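(* Let $m_0,m_1>0$. There exists a constant $\kappa_0=\kappa_0(m_0,m_1)$ such that the following holds for every integer $a\ge1$ and every $\kappa\ge\kappa_0$. Let $\alpha\in(0,1]$, $R>0$ and suppose $f_0\in\mathcal H(\alpha,R)\cap\mathcal F(m_0,m_1)$. Let $X=(X_1,\dots,X_n)$ be i.i.d. with density $f_0$ on $[0,1]$. Let $\Pi$ be the prior on densities induced by the Spike and Slab Pólya tree $\Pi(\alpha_\varepsilon,\pi_\varepsilon)$ with $$\alpha_\varepsilon=a,\qquad \pi_\varepsilon=e^{-\kappa l}\Big/\sum_{j=0}^L e^{-\kappa j},\quad l=|\varepsilon|.$$ Then for any $M$ large enough, as $n\to\infty$, in $P_{f_0}$-probability, $$\Pi\left[\|f-f_0\|_\infty\le M\left(\frac{\log n}{n}\right)^{\frac{\alpha}{2\alpha+1}}\,\Big|\,X\right]\to1.$$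
   Context: Haar basis on $[0,1]$: $\psi=-\mathbf 1_{(0,1/2]}+\mathbf 1_{(1/2,1]}$, $\psi_{lk}(x)=2^{l/2}\psi(2^lx-k)$ for $l\ge0$, $0\le k<2^l$ (together with $\varphi=\mathbf 1_{[0,1]}$); $f_{lk}=\int_0^1 f\psi_{lk}$. $\mathcal H(\alpha,R)=\{f: |f_{lk}|\le R2^{-l(\alpha+1/2)}\ \forall l\ge0,\,0\le k<2^l\}$; $\mathcal F(m_0,m_1)=\{f:\int_0^1f=1,\ m_0\le f\le m_1\}$. Finite binary words (including the empty word) are denoted $\varepsilon=\varepsilon_1\cdots\varepsilon_l$, $|\varepsilon|=l$; $\varepsilon0,\varepsilon1$ are $\varepsilon$ with $0$ or $1$ appended. $I_\emptyset=(0,1]$ and $I_\varepsilon=(k2^{-l},(k+1)2^{-l}]$ if $|\varepsilon|=l$ and $k2^{-l}=\sum_{i\le l}\varepsilon_i2^{-i}$. $L=L_n$ is the largest integer with $2^LL^2\le n$. Spike and Slab Pólya tree $\Pi(\alpha_\varepsilon,\pi_\varepsilon)$: take independent variables $Y_{\varepsilon0}\sim(1-\pi_{\varepsilon0})\delta_{1/2}+\pi_{\varepsilon0}\mathrm{Beta}(\alpha_{\varepsilon0},\alpha_{\varepsilon1})$ for $|\varepsilon|\le L-1$, set $Y_{\varepsilon1}=1-Y_{\varepsilon0}$ and $P(I_\varepsilon)=\prod_{j=1}^{|\varepsilon|}Y_{\varepsilon_1\cdots\varepsilon_j}$ for $|\varepsilon|\le L$. The random density $f$ is the histogram equal to $2^LP(I_\varepsilon)$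 on each $I_\varepsilon$, $|\varepsilon|=L$; the prior $\Pi$ is its law. $\Pi[\cdot\,|\,X]$ is the posterior distribution of $f$ in the model where, given $f$, $X_1,\dots,X_n$ are i.i.d. with density $f$. *)

theory Defs
  imports "HOL-Probability.Probability"
begin

abbreviation unit_lebesgue :: "real measure" where
  "unit_lebesgue \<equiv> restrict_space lborel {0..1}"

definition haar_psi :: "real \<Rightarrow> real" where
  "haar_psi x = - indicator {0<..1/2} x + indicator {1/2<..1} x"

definition haar_wavelet :: "nat \<Rightarrow> nat \<Rightarrow> real \<Rightarrow> real" where
  "haar_wavelet l k x = 2 powr (real l / 2) * haar_psi (2 ^ l * x - real k)"

definition haar_coeff :: "(real \<Rightarrow> real) \<Rightarrow> nat \<Rightarrow> nat \<Rightarrow> real" where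
  "haar_coeff f l k = (\<integral>x. f x * haar_wavelet l k x \<partial>unit_lebesgue)"

definition haar_ball :: "real \<Rightarrow> real \<Rightarrow> (real \<Rightarrow> real) set" where
  "haar_ball \<alpha> R =
     {f. \<forall>l. \<forall>k < 2 ^ l. \<bar>haar_coeff f l k\<bar> \<le> R * 2 powr (- real l * (\<alpha> + 1/2))}"

text \<open>Densities, Haar coefficients and the supremum norm only see a function up to Lebesgue
  null sets, so the bounds are required almost everywhere and the supremum norm is the norm of
  \<open>L\<^sup>\<infinity>[0,1]\<close>.\<close>

definition bounded_densities :: "real \<Rightarrow> real \<Rightarrow> (real \<Rightarrow> real) set" where
  "bounded_densities m0 m1 =
     {f \<in> borel_measurable unit_lebesgue.
        (\<integral>x. f x \<partial>unit_lebesgue) = 1 \<and> (AE x in unit_lebesgue. m0 \<le> f x \<and> f x \<le> m1)}"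

definition sup_norm :: "(real \<Rightarrow> real) \<Rightarrow> ereal" where
  "sup_norm f = esssup unit_lebesgue (\<lambda>x. ereal \<bar>f x\<bar>)"

text \<open>A binary word \<open>\<epsilon>\<^sub>1 \<dots> \<epsilon>\<^sub>l\<close> is a list of Booleans, \<open>True\<close> standing for the digit 1;
  the letter \<open>\<epsilon>\<^sub>i\<close> is the list entry with index \<open>i - 1\<close>.\<close>

type_synonym word = "bool list"

definition dyadic_left :: "word \<Rightarrow> real" where
  "dyadic_left \<epsilon> = (\<Sum>i < length \<epsilon>. of_bool (\<epsilon> ! i) / 2 ^ Suc i)"

definition dyadic_interval :: "word \<Rightarrow> real set" where
  "dyadic_interval \<epsilon> = {dyadic_left \<epsilon> <.. dyadic_left \<epsilon> + 1 / 2 ^ length \<epsilon>}"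

definition beta_distribution :: "real \<Rightarrow> real \<Rightarrow> real measure" where
  "beta_distribution a b =
     density lborel (\<lambda>x. ennreal
       (indicator {0<..<1} x * x powr (a - 1) * (1 - x) powr (b - 1) / Beta a b))"

text \<open>The mixture \<open>(1 - p) \<delta>\<^bsub>1/2\<^esub> + p Beta(a, b)\<close>.\<close>

definition spike_slab :: "real \<Rightarrow> real \<Rightarrow> real \<Rightarrow> real measure" where
  "spike_slab p a b =
     measure_pmf (bernoulli_pmf p) \<bind>
       (\<lambda>slab. if slab then beta_distribution a b else return borel (1/2))"

text \<open>Joint law of the independent left splits: the coordinate with index \<open>\<epsilon>\<close> is \<open>Y\<^bsub>\<epsilon>0\<^esub>\<close>.\<close>

definition split_law :: "nat \<Rightarrow> (word \<Rightarrow> real) \<Rightarrow> (word \<Rightarrow> real) \<Rightarrow> (word \<Rightarrow> real) measure" where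
  "split_law L \<alpha> \<pi> =
     (\<Pi>\<^sub>M \<epsilon> \<in> {\<epsilon>. length \<epsilon> < L}.
        spike_slab (\<pi> (\<epsilon> @ [False])) (\<alpha> (\<epsilon> @ [False])) (\<alpha> (\<epsilon> @ [True])))"

definition split_var :: "(word \<Rightarrow> real) \<Rightarrow> word \<Rightarrow> real" where
  "split_var y \<epsilon> = (if last \<epsilon> then 1 - y (butlast \<epsilon>) else y (butlast \<epsilon>))"

definition tree_mass :: "(word \<Rightarrow> real) \<Rightarrow> word \<Rightarrow> real" where
  "tree_mass y \<epsilon> = (\<Prod>j = 1..length \<epsilon>. split_var y (take j \<epsilon>))"

definition tree_density :: "nat \<Rightarrow> (word \<Rightarrow> real) \<Rightarrow> real \<Rightarrow> real" where
  "tree_density L y x =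
     (\<Sum>\<epsilon> | length \<epsilon> = L. 2 ^ L * tree_mass y \<epsilon> * indicator (dyadic_interval \<epsilon>) x)"

text \<open>The prior is the law of the random histogram. The set of functions carries the final
  sigma-algebra, that is, the largest one for which the histogram is a random variable. The
  probability of any event \<open>A\<close> is then that of the histogram lying in \<open>A\<close> whenever this makes
  sense; this covers point evaluations and balls for the supremum norm.\<close>

definition spike_slab_Polya_tree ::
    "nat \<Rightarrow> (word \<Rightarrow> real) \<Rightarrow> (word \<Rightarrow> real) \<Rightarrow> (real \<Rightarrow> real) measure" where
  "spike_slab_Polya_tree L \<alpha> \<pi> =
     distr (split_law L \<alpha> \<pi>)
       (sigma UNIV {A. tree_density L -` A \<inter> space (split_law L \<alpha> \<pi>) \<in> sets (split_law L \<alpha> \<pi>)})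
       (tree_density L)"

definition tree_depth :: "nat \<Rightarrow> nat" where
  "tree_depth n = (GREATEST L. 2 ^ L * L ^ 2 \<le> n)"

definition slab_weight :: "real \<Rightarrow> nat \<Rightarrow> word \<Rightarrow> real" where
  "slab_weight \<kappa> L \<epsilon> = exp (- \<kappa> * length \<epsilon>) / (\<Sum>j = 0..L. exp (- \<kappa> * real j))"

definition iid_law :: "nat \<Rightarrow> (real \<Rightarrow> real) \<Rightarrow> (nat \<Rightarrow> real) measure" where
  "iid_law n f = (\<Pi>\<^sub>M i \<in> {..<n}. density unit_lebesgue (\<lambda>x. ennreal (f x)))"

definition likelihood :: "nat \<Rightarrow> (nat \<Rightarrow> real) \<Rightarrow> (real \<Rightarrow> real) \<Rightarrow> ennreal" where
  "likelihood n X f = (\<Prod>i<n. ennreal (f (X i)))"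

text \<open>Bayes' formula: all distributions in the model are dominated by Lebesgue measure.\<close>

definition posterior ::
    "(real \<Rightarrow> real) measure \<Rightarrow> nat \<Rightarrow> (nat \<Rightarrow> real) \<Rightarrow> (real \<Rightarrow> real) measure" where
  "posterior prior n X =
     density prior (\<lambda>f. likelihood n X f / (\<integral>\<^sup>+ g. likelihood n X g \<partial>prior))"

text \<open>Convergence in probability of \<open>Z\<^sub>n\<close> to \<open>c\<close>, where \<open>Z\<^sub>n\<close> lives on its own probability
  space \<open>P\<^sub>n\<close>.\<close>

definition converges_in_prob ::
    "(nat \<Rightarrow> 'a measure) \<Rightarrow> (nat \<Rightarrow> 'a \<Rightarrow> real) \<Rightarrow> real \<Rightarrow> bool" where
  "converges_in_prob P Z c \<longleftrightarrow>
     (\<forall>\<eta>>0. (\<lambda>n. measure (P n) {\<omega> \<in> space (P n). \<bar>Z n \<omega> - c\<bar> > \<eta>}) \<longlonglongrightarrow> 0)"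

end

theory Submission
  imports Defs "HOL-Real_Asymp.Real_Asymp"
begin

text \<open>On the unit interval a tree histogram is a product over the words of factors depending on one
  split each, so the likelihood factorises over the words and the posterior mass of the event that
  some split is bad is at most a sum of one-dimensional ratios of integrals of
  \<open>(2y)\<^sup>N\<^sup>0 (2(1-y))\<^sup>N\<^sup>1\<close> against the spike and slab law. On an event of probability tending to one
  (Chernoff and a union bound over the cells, whose expected counts dominate \<open>ln n\<close>) these ratios are
  all \<open>O(n\<^sup>-\<^sup>2)\<close>. At levels where the Haar coefficients of \<open>f0\<close> are below the noise
  \<open>sqrt (ln n / n)\<close> the likelihood ratio of slab against spike is polynomial in \<open>n\<close> with a degree
  depending on \<open>m0\<close> only; since such levels are at least \<open>ln n / 4\<close> the prior weight beats it when
  \<open>\<kappa>\<close> is large, and the split is exactly \<open>1/2\<close>. At the other levels spike and slab are treated at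
  once: the likelihood of a split at distance \<open>r\<close> from its mode is smaller by \<open>exp (- N r\<^sup>2 / 2)\<close>, and
  the slab puts mass of order \<open>1/N\<close> where the likelihood is within a factor 2 of its maximum. The
  ratio of the histogram to that of \<open>f0\<close> is the product of the ratios of the splits, so the
  relative errors of the splits add up, and they are dominated geometrically by the critical level.\<close>

section \<open>One coordinate of the tree\<close>

text \<open>The penalty \<kappa> acts in two opposite ways. At high levels it must outweigh a
  possible likelihood gain of \<open>n powr (4 / m0 + 128)\<close>; since \<alpha> \<le> 1 keeps
  these levels above \<open>ln n / 4\<close>, this fixes \<kappa>0 through m0 alone, for all
  \<alpha>, R and a. At low levels the same penalty is a cost, but the depth is at most
  \<open>2 * ln n\<close>, so it costs a fixed power of n, which a wider tolerance pays for. This is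
  why M depends on \<kappa>, and why no lower bound on the coefficients of \<open>f0\<close> is
  required: a slab never has to be detected.

  The depth is squeezed from both sides. The factor \<open>L\<^sup>2\<close> leaves every cell with
  an expected count of order at least the square of \<open>ln n\<close>, enough for uniform
  concentration, while \<open>2 ^ L\<close> is still n up to logarithms, enough for the truncation
  bias to be below the rate. As there are at most n nodes, bounds of order
  \<open>1 / n\<^sup>2\<close> per node or cell survive the union as O(1/n).\<close>

definition split_lik :: "nat \<Rightarrow> nat \<Rightarrow> real \<Rightarrow> real" where
  "split_lik N0 N1 y = (2 * y) ^ N0 * (2 * (1 - y)) ^ N1"

lemma split_lik_nonneg: "0 \<le> y \<Longrightarrow> y \<le> 1 \<Longrightarrow> 0 \<le> split_lik N0 N1 y"
  by (simp add: split_lik_def)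

lemma split_lik_half [simp]: "split_lik N0 N1 (1/2) = 1"
  by (simp add: split_lik_def)

lemma split_lik_measurable [measurable]: "split_lik N0 N1 \<in> borel_measurable borel"
  unfolding split_lik_def by measurable

text \<open>The left side is minus the squared Hellinger distance of two Bernoulli laws. Since
  \<open>sqrt u + sqrt v\<close> is at most 2 on the unit interval, each squared difference of roots
  is at least a quarter of the squared difference of the arguments, and both of these are
  \<open>(y - q)\<^sup>2\<close>.\<close>

lemma sqrt_affinity_le:
  fixes q y :: real
  assumes "0 \<le> q" "q \<le> 1" "0 \<le> y" "y \<le> 1"
  shows "2 * (sqrt (q * y) + sqrt ((1 - q) * (1 - y)) - 1) \<le> - ((y - q)\<^sup>2 / 2)"
proof -
  have *: "(v - u)\<^sup>2 / 4 \<le> (sqrt u - sqrt v)\<^sup>2" if "0 \<le> u" "u \<le> 1" "0 \<le> v" "v \<le> 1" for u v :: real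
  proof -
    have "v - u = (sqrt v - sqrt u) * (sqrt v + sqrt u)"
      using that by (simp add: algebra_simps)
    then have "(v - u)\<^sup>2 = (sqrt u - sqrt v)\<^sup>2 * (sqrt v + sqrt u)\<^sup>2"
      by (simp add: power_mult_distrib power2_commute)
    also have "sqrt v + sqrt u \<le> 2"
      using add_mono[of "sqrt v" 1 "sqrt u" 1] that by simp
    then have "(sqrt u - sqrt v)\<^sup>2 * (sqrt v + sqrt u)\<^sup>2 \<le> (sqrt u - sqrt v)\<^sup>2 * 2\<^sup>2"
      using that by (intro mult_left_mono power_mono) auto
    finally show ?thesis by simp
  qed
  have "2 * (sqrt (q * y) + sqrt ((1 - q) * (1 - y)) - 1)
      = - (sqrt q - sqrt y)\<^sup>2 - (sqrt (1 - q) - sqrt (1 - y))\<^sup>2"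
    using assms by (simp only: power2_diff real_sqrt_mult) simp
  also have "\<dots> \<le> - ((y - q)\<^sup>2 / 4) - ((1 - y) - (1 - q))\<^sup>2 / 4"
    using *[of q y] *[of "1 - q" "1 - y"] assms by linarith
  also have "((1 - y) - (1 - q))\<^sup>2 = (y - q)\<^sup>2" by (simp add: power2_commute)
  finally show ?thesis by simp
qed

text \<open>This is x \<le> exp (x - 1) at the root of the ratio, raised to the power 2n. The root
  is essential: with the ratio itself the exponents for \<open>q\<close> and for
  \<open>1 - q\<close> would cancel in the product, and no quadratic decay would remain.\<close>

lemma power_le_exp_sqrt:
  fixes q y :: real
  assumes "0 < q" "0 \<le> y"
  shows "y ^ n \<le> q ^ n * exp (2 * real n * (sqrt (y / q) - 1))"
proof -
  have "sqrt (y / q) \<le> exp (sqrt (y / q) - 1)"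
    using exp_ge_add_one_self[of "sqrt (y / q) - 1"] by simp
  then have "sqrt (y / q) ^ (2 * n) \<le> exp (sqrt (y / q) - 1) ^ (2 * n)"
    using assms by (intro power_mono) auto
  moreover have "sqrt (y / q) ^ (2 * n) = (y / q) ^ n"
    using assms by (simp add: power_mult)
  moreover have "exp (sqrt (y / q) - 1) ^ (2 * n) = exp (2 * real n * (sqrt (y / q) - 1))"
    by (simp add: exp_of_nat_mult[symmetric])
  ultimately have "(y / q) ^ n \<le> exp (2 * real n * (sqrt (y / q) - 1))" by simp
  then show ?thesis using assms by (simp add: power_divide field_simps)
qed

lemma mult_sqrt_divide:
  fixes q y :: real
  assumes "0 < q"
  shows "q * sqrt (y / q) = sqrt (q * y)"
proof -
  have "q * y = q\<^sup>2 * (y / q)" using assms by (simp add: power2_eq_square)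
  also have "sqrt \<dots> = q * sqrt (y / q)"
    using assms by (simp only: real_sqrt_mult) simp
  finally show ?thesis by simp
qed

text \<open>Pinsker's inequality for Bernoulli laws, through the Hellinger affinity.\<close>

lemma split_lik_le_exp:
  fixes y :: real
  assumes "N0 > 0" "N1 > 0" "0 \<le> y" "y \<le> 1"
  defines "q \<equiv> real N0 / real (N0 + N1)"
  shows "split_lik N0 N1 y \<le> split_lik N0 N1 q * exp (- real (N0 + N1) * (y - q)\<^sup>2 / 2)"
proof -
  define N where "N = real (N0 + N1)"
  have N: "N > 0" "real N0 = N * q" "real N1 = N * (1 - q)"
    using assms by (auto simp: N_def q_def field_simps)
  have q: "0 < q" "q < 1" using assms by (auto simp: q_def field_simps)
  have A: "2 * real N0 * (sqrt (y / q) - 1) = 2 * N * (sqrt (q * y) - q)"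
    unfolding N(2) mult_sqrt_divide[OF q(1), of y, symmetric] by (simp add: algebra_simps)
  have B: "2 * real N1 * (sqrt ((1 - y) / (1 - q)) - 1) = 2 * N * (sqrt ((1 - q) * (1 - y)) - (1 - q))"
  proof -
    have "1 - q > 0" using q by simp
    note * = mult_sqrt_divide[OF this, of "1 - y"]
    have "2 * (N * (1 - q)) * (s - 1) = 2 * N * ((1 - q) * s - (1 - q))" for s
      by (simp add: algebra_simps)
    then show ?thesis unfolding N(3) *[symmetric] .
  qed
  have "y ^ N0 * (1 - y) ^ N1 \<le> (q ^ N0 * exp (2 * real N0 * (sqrt (y / q) - 1)))
     * ((1 - q) ^ N1 * exp (2 * real N1 * (sqrt ((1 - y) / (1 - q)) - 1)))"
    using q assms(3,4) by (intro mult_mono power_le_exp_sqrt) auto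
  also have "\<dots> = q ^ N0 * (1 - q) ^ N1 *
     exp (N * (2 * (sqrt (q * y) + sqrt ((1 - q) * (1 - y)) - 1)))"
    unfolding A B by (simp add: exp_add[symmetric] algebra_simps)
  also have "\<dots> \<le> q ^ N0 * (1 - q) ^ N1 * exp (N * (- ((y - q)\<^sup>2 / 2)))"
    using q N(1) assms(3,4) sqrt_affinity_le[of q y]
    by (intro mult_left_mono iffD2[OF exp_le_cancel_iff]) auto
  finally have "2 ^ N0 * 2 ^ N1 * (y ^ N0 * (1 - y) ^ N1)
     \<le> 2 ^ N0 * 2 ^ N1 * (q ^ N0 * (1 - q) ^ N1 * exp (N * (- ((y - q)\<^sup>2 / 2))))"
    by (intro mult_left_mono) auto
  moreover have "N * (- ((y - q)\<^sup>2 / 2)) = - real (N0 + N1) * (y - q)\<^sup>2 / 2"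
    unfolding N_def by (simp only: mult_minus_left mult_minus_right times_divide_eq_right minus_divide_left)
  ultimately show ?thesis unfolding split_lik_def power_mult_distrib by (simp only: mult_ac)
qed

text \<open>1 + x \<le> exp x is used at x = 2q - 1 and at x = 1 - 2q. The exponent is Pearson's
  chi-square statistic for a fair split; it caps the gain of any slab value over the spike, whose
  likelihood is 1.\<close>

lemma split_lik_mode_le:
  assumes "N0 > 0" "N1 > 0"
  defines "q \<equiv> real N0 / real (N0 + N1)"
  shows "split_lik N0 N1 q \<le> exp ((real N0 - real N1)\<^sup>2 / real (N0 + N1))"
proof -
  have q: "0 < q" "q < 1" using assms by (auto simp: q_def field_simps)
  have "split_lik N0 N1 q \<le> exp (2 * q - 1) ^ N0 * exp (2 * (1 - q) - 1) ^ N1"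
    unfolding split_lik_def
    using q exp_ge_add_one_self[of "2 * q - 1"] exp_ge_add_one_self[of "2 * (1 - q) - 1"]
    by (intro mult_mono power_mono) auto
  also have "\<dots> = exp (real N0 * (2 * q - 1) + real N1 * (2 * (1 - q) - 1))"
    by (simp add: exp_of_nat_mult[symmetric] exp_add)
  also have "real N0 * (2 * q - 1) + real N1 * (2 * (1 - q) - 1)
     = (real N0 - real N1)\<^sup>2 / real (N0 + N1)"
  proof -
    have "2 * q - 1 = (real N0 - real N1) / real (N0 + N1)"
      using assms by (simp add: q_def field_simps)
    moreover have "real N0 * (2 * q - 1) + real N1 * (2 * (1 - q) - 1) = (real N0 - real N1) * (2 * q - 1)"
      by (simp add: algebra_simps)
    ultimately show ?thesis by (simp add: power2_eq_square)
  qed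
  finally show ?thesis .
qed

text \<open>To the right of the mode the power of y only grows, and Bernoulli's inequality limits
  the loss in the power of 1 - y. The window is narrower than the peak of the likelihood, but this
  loses only a power of N, which the tail bound can absorb.\<close>

lemma split_lik_near_mode_ge:
  fixes y :: real
  assumes "N0 > 0" "N1 > 0"
  defines "N \<equiv> N0 + N1"
  defines "q \<equiv> real N0 / real N"
  assumes y: "q \<le> y" "y \<le> q + 1 / (2 * real N)" "y \<le> 1"
  shows "split_lik N0 N1 q / 2 \<le> split_lik N0 N1 y"
proof -
  have q: "0 < q" "q < 1" "real N1 = real N * (1 - q)" "real N > 0"
    using assms by (auto simp: q_def N_def field_simps)
  have "1 / 2 \<le> 1 - real N * (y - q)"
    using y q by (simp add: field_simps)
  also have "\<dots> = 1 + real N1 * (- ((y - q) / (1 - q)))"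
    using q by simp
  also have "\<dots> \<le> (1 + - ((y - q) / (1 - q))) ^ N1"
    using q y by (intro Bernoulli_inequality) (simp add: field_simps)
  also have "1 + - ((y - q) / (1 - q)) = (1 - y) / (1 - q)"
    using q by (simp add: field_simps)
  finally have "1 / 2 \<le> (1 - y) ^ N1 / (1 - q) ^ N1"
    by (simp add: power_divide)
  then have "(1 - q) ^ N1 / 2 \<le> (1 - y) ^ N1"
    using q by (simp add: field_simps)
  then have "2 ^ N1 * ((1 - q) ^ N1 / 2) \<le> 2 ^ N1 * (1 - y) ^ N1"
    by (intro mult_left_mono) auto
  moreover have "(2 * q) ^ N0 \<le> (2 * y) ^ N0"
    using q y by (intro power_mono) auto
  ultimately have "(2 * q) ^ N0 * (2 ^ N1 * ((1 - q) ^ N1 / 2)) \<le> (2 * y) ^ N0 * (2 ^ N1 * (1 - y) ^ N1)"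
    using q y by (intro mult_mono) auto
  then show ?thesis unfolding split_lik_def power_mult_distrib[of 2 "1 - q"] power_mult_distrib[of 2 "1 - y"]
    by simp
qed

section \<open>The Beta and the spike and slab laws of one split\<close>

lemma sets_beta_distribution [simp, measurable_cong]: "sets (beta_distribution a b) = sets borel"
  by (simp add: beta_distribution_def)

lemma prob_space_beta_distribution:
  assumes "a > 0" "b > 0"
  shows "prob_space (beta_distribution a b)"
proof
  have Beta_pos: "Beta a b > 0" using assms by (simp add: Beta_def)
  let ?f = "\<lambda>x::real. x powr (a - 1) * (1 - x) powr (b - 1)"
  have "(?f has_integral Beta a b) {0<..<1}"
    using has_integral_Beta_real[OF assms] by (simp add: has_integral_Icc_iff_Ioo)
  then have "((\<lambda>x. ?f x * (1 / Beta a b)) has_integral (Beta a b * (1 / Beta a b))) {0<..<1}"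
    by (rule has_integral_mult_left)
  then have "((\<lambda>x. ?f x / Beta a b) has_integral 1) {0<..<1}"
    using Beta_pos by simp
  then have "((\<lambda>x. if x \<in> {0<..<1} then ?f x / Beta a b else 0) has_integral 1) UNIV"
    by (subst has_integral_restrict_UNIV)
  also have "(\<lambda>x. if x \<in> {0<..<1} then ?f x / Beta a b else 0)
     = (\<lambda>x. indicator {0<..<1} x * x powr (a - 1) * (1 - x) powr (b - 1) / Beta a b)"
    by (auto simp: fun_eq_iff)
  finally have *: "((\<lambda>x. indicator {0<..<1} x * x powr (a - 1) * (1 - x) powr (b - 1) / Beta a b)
     has_integral 1) UNIV" .
  have "(\<integral>\<^sup>+ x. ennreal (indicator {0<..<1} x * x powr (a - 1) * (1 - x) powr (b - 1) / Beta a b)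
      \<partial>lborel) = ennreal 1"
    using * Beta_pos by (intro nn_integral_has_integral_lborel) (auto simp: indicator_def)
  then show "emeasure (beta_distribution a b) (space (beta_distribution a b)) = 1"
    unfolding beta_distribution_def by (subst emeasure_density) auto
qed

lemma sets_spike_slab [simp, measurable_cong]: "sets (spike_slab p a b) = sets borel"
  by (auto simp: spike_slab_def)

lemma space_spike_slab [simp]: "space (spike_slab p a b) = UNIV"
  using sets_spike_slab[THEN sets_eq_imp_space_eq] by simp

lemma spike_slab_kernel:
  assumes "a > 0" "b > 0"
  shows "(\<lambda>slab. if slab then beta_distribution a b else return borel (1/2))
     \<in> measurable (measure_pmf (bernoulli_pmf p)) (subprob_algebra borel)"
  using prob_space_beta_distribution[OF assms]
  by (auto simp: space_subprob_algebra prob_space_imp_subprob_space prob_space_return)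

lemma prob_space_spike_slab:
  assumes "a > 0" "b > 0"
  shows "prob_space (spike_slab p a b)"
  unfolding spike_slab_def
  using prob_space_beta_distribution[OF assms]
  by (intro prob_space.prob_space_bind[OF _ _ spike_slab_kernel[OF assms]] measure_pmf.prob_space_axioms)
     (auto simp: prob_space_return)

lemma nn_integral_spike_slab:
  assumes "a > 0" "b > 0" "0 \<le> p" "p \<le> 1" and [measurable]: "h \<in> borel_measurable borel"
  shows "(\<integral>\<^sup>+ y. h y \<partial>spike_slab p a b)
     = ennreal p * (\<integral>\<^sup>+ y. h y \<partial>beta_distribution a b) + ennreal (1 - p) * h (1/2)"
proof -
  have "(\<integral>\<^sup>+ y. h y \<partial>spike_slab p a b) =
     (\<integral>\<^sup>+ s. \<integral>\<^sup>+ y. h y \<partial>(if s then beta_distribution a b else return borel (1/2)) \<partial>bernoulli_pmf p)"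
    unfolding spike_slab_def
    by (intro nn_integral_bind[where B = borel] spike_slab_kernel assms)
  also have "\<dots> = ennreal p * (\<integral>\<^sup>+ y. h y \<partial>beta_distribution a b) + ennreal (1 - p) * h (1/2)"
    using assms by (simp add: nn_integral_return mult.commute)
  finally show ?thesis .
qed

lemma AE_beta_distribution: "AE y in beta_distribution a b. 0 \<le> y \<and> y \<le> 1"
  unfolding beta_distribution_def
  by (subst AE_density) (auto simp: indicator_def)

lemma AE_spike_slab:
  assumes "a > 0" "b > 0" "0 \<le> p" "p \<le> 1"
  shows "AE y in spike_slab p a b. 0 \<le> y \<and> y \<le> 1"
proof (rule AE_I')
  have "(\<integral>\<^sup>+ y. indicator (- {0..1}) y \<partial>beta_distribution a b) = (\<integral>\<^sup>+ y. 0 \<partial>beta_distribution a b)"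
    by (intro nn_integral_cong_AE) (use AE_beta_distribution[of a b] in eventually_elim, auto)
  then have "(\<integral>\<^sup>+ y. indicator (- {0..1}) y \<partial>spike_slab p a b) = 0"
    by (subst nn_integral_spike_slab[OF assms]) auto
  then show "- {0..1} \<in> null_sets (spike_slab p a b)"
    by (subst (asm) nn_integral_indicator) (auto simp: null_sets_def)
qed auto

text \<open>For a \<ge> 1 the function \<open>x powr (a - 1)\<close> is nondecreasing, so at
  distance c from the endpoints both factors of the density are at least
  \<open>c powr (a - 1)\<close>.\<close>

lemma emeasure_beta_interval_ge:
  assumes a: "a \<ge> 1" and "0 < c" "c \<le> u" "u \<le> v" "v \<le> 1 - c"
  shows "emeasure (beta_distribution a a) {u..v} \<ge> ennreal (c powr (2 * (a - 1)) / Beta a a * (v - u))"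
proof -
  have Beta_pos: "Beta a a > 0" using assms by (simp add: Beta_def)
  have le: "c powr (2 * (a - 1)) / Beta a a
      \<le> indicator {0<..<1} x * x powr (a - 1) * (1 - x) powr (a - 1) / Beta a a"
    if "x \<in> {u..v}" for x
  proof -
    have "c powr (2 * (a - 1)) = c powr (a - 1) * c powr (a - 1)"
      by (simp add: powr_add[symmetric])
    also have "\<dots> \<le> x powr (a - 1) * (1 - x) powr (a - 1)"
      using assms that by (intro mult_mono powr_mono2) auto
    finally show ?thesis using assms that Beta_pos by (auto intro!: divide_right_mono)
  qed
  have "(\<integral>\<^sup>+ x. ennreal (c powr (2 * (a - 1)) / Beta a a) * indicator {u..v} x \<partial>lborel)
     \<le> (\<integral>\<^sup>+ x. ennreal (indicator {0<..<1} x * x powr (a - 1) * (1 - x) powr (a - 1) / Beta a a)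
          * indicator {u..v} x \<partial>lborel)"
  proof (intro nn_integral_mono)
    fix x
    show "ennreal (c powr (2 * (a - 1)) / Beta a a) * indicator {u..v} x
      \<le> ennreal (indicator {0<..<1} x * x powr (a - 1) * (1 - x) powr (a - 1) / Beta a a) * indicator {u..v} x"
      using le[of x] by (cases "x \<in> {u..v}") (auto intro!: ennreal_leI)
  qed
  moreover have "(\<integral>\<^sup>+ x. ennreal (c powr (2 * (a - 1)) / Beta a a) * indicator {u..v} x \<partial>lborel)
      = ennreal (c powr (2 * (a - 1)) / Beta a a * (v - u))"
    using assms Beta_pos by (simp add: nn_integral_cmult ennreal_mult'[symmetric])
  ultimately show ?thesis
    unfolding beta_distribution_def by (subst emeasure_density) auto
qed

section \<open>Posterior ratios for one split\<close>

lemma set_nn_integral_le_sup: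
  assumes "prob_space M" "AE y in M. y \<in> A \<longrightarrow> h y \<le> C" "A \<in> sets M"
  shows "(\<integral>\<^sup>+ y. h y * indicator A y \<partial>M) \<le> C"
proof -
  interpret prob_space M by fact
  have "(\<integral>\<^sup>+ y. h y * indicator A y \<partial>M) \<le> (\<integral>\<^sup>+ y. C \<partial>M)"
    by (intro nn_integral_mono_AE) (use assms(2) in eventually_elim, auto simp: indicator_def)
  then show ?thesis by (simp add: emeasure_space_1)
qed

text \<open>Removing the point 1/2 leaves only the slab, which contributes at most p times the
  maximal likelihood. The denominator is at least the spike's share \<open>1 - p\<close>, because
  the likelihood at 1/2 is 1.\<close>

lemma slab_posterior_le:
  assumes "a > 0" "0 \<le> p" "p < 1" "N0 > 0" "N1 > 0"
  shows "(\<integral>\<^sup>+ y. ennreal (split_lik N0 N1 y) * indicator (- {1/2}) y \<partial>spike_slab p a a)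
    \<le> ennreal (p / (1 - p) * exp ((real N0 - real N1)\<^sup>2 / real (N0 + N1)))
        * (\<integral>\<^sup>+ y. ennreal (split_lik N0 N1 y) \<partial>spike_slab p a a)"
proof -
  define E where "E = exp ((real N0 - real N1)\<^sup>2 / real (N0 + N1))"
  define q where "q = real N0 / real (N0 + N1)"
  have q: "0 < q" "q < 1" using assms by (auto simp: q_def field_simps)
  have sup: "split_lik N0 N1 y \<le> E" if "0 \<le> y" "y \<le> 1" for y
  proof -
    have "split_lik N0 N1 y \<le> split_lik N0 N1 q * exp (- real (N0 + N1) * (y - q)\<^sup>2 / 2)"
      unfolding q_def by (rule split_lik_le_exp) (use assms that in auto)
    also have "\<dots> \<le> split_lik N0 N1 q"
    proof (intro mult_left_le split_lik_nonneg)
      have "real (N0 + N1) * (y - q)\<^sup>2 \<ge> 0" by (intro mult_nonneg_nonneg) auto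
      then show "exp (- real (N0 + N1) * (y - q)\<^sup>2 / 2) \<le> 1"
        unfolding exp_le_one_iff minus_mult_left[symmetric] by linarith
    qed (use q in auto)
    also have "\<dots> \<le> E" unfolding E_def q_def using assms by (intro split_lik_mode_le) auto
    finally show ?thesis .
  qed
  have "(\<integral>\<^sup>+ y. ennreal (split_lik N0 N1 y) * indicator (- {1/2}) y \<partial>spike_slab p a a)
     = ennreal p * (\<integral>\<^sup>+ y. ennreal (split_lik N0 N1 y) * indicator (- {1/2}) y \<partial>beta_distribution a a)"
    using assms by (subst nn_integral_spike_slab) auto
  also have "\<dots> \<le> ennreal p * ennreal E"
    by (intro mult_left_mono set_nn_integral_le_sup prob_space_beta_distribution assms)
       (use AE_beta_distribution[of a a] in \<open>auto intro!: ennreal_leI sup\<close>)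
  also have "\<dots> = ennreal (p / (1 - p) * E) * ennreal (1 - p)"
    using assms by (simp add: ennreal_mult'[symmetric] E_def)
  also have "ennreal (1 - p) \<le> (\<integral>\<^sup>+ y. ennreal (split_lik N0 N1 y) \<partial>spike_slab p a a)"
    using assms by (subst nn_integral_spike_slab) (auto intro: add_increasing)
  finally show ?thesis unfolding E_def by (simp add: mult_left_mono)
qed

text \<open>The numerator is at most the likelihood S at the mode times the Gaussian factor, whether
  the mass in A comes from spike or slab. The denominator is at least p times S/2 times the Beta
  mass of a short window to the right of the mode, and S cancels. In
  \<open>c powr (2 * a - 1)\<close> the density contributes \<open>2 * (a - 1)\<close> and the width
  of the window the remaining 1.\<close>

lemma split_posterior_tail_le:
  assumes a: "a \<ge> 1" and p: "0 < p" "p \<le> 1" and N: "N0 > 0" "N1 > 0" and c: "0 < c" "r \<ge> 0"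
  defines "N \<equiv> N0 + N1"
  defines "q \<equiv> real N0 / real N"
  assumes q: "2 * c \<le> q" "q \<le> 1 - 2 * c" and A[measurable]: "A \<in> sets borel"
    and far: "\<And>y. y \<in> A \<Longrightarrow> r \<le> \<bar>y - q\<bar>"
  shows "(\<integral>\<^sup>+ y. ennreal (split_lik N0 N1 y) * indicator A y \<partial>spike_slab p a a)
    \<le> ennreal (4 * Beta a a / c powr (2 * a - 1) * real N / p * exp (- real N * r\<^sup>2 / 2))
        * (\<integral>\<^sup>+ y. ennreal (split_lik N0 N1 y) \<partial>spike_slab p a a)"
proof -
  have Beta_pos: "Beta a a > 0" using assms by (simp add: Beta_def)
  have Npos: "real N \<ge> 1" using N by (simp add: N_def)
  have c1: "c < 1" using q c by linarith
  define k where "k = c powr (2 * (a - 1)) / Beta a a"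
  \<comment> \<open>Being at most c keeps the window inside \<open>{c..1 - c}\<close>, where the
    Beta density is bounded below; being at most 1/(2N) keeps the likelihood above half its
    maximum.\<close>
  define t where "t = c / (2 * real N)"
  define S where "S = split_lik N0 N1 q"
  have kpos: "k > 0" using c Beta_pos by (simp add: k_def)
  have tpos: "t > 0" using c Npos by (simp add: t_def)
  have tc: "t \<le> c" "t \<le> 1 / (2 * real N)"
    using c Npos c1 unfolding t_def by (auto simp: field_simps)
  have S: "S \<ge> 0" using q c by (auto simp: S_def intro!: split_lik_nonneg)
  let ?Z = "\<integral>\<^sup>+ y. ennreal (split_lik N0 N1 y) \<partial>spike_slab p a a"
  have "ennreal (p * (S / 2 * (k * t))) = ennreal p * (ennreal (S / 2) * ennreal (k * (q + t - q)))"
    using p S kpos tpos by (simp add: ennreal_mult'[symmetric])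
  also have "\<dots> \<le> ennreal p * (ennreal (S / 2) * emeasure (beta_distribution a a) {q..q + t})"
    unfolding k_def using a c q tc tpos
    by (intro mult_left_mono emeasure_beta_interval_ge) auto
  also have "\<dots> = ennreal p * (\<integral>\<^sup>+ y. ennreal (S / 2) * indicator {q..q + t} y \<partial>beta_distribution a a)"
    by (simp add: nn_integral_cmult_indicator)
  also have "\<dots> \<le> ennreal p * (\<integral>\<^sup>+ y. ennreal (split_lik N0 N1 y) \<partial>beta_distribution a a)"
  proof (intro mult_left_mono nn_integral_mono)
    fix y show "ennreal (S / 2) * indicator {q..q + t} y \<le> ennreal (split_lik N0 N1 y)"
    proof (cases "y \<in> {q..q + t}")
      case True
      have "S / 2 \<le> split_lik N0 N1 y"
        unfolding S_def q_def N_def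
        by (rule split_lik_near_mode_ge) (use True tc N q c in \<open>auto simp: q_def N_def\<close>)
      then show ?thesis by (auto simp: indicator_def intro: ennreal_leI)
    qed auto
  qed auto
  also have "\<dots> \<le> ?Z"
    using assms by (subst nn_integral_spike_slab) auto
  finally have Z: "ennreal (p * (S / 2 * (k * t))) \<le> ?Z" .
  have "(\<integral>\<^sup>+ y. ennreal (split_lik N0 N1 y) * indicator A y \<partial>spike_slab p a a)
     \<le> ennreal (S * exp (- real N * r\<^sup>2 / 2))"
  proof (intro set_nn_integral_le_sup prob_space_spike_slab)
    have "ennreal (split_lik N0 N1 y) \<le> ennreal (S * exp (- real N * r\<^sup>2 / 2))"
      if "0 \<le> y" "y \<le> 1" "y \<in> A" for y
    proof (rule ennreal_leI)
      have "split_lik N0 N1 y \<le> S * exp (- real N * (y - q)\<^sup>2 / 2)"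
        unfolding S_def q_def N_def by (rule split_lik_le_exp) (use N that in auto)
      also have "r\<^sup>2 \<le> (y - q)\<^sup>2"
        using far[OF that(3)] c by (metis power2_abs power_mono)
      then have "S * exp (- real N * (y - q)\<^sup>2 / 2) \<le> S * exp (- real N * r\<^sup>2 / 2)"
        using S Npos by (intro mult_left_mono) auto
      finally show "split_lik N0 N1 y \<le> S * exp (- real N * r\<^sup>2 / 2)" .
    qed
    then show "AE y in spike_slab p a a. y \<in> A \<longrightarrow>
        ennreal (split_lik N0 N1 y) \<le> ennreal (S * exp (- real N * r\<^sup>2 / 2))"
      using AE_spike_slab[of a a p] a p by auto
  qed (use a in auto)
  also have "S * exp (- real N * r\<^sup>2 / 2) =
    (4 * real N / (k * c) / p * exp (- real N * r\<^sup>2 / 2)) * (p * (S / 2 * (k * t)))"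
    using p Npos c kpos by (simp add: t_def field_simps)
  also have "ennreal \<dots> = ennreal (4 * real N / (k * c) / p * exp (- real N * r\<^sup>2 / 2))
      * ennreal (p * (S / 2 * (k * t)))"
    using p Npos c kpos by (intro ennreal_mult') auto
  also have "\<dots> \<le> ennreal (4 * real N / (k * c) / p * exp (- real N * r\<^sup>2 / 2)) * ?Z"
    by (intro mult_left_mono Z) auto
  also have "k * c = c powr (2 * a - 1) / Beta a a"
  proof -
    have "c powr (2 * a - 1) = c powr (2 * (a - 1)) * c powr 1"
      by (subst powr_add[symmetric]) (simp add: algebra_simps)
    then show ?thesis using c by (simp add: k_def)
  qed
  finally show ?thesis by (simp add: field_simps)
qed

section \<open>Dyadic intervals and the factorisation of the likelihood\<close>

lemma dyadic_left_Nil [simp]: "dyadic_left [] = 0"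
  by (simp add: dyadic_left_def)

lemma dyadic_left_snoc:
  "dyadic_left (\<epsilon> @ [b]) = dyadic_left \<epsilon> + of_bool b / 2 ^ Suc (length \<epsilon>)"
proof -
  have "(\<Sum>i<length \<epsilon>. of_bool ((\<epsilon> @ [b]) ! i) / 2 ^ Suc i :: real) = (\<Sum>i<length \<epsilon>. of_bool (\<epsilon> ! i) / 2 ^ Suc i)"
    by (intro sum.cong) (auto simp: nth_append)
  then show ?thesis by (simp add: dyadic_left_def)
qed

lemma dyadic_interval_Nil [simp]: "dyadic_interval [] = {0<..1}"
  by (simp add: dyadic_interval_def)

lemma dyadic_interval_sets [measurable]: "dyadic_interval \<epsilon> \<in> sets borel"
  by (simp add: dyadic_interval_def)

lemma dyadic_interval_children:
  "dyadic_interval (\<epsilon> @ [False]) \<union> dyadic_interval (\<epsilon> @ [True]) = dyadic_interval \<epsilon>"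
proof -
  have "(1::real) / 2 ^ length \<epsilon> = 2 * (1 / 2 ^ Suc (length \<epsilon>))"
    by simp
  moreover have "(1::real) / 2 ^ Suc (length \<epsilon>) > 0" by simp
  ultimately show ?thesis
    unfolding dyadic_interval_def dyadic_left_snoc length_append_singleton
    by (auto simp: algebra_simps)
qed

lemma dyadic_interval_children_disjoint:
  "dyadic_interval (\<epsilon> @ [False]) \<inter> dyadic_interval (\<epsilon> @ [True]) = {}"
  by (auto simp: dyadic_interval_def dyadic_left_snoc)

lemma dyadic_interval_snoc_subset: "dyadic_interval (\<epsilon> @ [b]) \<subseteq> dyadic_interval \<epsilon>"
  using dyadic_interval_children[of \<epsilon>] by (cases b) auto

lemma dyadic_interval_append_subset: "dyadic_interval (\<epsilon> @ w) \<subseteq> dyadic_interval \<epsilon>"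
proof (induction w rule: rev_induct)
  case (snoc b w)
  then show ?case using dyadic_interval_snoc_subset[of "\<epsilon> @ w" b] by auto
qed simp

lemma dyadic_interval_take: "x \<in> dyadic_interval \<epsilon> \<Longrightarrow> x \<in> dyadic_interval (take j \<epsilon>)"
  using dyadic_interval_append_subset[of "take j \<epsilon>" "drop j \<epsilon>"] by auto

lemma dyadic_interval_subset_unit: "dyadic_interval \<epsilon> \<subseteq> {0<..1}"
  using dyadic_interval_append_subset[of "[]" \<epsilon>] by simp

lemma dyadic_interval_length_ex:
  "x \<in> {0<..1} \<Longrightarrow> \<exists>\<epsilon>. length \<epsilon> = l \<and> x \<in> dyadic_interval \<epsilon>"
proof (induction l)
  case (Suc l)
  then obtain \<epsilon> where "length \<epsilon> = l" "x \<in> dyadic_interval \<epsilon>" by auto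
  then show ?case
    using dyadic_interval_children[of \<epsilon>] by (metis UnE length_append_singleton)
qed simp

lemma dyadic_interval_length_unique:
  "x \<in> dyadic_interval \<epsilon> \<Longrightarrow> x \<in> dyadic_interval \<epsilon>' \<Longrightarrow> length \<epsilon> = length \<epsilon>' \<Longrightarrow> \<epsilon> = \<epsilon>'"
proof (induction \<epsilon> arbitrary: \<epsilon>' rule: rev_induct)
  case (snoc b \<epsilon>)
  obtain \<epsilon>'' b' where eq: "\<epsilon>' = \<epsilon>'' @ [b']"
    using snoc.prems(3) by (cases \<epsilon>' rule: rev_cases) auto
  have "\<epsilon> = \<epsilon>''"
    using snoc.prems dyadic_interval_snoc_subset[of \<epsilon> b] dyadic_interval_snoc_subset[of \<epsilon>'' b']
    by (intro snoc.IH) (auto simp: eq)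
  then show ?case
    using snoc.prems dyadic_interval_children_disjoint[of \<epsilon>] by (cases b; cases b') (auto simp: eq)
qed simp

lemma dyadic_left_index: "\<exists>k < 2 ^ length \<epsilon>. dyadic_left \<epsilon> = real k / 2 ^ length \<epsilon>"
proof (induction \<epsilon> rule: rev_induct)
  case (snoc b \<epsilon>)
  then obtain k where k: "k < 2 ^ length \<epsilon>" "dyadic_left \<epsilon> = real k / 2 ^ length \<epsilon>" by auto
  then have "2 * k + of_bool b < 2 ^ length (\<epsilon> @ [b])" by auto
  moreover have "dyadic_left (\<epsilon> @ [b]) = real (2 * k + of_bool b) / 2 ^ length (\<epsilon> @ [b])"
    using k by (simp add: dyadic_left_snoc field_simps)
  ultimately show ?case by blast
qed simp

text \<open>Rescaling maps the cell to (0,1] and its halves to the two pieces of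
  \<open>haar_psi\<close>. The index k may stay existential because \<open>haar_ball\<close> bounds
  all coefficients of a level alike.\<close>

lemma haar_wavelet_eq_children:
  "\<exists>k < 2 ^ length \<epsilon>. \<forall>x. haar_wavelet (length \<epsilon>) k x = 2 powr (real (length \<epsilon>) / 2) *
     (indicator (dyadic_interval (\<epsilon> @ [True])) x - indicator (dyadic_interval (\<epsilon> @ [False])) x)"
proof -
  define P :: real where "P = 2 ^ length \<epsilon>"
  have P: "P > 0" by (simp add: P_def)
  obtain k where k: "k < 2 ^ length \<epsilon>" "dyadic_left \<epsilon> = real k / P"
    using dyadic_left_index[of \<epsilon>] by (auto simp: P_def)
  have F: "x \<in> dyadic_interval (\<epsilon> @ [False]) \<longleftrightarrow> P * x - real k \<in> {0<..1/2}" for x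
    using P unfolding dyadic_interval_def dyadic_left_snoc length_append_singleton power_Suc k(2) P_def[symmetric]
    by (auto simp: field_simps)
  have T: "x \<in> dyadic_interval (\<epsilon> @ [True]) \<longleftrightarrow> P * x - real k \<in> {1/2<..1}" for x
    using P unfolding dyadic_interval_def dyadic_left_snoc length_append_singleton power_Suc k(2) P_def[symmetric]
    by (auto simp: field_simps)
  have "haar_psi (P * x - real k) =
      indicator (dyadic_interval (\<epsilon> @ [True])) x - indicator (dyadic_interval (\<epsilon> @ [False])) x" for x
    unfolding haar_psi_def using F[of x] T[of x] by (auto simp: indicator_def)
  then show ?thesis using k(1) unfolding haar_wavelet_def P_def by auto
qed

lemma finite_words_less [simp]: "finite {\<epsilon> :: bool list. length \<epsilon> < L}"
  by (rule finite_subset[OF _ finite_lists_length_le[of "UNIV :: bool set" L]]) auto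

lemma finite_words_le [simp]: "finite {\<epsilon> :: bool list. length \<epsilon> \<le> L}"
  by (rule finite_subset[OF _ finite_lists_length_le[of "UNIV :: bool set" L]]) auto

lemma finite_words_eq [simp]: "finite {\<epsilon> :: bool list. length \<epsilon> = L}"
  by (rule finite_subset[OF _ finite_lists_length_le[of "UNIV :: bool set" L]]) auto

lemma card_words_le: "card {\<epsilon> :: bool list. length \<epsilon> \<le> L} \<le> 2 ^ Suc L"
proof -
  have "card {\<epsilon> :: bool list. length \<epsilon> \<le> L} = (\<Sum>i\<le>L. 2 ^ i)"
    using card_lists_length_le[of "UNIV :: bool set" L] by simp
  also have "\<dots> < 2 ^ Suc L" by (induction L) auto
  finally show ?thesis by simp
qed

lemma card_words_less: "card {\<epsilon> :: bool list. length \<epsilon> < L} \<le> 2 ^ L"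
proof (cases L)
  case (Suc l)
  then show ?thesis using card_words_le[of l] by (simp add: less_Suc_eq_le)
qed simp

text \<open>The value 1 off the cell lets the product over the path of x be written as a product
  over all words, an index set that does not depend on x.\<close>

definition split_factor :: "word \<Rightarrow> real \<Rightarrow> real \<Rightarrow> real" where
  "split_factor \<epsilon> y x =
     (if x \<in> dyadic_interval (\<epsilon> @ [False]) then 2 * y
      else if x \<in> dyadic_interval (\<epsilon> @ [True]) then 2 * (1 - y) else 1)"

lemma sum_words_indicator:
  fixes c :: "word \<Rightarrow> real"
  assumes "x \<in> dyadic_interval w"
  shows "(\<Sum>\<epsilon> | length \<epsilon> = length w. c \<epsilon> * indicator (dyadic_interval \<epsilon>) x) = c w"
proof -
  have "c \<epsilon> * indicator (dyadic_interval \<epsilon>) x = (if \<epsilon> = w then c w else 0)"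
    if "length \<epsilon> = length w" for \<epsilon>
  proof -
    have "x \<in> dyadic_interval \<epsilon> \<longleftrightarrow> \<epsilon> = w"
      using assms that dyadic_interval_length_unique[of x \<epsilon> w] by auto
    then show ?thesis by (auto simp: indicator_def)
  qed
  then have "(\<Sum>\<epsilon> | length \<epsilon> = length w. c \<epsilon> * indicator (dyadic_interval \<epsilon>) x)
      = (\<Sum>\<epsilon> | length \<epsilon> = length w. if \<epsilon> = w then c w else 0)"
    by (intro sum.cong) auto
  then show ?thesis by simp
qed

lemma tree_density_eq:
  assumes "length w = L" "x \<in> dyadic_interval w"
  shows "tree_density L y x = 2 ^ L * tree_mass y w"
  using sum_words_indicator[OF assms(2), of "\<lambda>\<epsilon>. 2 ^ L * tree_mass y \<epsilon>"] assms(1)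
  by (simp add: tree_density_def)

lemma tree_mass_eq_prod:
  "tree_mass y w = (\<Prod>j<length w. split_var y (take j w @ [w ! j]))"
proof -
  have "tree_mass y w = (\<Prod>j<length w. split_var y (take (Suc j) w))"
    unfolding tree_mass_def One_nat_def by (rule prod.atLeast1_atMost_eq)
  also have "\<dots> = (\<Prod>j<length w. split_var y (take j w @ [w ! j]))"
    by (intro prod.cong) (auto simp: take_Suc_conv_app_nth)
  finally show ?thesis .
qed

text \<open>The words with a nontrivial factor are the proper prefixes of the word w whose cell
  contains x; each of the L prefixes supplies one split and one of the L factors 2. At x = 0 the
  identity fails for the trivial reason that 0 lies in no cell.\<close>

lemma tree_density_eq_prod:
  assumes x: "x \<in> {0<..1}"
  shows "tree_density L y x = (\<Prod>\<epsilon> | length \<epsilon> < L. split_factor \<epsilon> (y \<epsilon>) x)"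
proof -
  obtain w where w: "length w = L" "x \<in> dyadic_interval w"
    using dyadic_interval_length_ex[OF x] by auto
  have on_path: "split_factor (take j w) (y (take j w)) x = 2 * split_var y (take j w @ [w ! j])"
    if "j < L" for j
  proof -
    have "x \<in> dyadic_interval (take j w @ [w ! j])"
      using dyadic_interval_take[OF w(2), of "Suc j"] that w by (simp add: take_Suc_conv_app_nth)
    then show ?thesis
      using dyadic_interval_children_disjoint[of "take j w"]
      by (cases "w ! j") (auto simp: split_factor_def split_var_def)
  qed
  have off_path: "split_factor \<epsilon> (y \<epsilon>) x = 1"
    if "length \<epsilon> < L" "\<epsilon> \<notin> (\<lambda>j. take j w) ` {..<L}" for \<epsilon>
  proof -
    have "x \<notin> dyadic_interval (\<epsilon> @ [b])" for b
    proof
      assume "x \<in> dyadic_interval (\<epsilon> @ [b])"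
      moreover have "x \<in> dyadic_interval (take (length \<epsilon>) w)"
        using dyadic_interval_take[OF w(2)] .
      ultimately have "\<epsilon> = take (length \<epsilon>) w"
        using that(1) w(1) dyadic_interval_snoc_subset[of \<epsilon> b]
        by (intro dyadic_interval_length_unique) auto
      then show False using that by auto
    qed
    then show ?thesis by (simp add: split_factor_def)
  qed
  have inj: "inj_on (\<lambda>j. take j w) {..<L}"
    by (rule inj_onI) (metis length_take lessThan_iff min.absorb4 w(1))
  have "(\<Prod>\<epsilon> | length \<epsilon> < L. split_factor \<epsilon> (y \<epsilon>) x)
     = (\<Prod>\<epsilon> \<in> (\<lambda>j. take j w) ` {..<L}. split_factor \<epsilon> (y \<epsilon>) x)"
    using off_path w(1) by (intro prod.mono_neutral_right) auto
  also have "\<dots> = (\<Prod>j<L. split_factor (take j w) (y (take j w)) x)"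
    using inj by (subst prod.reindex) auto
  also have "\<dots> = (\<Prod>j<L. 2 * split_var y (take j w @ [w ! j]))"
    by (intro prod.cong) (auto simp: on_path)
  also have "\<dots> = 2 ^ L * tree_mass y w"
    unfolding tree_mass_eq_prod w(1) by (simp add: prod.distrib)
  finally show ?thesis using tree_density_eq[OF w] by simp
qed

definition sample_count :: "nat \<Rightarrow> (nat \<Rightarrow> real) \<Rightarrow> real set \<Rightarrow> nat" where
  "sample_count n X A = card {i. i < n \<and> X i \<in> A}"

abbreviation node_lik :: "nat \<Rightarrow> (nat \<Rightarrow> real) \<Rightarrow> word \<Rightarrow> real \<Rightarrow> real" where
  "node_lik n X \<epsilon> \<equiv> split_lik (sample_count n X (dyadic_interval (\<epsilon> @ [False])))
     (sample_count n X (dyadic_interval (\<epsilon> @ [True])))"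

lemma prod_if_card:
  fixes c :: real and n :: nat
  shows "(\<Prod>i<n. if P i then c else 1) = c ^ card {i. i < n \<and> P i}"
proof -
  have "(\<Prod>i<n. if P i then c else 1) = (\<Prod>i \<in> {i \<in> {..<n}. P i}. c)"
    by (subst prod.inter_filter) auto
  then show ?thesis by simp
qed

lemma prod_split_factor:
  "(\<Prod>i<n. split_factor \<epsilon> y (X i)) = node_lik n X \<epsilon> y"
proof -
  have "(\<Prod>i<n. split_factor \<epsilon> y (X i)) =
    (\<Prod>i<n. (if X i \<in> dyadic_interval (\<epsilon> @ [False]) then 2 * y else 1) *
      (if X i \<in> dyadic_interval (\<epsilon> @ [True]) then 2 * (1 - y) else 1))"
    using dyadic_interval_children_disjoint[of \<epsilon>]
    by (intro prod.cong) (auto simp: split_factor_def)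
  then show ?thesis
    by (simp add: prod.distrib prod_if_card split_lik_def sample_count_def)
qed

text \<open>Exchanging the product over the sample with the product over the words collects, at each
  node, the two child counts as exponents. Splits in [0,1] keep all factors nonnegative, so
  \<open>ennreal\<close> passes through the products.\<close>

lemma likelihood_tree_density:
  assumes X: "\<And>i. i < n \<Longrightarrow> X i \<in> {0<..1}"
    and y: "\<And>\<epsilon>. length \<epsilon> < L \<Longrightarrow> 0 \<le> y \<epsilon> \<and> y \<epsilon> \<le> 1"
  shows "likelihood n X (tree_density L y)
    = (\<Prod>\<epsilon> | length \<epsilon> < L. ennreal (node_lik n X \<epsilon> (y \<epsilon>)))"
proof -
  have nonneg: "0 \<le> split_factor \<epsilon> (y \<epsilon>) x" if "length \<epsilon> < L" for \<epsilon> x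
    using y[OF that] by (auto simp: split_factor_def)
  have "likelihood n X (tree_density L y)
    = (\<Prod>i<n. ennreal (\<Prod>\<epsilon> | length \<epsilon> < L. split_factor \<epsilon> (y \<epsilon>) (X i)))"
    unfolding likelihood_def using X by (intro prod.cong) (auto simp: tree_density_eq_prod)
  also have "\<dots> = ennreal (\<Prod>i<n. \<Prod>\<epsilon> | length \<epsilon> < L. split_factor \<epsilon> (y \<epsilon>) (X i))"
    using nonneg by (intro prod_ennreal prod_nonneg) auto
  also have "(\<Prod>i<n. \<Prod>\<epsilon> | length \<epsilon> < L. split_factor \<epsilon> (y \<epsilon>) (X i))
     = (\<Prod>\<epsilon> | length \<epsilon> < L. node_lik n X \<epsilon> (y \<epsilon>))"
    by (subst prod.swap) (simp add: prod_split_factor)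
  also have "ennreal \<dots> = (\<Prod>\<epsilon> | length \<epsilon> < L. ennreal (node_lik n X \<epsilon> (y \<epsilon>)))"
    using y by (intro prod_ennreal[symmetric] split_lik_nonneg) auto
  finally show ?thesis .
qed

lemma sample_count_children:
  "sample_count n X (dyadic_interval \<epsilon>) =
     sample_count n X (dyadic_interval (\<epsilon> @ [False])) + sample_count n X (dyadic_interval (\<epsilon> @ [True]))"
proof -
  have "{i. i < n \<and> X i \<in> dyadic_interval \<epsilon>} = {i. i < n \<and> X i \<in> dyadic_interval (\<epsilon> @ [False])}
      \<union> {i. i < n \<and> X i \<in> dyadic_interval (\<epsilon> @ [True])}"
    using dyadic_interval_children[of \<epsilon>] by auto
  then show ?thesis
    unfolding sample_count_def using dyadic_interval_children_disjoint[of \<epsilon>]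
    by (simp, intro card_Un_disjoint) auto
qed

section \<open>The posterior\<close>

lemma split_law_eq:
  "split_law L (\<lambda>_. a) p = (\<Pi>\<^sub>M \<epsilon> \<in> {\<epsilon>. length \<epsilon> < L}. spike_slab (p (\<epsilon> @ [False])) a a)"
  by (simp add: split_law_def)

lemma split_law_coordinate_measurable:
  "length \<epsilon> < L \<Longrightarrow> (\<lambda>y. y \<epsilon>) \<in> borel_measurable (split_law L (\<lambda>_. a) p)"
  unfolding split_law_eq
  using measurable_component_singleton[of \<epsilon> "{\<epsilon>. length \<epsilon> < L}" "\<lambda>\<epsilon>. spike_slab (p (\<epsilon> @ [False])) a a"]
  by (simp cong: measurable_cong_sets)

lemma tree_mass_measurable:
  assumes "length w \<le> L"
  shows "(\<lambda>y. tree_mass y w) \<in> borel_measurable (split_law L (\<lambda>_. a) p)"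
  unfolding tree_mass_eq_prod
proof (intro borel_measurable_prod)
  fix j assume "j \<in> {..<length w}"
  then have [measurable]: "(\<lambda>y. y (take j w)) \<in> borel_measurable (split_law L (\<lambda>_. a) p)"
    using assms by (intro split_law_coordinate_measurable) auto
  show "(\<lambda>y. split_var y (take j w @ [w ! j])) \<in> borel_measurable (split_law L (\<lambda>_. a) p)"
    by (cases "w ! j") (simp_all add: split_var_def)
qed

lemma tree_density_measurable:
  "(\<lambda>(y, x). tree_density L y x) \<in> borel_measurable (split_law L (\<lambda>_. a) p \<Otimes>\<^sub>M borel)"
  unfolding tree_density_def split_beta
proof (intro borel_measurable_sum)
  fix w :: word assume "w \<in> {w. length w = L}"
  then have [measurable]: "(\<lambda>y. tree_mass y w) \<in> borel_measurable (split_law L (\<lambda>_. a) p)"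
    by (intro tree_mass_measurable) auto
  show "(\<lambda>z. 2 ^ L * tree_mass (fst z) w * indicator (dyadic_interval w) (snd z))
      \<in> borel_measurable (split_law L (\<lambda>_. a) p \<Otimes>\<^sub>M borel)"
    by measurable
qed

lemma tree_density_measurable_coordinates:
  "(\<lambda>y. tree_density L y x) \<in> borel_measurable (split_law L (\<lambda>_. a) p)"
  using measurable_compose[OF measurable_Pair[OF measurable_ident measurable_const[of x]] tree_density_measurable]
  by simp

lemma tree_density_measurable_arg [measurable]: "tree_density L y \<in> borel_measurable borel"
  unfolding tree_density_def by measurable

lemma likelihood_measurable:
  "(\<lambda>y. likelihood n X (tree_density L y)) \<in> borel_measurable (split_law L (\<lambda>_. a) p)"
  unfolding likelihood_def
  by (intro borel_measurable_prod_ennreal measurable_compose[OF _ measurable_ennreal]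
      tree_density_measurable_coordinates)

section \<open>Prior and posterior pulled back to the splits\<close>

abbreviation Polya_tree :: "nat \<Rightarrow> real \<Rightarrow> (word \<Rightarrow> real) \<Rightarrow> (real \<Rightarrow> real) measure" where
  "Polya_tree L a p \<equiv> spike_slab_Polya_tree L (\<lambda>_. a) p"

lemma space_Polya_tree [simp]: "space (Polya_tree L a p) = UNIV"
  by (simp add: spike_slab_Polya_tree_def space_measure_of_conv)

text \<open>The final sigma-algebra reduces measurability of a set of functions to measurability in
  finitely many real coordinates. All integrals over functions are moved to the product law in the
  same way.\<close>

lemma sets_Polya_tree:
  "{y \<in> space (split_law L (\<lambda>_. a) p). tree_density L y \<in> A} \<in> sets (split_law L (\<lambda>_. a) p)
    \<Longrightarrow> A \<in> sets (Polya_tree L a p)"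
  by (auto simp: spike_slab_Polya_tree_def vimage_def Int_def conj_commute intro!: sigma_sets.Basic)

lemma tree_density_measurable_final:
  "tree_density L \<in> measurable (split_law L (\<lambda>_. a) p) (Polya_tree L a p)"
  unfolding spike_slab_Polya_tree_def measurable_distr_eq2
  by (intro measurable_measure_of) auto

lemma Polya_tree_measurable:
  fixes g :: "(real \<Rightarrow> real) \<Rightarrow> ennreal"
  assumes "(\<lambda>y. g (tree_density L y)) \<in> borel_measurable (split_law L (\<lambda>_. a) p)"
  shows "g \<in> borel_measurable (Polya_tree L a p)"
proof (rule measurableI)
  fix A :: "ennreal set" assume "A \<in> sets borel"
  from measurable_sets[OF assms this]
  have "{y \<in> space (split_law L (\<lambda>_. a) p). tree_density L y \<in> g -` A} \<in> sets (split_law L (\<lambda>_. a) p)"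
    by (simp add: vimage_def Int_def conj_commute)
  from sets_Polya_tree[OF this] show "g -` A \<inter> space (Polya_tree L a p) \<in> sets (Polya_tree L a p)"
    by simp
qed auto

lemma nn_integral_Polya_tree:
  assumes "(\<lambda>y. g (tree_density L y)) \<in> borel_measurable (split_law L (\<lambda>_. a) p)"
  shows "(\<integral>\<^sup>+ f. g f \<partial>Polya_tree L a p) = (\<integral>\<^sup>+ y. g (tree_density L y) \<partial>split_law L (\<lambda>_. a) p)"
proof -
  have "g \<in> borel_measurable (Polya_tree L a p)" by (rule Polya_tree_measurable[OF assms])
  then show ?thesis
    using tree_density_measurable_final[of L a p]
    unfolding spike_slab_Polya_tree_def by (subst nn_integral_distr) auto
qed

lemma emeasure_posterior_Polya_tree:
  fixes n :: nat and X :: "nat \<Rightarrow> real"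
  assumes A: "{y \<in> space (split_law L (\<lambda>_. a) p). tree_density L y \<in> A} \<in> sets (split_law L (\<lambda>_. a) p)"
  defines "Z \<equiv> \<integral>\<^sup>+ y. likelihood n X (tree_density L y) \<partial>split_law L (\<lambda>_. a) p"
  shows "emeasure (posterior (Polya_tree L a p) n X) A
    = (\<integral>\<^sup>+ y. likelihood n X (tree_density L y) * indicator A (tree_density L y) \<partial>split_law L (\<lambda>_. a) p) / Z"
proof -
  note lik = likelihood_measurable[of n X L a p]
  have ind: "(\<lambda>y. indicator A (tree_density L y) :: ennreal) \<in> borel_measurable (split_law L (\<lambda>_. a) p)"
    using A by (auto simp: borel_measurable_indicator_iff indicator_def[abs_def] intro!: measurable_If)
  have Z: "(\<integral>\<^sup>+ f. likelihood n X f \<partial>Polya_tree L a p) = Z"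
    unfolding Z_def by (rule nn_integral_Polya_tree[OF lik])
  have "emeasure (posterior (Polya_tree L a p) n X) A
    = (\<integral>\<^sup>+ f. likelihood n X f / Z * indicator A f \<partial>Polya_tree L a p)"
    unfolding posterior_def Z
    using A lik by (intro emeasure_density sets_Polya_tree Polya_tree_measurable) auto
  also have "\<dots> = (\<integral>\<^sup>+ y. likelihood n X (tree_density L y) / Z * indicator A (tree_density L y)
      \<partial>split_law L (\<lambda>_. a) p)"
    using lik ind by (intro nn_integral_Polya_tree) auto
  also have "\<dots> = (\<integral>\<^sup>+ y. likelihood n X (tree_density L y) * indicator A (tree_density L y) / Z
      \<partial>split_law L (\<lambda>_. a) p)"
    by (intro nn_integral_cong) (simp add: ennreal_times_divide mult.commute)
  also have "\<dots> = (\<integral>\<^sup>+ y. likelihood n X (tree_density L y) * indicator A (tree_density L y)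
      \<partial>split_law L (\<lambda>_. a) p) / Z"
    using lik ind by (intro nn_integral_divide) auto
  finally show ?thesis .
qed

text \<open>A union bound before normalisation. The indicator of the union is at most the sum of the
  indicators, each summand is again a product function, and only its i-th integral differs from the
  full product; there the ratio \<open>b i\<close> appears.\<close>

lemma nn_integral_PiM_escape_le:
  fixes h :: "'i \<Rightarrow> 'b \<Rightarrow> ennreal"
  assumes "finite I" and M: "\<And>i. prob_space (M i)"
    and h: "\<And>i. i \<in> I \<Longrightarrow> h i \<in> borel_measurable (M i)"
    and B: "\<And>i. i \<in> I \<Longrightarrow> B i \<in> sets (M i)"
    and le: "\<And>i. i \<in> I \<Longrightarrow> (\<integral>\<^sup>+ y. h i y * indicator (B i) y \<partial>M i) \<le> b i * (\<integral>\<^sup>+ y. h i y \<partial>M i)"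
  shows "(\<integral>\<^sup>+ y. (\<Prod>i\<in>I. h i (y i)) * indicator {y. \<exists>i\<in>I. y i \<in> B i} y \<partial>PiM I M)
    \<le> (\<Sum>i\<in>I. b i) * (\<Prod>i\<in>I. \<integral>\<^sup>+ y. h i y \<partial>M i)"
proof -
  interpret product_sigma_finite M
    by (intro product_sigma_finite.intro prob_space_imp_sigma_finite M)
  \<comment> \<open>The i-th summand of the union bound as a product over j, with the indicator
    attached to the factor j = i.\<close>
  define g where "g i j y = h j y * (if j = i then indicator (B i) y else 1)" for i j y
  have g: "g i j \<in> borel_measurable (M j)" if "i \<in> I" "j \<in> I" for i j
    using h[OF that(2)] B[OF that(1)] by (cases "i = j") (auto simp: g_def[abs_def])
  have prod_g: "(\<Prod>j\<in>I. g i j (y j)) = (\<Prod>j\<in>I. h j (y j)) * indicator (B i) (y i)" if "i \<in> I" for i y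
    using \<open>finite I\<close> that by (simp add: g_def prod.distrib prod.delta)
  have "(\<integral>\<^sup>+ y. (\<Prod>i\<in>I. h i (y i)) * indicator {y. \<exists>i\<in>I. y i \<in> B i} y \<partial>PiM I M)
    \<le> (\<integral>\<^sup>+ y. (\<Sum>i\<in>I. \<Prod>j\<in>I. g i j (y j)) \<partial>PiM I M)"
  proof (intro nn_integral_mono)
    fix y
    show "(\<Prod>i\<in>I. h i (y i)) * indicator {y. \<exists>i\<in>I. y i \<in> B i} y \<le> (\<Sum>i\<in>I. \<Prod>j\<in>I. g i j (y j))"
    proof (cases "\<exists>i\<in>I. y i \<in> B i")
      case True
      then obtain i where i: "i \<in> I" "y i \<in> B i" by auto
      have "(\<Prod>i\<in>I. h i (y i)) * indicator {y. \<exists>i\<in>I. y i \<in> B i} y = (\<Prod>j\<in>I. g i j (y j))"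
        using i True by (simp add: prod_g)
      also have "\<dots> \<le> (\<Sum>i\<in>I. \<Prod>j\<in>I. g i j (y j))"
        using i \<open>finite I\<close> by (intro member_le_sum) auto
      finally show ?thesis .
    qed auto
  qed
  also have "\<dots> = (\<Sum>i\<in>I. \<integral>\<^sup>+ y. (\<Prod>j\<in>I. g i j (y j)) \<partial>PiM I M)"
    using g by (intro nn_integral_sum borel_measurable_prod measurable_compose[OF measurable_component_singleton]) auto
  also have "\<dots> = (\<Sum>i\<in>I. \<Prod>j\<in>I. \<integral>\<^sup>+ y. g i j y \<partial>M j)"
    using g \<open>finite I\<close> by (intro sum.cong refl product_nn_integral_prod) auto
  also have "\<dots> \<le> (\<Sum>i\<in>I. b i * (\<Prod>j\<in>I. \<integral>\<^sup>+ y. h j y \<partial>M j))"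
  proof (intro sum_mono)
    fix i assume i: "i \<in> I"
    have "(\<Prod>j\<in>I. \<integral>\<^sup>+ y. g i j y \<partial>M j)
      = (\<integral>\<^sup>+ y. h i y * indicator (B i) y \<partial>M i) * (\<Prod>j\<in>I - {i}. \<integral>\<^sup>+ y. h j y \<partial>M j)"
      using i \<open>finite I\<close> by (subst prod.remove[of _ i]) (auto simp: g_def[abs_def] intro!: arg_cong2[where f="(*)"] prod.cong)
    also have "\<dots> \<le> (b i * (\<integral>\<^sup>+ y. h i y \<partial>M i)) * (\<Prod>j\<in>I - {i}. \<integral>\<^sup>+ y. h j y \<partial>M j)"
      by (intro mult_right_mono le i) auto
    also have "\<dots> = b i * (\<Prod>j\<in>I. \<integral>\<^sup>+ y. h j y \<partial>M j)"
      using i \<open>finite I\<close> by (subst (2) prod.remove[of _ i]) (auto simp: mult.assoc)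
    finally show "(\<Prod>j\<in>I. \<integral>\<^sup>+ y. g i j y \<partial>M j) \<le> b i * (\<Prod>j\<in>I. \<integral>\<^sup>+ y. h j y \<partial>M j)" .
  qed
  finally show ?thesis by (simp add: sum_distrib_right)
qed

text \<open>These make the normalising constant cancel in Bayes' formula: the spike alone keeps it
  positive, and on [0,1] the likelihood is at most \<open>2 ^ N0 * 2 ^ N1\<close>.\<close>

lemma nn_integral_split_lik_bounds:
  assumes "a > 0" "0 \<le> p" "p < 1"
  shows "(\<integral>\<^sup>+ y. ennreal (split_lik N0 N1 y) \<partial>spike_slab p a a) \<noteq> 0"
    and "(\<integral>\<^sup>+ y. ennreal (split_lik N0 N1 y) \<partial>spike_slab p a a) < \<top>"
proof -
  have "0 < ennreal (1 - p)" using assms by simp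
  also have "\<dots> \<le> (\<integral>\<^sup>+ y. ennreal (split_lik N0 N1 y) \<partial>spike_slab p a a)"
    using assms by (subst nn_integral_spike_slab) (auto intro: add_increasing)
  finally show "(\<integral>\<^sup>+ y. ennreal (split_lik N0 N1 y) \<partial>spike_slab p a a) \<noteq> 0" by simp
  have "(\<integral>\<^sup>+ y. ennreal (split_lik N0 N1 y) * indicator UNIV y \<partial>spike_slab p a a) \<le> ennreal (2 ^ N0 * 2 ^ N1)"
  proof (intro set_nn_integral_le_sup prob_space_spike_slab)
    have "ennreal (split_lik N0 N1 y) \<le> ennreal (2 ^ N0 * 2 ^ N1)" if "0 \<le> y" "y \<le> 1" for y
      using that unfolding split_lik_def by (intro ennreal_leI mult_mono power_mono) auto
    then show "AE y in spike_slab p a a. y \<in> UNIV \<longrightarrow> ennreal (split_lik N0 N1 y) \<le> ennreal (2 ^ N0 * 2 ^ N1)"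
      using AE_spike_slab[of a a p] assms by auto
  qed (use assms in auto)
  also have "\<dots> < \<top>" by simp
  finally show "(\<integral>\<^sup>+ y. ennreal (split_lik N0 N1 y) \<partial>spike_slab p a a) < \<top>" by simp
qed

lemma prod_ennreal_less_top: "(\<And>i. i \<in> I \<Longrightarrow> f i < (\<top>::ennreal)) \<Longrightarrow> (\<Prod>i\<in>I. f i) < \<top>"
  by (induction I rule: infinite_finite_induct) (auto simp: ennreal_mult_less_top)

text \<open>By \<open>sub\<close>, the complement of A is contained, up to a null set, in the event
  that some split lies in its set B. The posterior mass of that event is bounded node by node, since
  prior and likelihood are both products.\<close>

lemma posterior_Polya_tree_ge:
  assumes a: "a > 0" and p: "\<And>\<epsilon>. 0 \<le> p \<epsilon>" "\<And>\<epsilon>. length \<epsilon> < L \<Longrightarrow> p (\<epsilon> @ [False]) < 1"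
    and X: "\<And>i. i < n \<Longrightarrow> X i \<in> {0<..1}"
    and B: "\<And>\<epsilon>. B \<epsilon> \<in> sets borel"
    and b: "\<And>\<epsilon>. 0 \<le> b \<epsilon>"
    and le: "\<And>\<epsilon>. length \<epsilon> < L \<Longrightarrow>
      (\<integral>\<^sup>+ y. ennreal (node_lik n X \<epsilon> y) * indicator (B \<epsilon>) y \<partial>spike_slab (p (\<epsilon> @ [False])) a a)
      \<le> ennreal (b \<epsilon>) * (\<integral>\<^sup>+ y. ennreal (node_lik n X \<epsilon> y) \<partial>spike_slab (p (\<epsilon> @ [False])) a a)"
    and A: "{y \<in> space (split_law L (\<lambda>_. a) p). tree_density L y \<in> A} \<in> sets (split_law L (\<lambda>_. a) p)"
    and sub: "\<And>y. (\<And>\<epsilon>. length \<epsilon> < L \<Longrightarrow> 0 \<le> y \<epsilon> \<and> y \<epsilon> \<le> 1 \<and> y \<epsilon> \<notin> B \<epsilon>) \<Longrightarrow> tree_density L y \<in> A"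
  shows "1 - (\<Sum>\<epsilon> | length \<epsilon> < L. b \<epsilon>) \<le> measure (posterior (Polya_tree L a p) n X) A"
    and "measure (posterior (Polya_tree L a p) n X) A \<le> 1"
proof -
  let ?Q = "split_law L (\<lambda>_. a) p"
  let ?I = "{\<epsilon> :: word. length \<epsilon> < L}"
  let ?M = "\<lambda>\<epsilon>. spike_slab (p (\<epsilon> @ [False])) a a"
  let ?h = "\<lambda>\<epsilon> y. ennreal (node_lik n X \<epsilon> y)"
  let ?lik = "\<lambda>y. likelihood n X (tree_density L y)"
  let ?P = "posterior (Polya_tree L a p) n X"
  define Z where "Z = (\<integral>\<^sup>+ y. ?lik y \<partial>?Q)"
  interpret product_sigma_finite ?M
    by (intro product_sigma_finite.intro prob_space_imp_sigma_finite prob_space_spike_slab a)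
  have unit: "AE y in ?Q. \<forall>\<epsilon>\<in>?I. 0 \<le> y \<epsilon> \<and> y \<epsilon> \<le> 1"
    unfolding split_law_eq using p a
    by (intro AE_finite_allI AE_PiM_component[where M = ?M and P = "\<lambda>t. 0 \<le> t \<and> t \<le> 1"]
        prob_space_spike_slab AE_spike_slab)
       (auto intro: less_imp_le)
  have lik_AE: "AE y in ?Q. ?lik y = (\<Prod>\<epsilon>\<in>?I. ?h \<epsilon> (y \<epsilon>))"
    using unit by eventually_elim (use X in \<open>auto intro!: likelihood_tree_density\<close>)
  have "Z = (\<integral>\<^sup>+ y. (\<Prod>\<epsilon>\<in>?I. ?h \<epsilon> (y \<epsilon>)) \<partial>?Q)"
    unfolding Z_def by (intro nn_integral_cong_AE lik_AE)
  also have "\<dots> = (\<Prod>\<epsilon>\<in>?I. \<integral>\<^sup>+ y. ?h \<epsilon> y \<partial>?M \<epsilon>)"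
    unfolding split_law_eq by (intro product_nn_integral_prod) (auto cong: measurable_cong_sets)
  finally have Z: "Z = (\<Prod>\<epsilon>\<in>?I. \<integral>\<^sup>+ y. ?h \<epsilon> y \<partial>?M \<epsilon>)" .
  have Z0: "Z \<noteq> 0" "Z < \<top>"
    unfolding Z using nn_integral_split_lik_bounds[OF a] p
    by (auto intro!: prod_ennreal_less_top)
  \<comment> \<open>Bayes' formula at the whole space: the posterior has total mass one, which is
    what later allows passing from the complement of A to A.\<close>
  have "emeasure ?P UNIV = Z / Z"
    using emeasure_posterior_Polya_tree[where A = UNIV and L = L and a = a and p = p and n = n and X = X]
    unfolding Z_def by simp
  then have one: "emeasure ?P UNIV = 1" using Z0 by (simp add: ennreal_divide_self)
  have space_P: "space ?P = UNIV" by (simp add: posterior_def)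
  interpret P: prob_space ?P by standard (simp add: one space_P)
  show "measure ?P A \<le> 1" by simp
  have A_sets: "A \<in> sets ?P" using sets_Polya_tree[OF A] by (simp add: posterior_def)
  have compl: "{y \<in> space ?Q. tree_density L y \<in> - A} \<in> sets ?Q"
  proof -
    have "{y \<in> space ?Q. tree_density L y \<in> - A} = space ?Q - {y \<in> space ?Q. tree_density L y \<in> A}" by auto
    then show ?thesis using A by auto
  qed
  have "emeasure ?P (- A) = (\<integral>\<^sup>+ y. ?lik y * indicator (- A) (tree_density L y) \<partial>?Q) / Z"
    unfolding Z_def by (rule emeasure_posterior_Polya_tree[OF compl])
  also have "(\<integral>\<^sup>+ y. ?lik y * indicator (- A) (tree_density L y) \<partial>?Q)
     \<le> (\<integral>\<^sup>+ y. (\<Prod>\<epsilon>\<in>?I. ?h \<epsilon> (y \<epsilon>)) * indicator {y. \<exists>\<epsilon>\<in>?I. y \<epsilon> \<in> B \<epsilon>} y \<partial>?Q)"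
  proof (intro nn_integral_mono_AE)
    show "AE y in ?Q. ?lik y * indicator (- A) (tree_density L y)
      \<le> (\<Prod>\<epsilon>\<in>?I. ?h \<epsilon> (y \<epsilon>)) * indicator {y. \<exists>\<epsilon>\<in>?I. y \<epsilon> \<in> B \<epsilon>} y"
      using lik_AE unit
    proof eventually_elim
      fix y assume *: "?lik y = (\<Prod>\<epsilon>\<in>?I. ?h \<epsilon> (y \<epsilon>))" "\<forall>\<epsilon>\<in>?I. 0 \<le> y \<epsilon> \<and> y \<epsilon> \<le> 1"
      show "?lik y * indicator (- A) (tree_density L y)
        \<le> (\<Prod>\<epsilon>\<in>?I. ?h \<epsilon> (y \<epsilon>)) * indicator {y. \<exists>\<epsilon>\<in>?I. y \<epsilon> \<in> B \<epsilon>} y"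
        unfolding *(1) using *(2) sub[of y] by (intro mult_left_mono) (auto simp: indicator_def)
    qed
  qed
  also have "\<dots> \<le> (\<Sum>\<epsilon>\<in>?I. ennreal (b \<epsilon>)) * Z"
    unfolding Z split_law_eq
    using le B a
    by (intro nn_integral_PiM_escape_le prob_space_spike_slab) (auto cong: measurable_cong_sets)
  finally have "emeasure ?P (- A) \<le> (\<Sum>\<epsilon>\<in>?I. ennreal (b \<epsilon>)) * Z / Z"
    by (auto intro: divide_right_mono_ennreal)
  also have "\<dots> = (\<Sum>\<epsilon>\<in>?I. ennreal (b \<epsilon>))"
    using Z0 by (simp add: ennreal_mult_divide_eq)
  also have "\<dots> = ennreal (\<Sum>\<epsilon>\<in>?I. b \<epsilon>)" using b by simp
  finally have "measure ?P (- A) \<le> (\<Sum>\<epsilon>\<in>?I. b \<epsilon>)"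
    using b by (subst (asm) P.emeasure_eq_measure) (simp add: sum_nonneg)
  moreover have "measure ?P (- A) = 1 - measure ?P A"
    using P.prob_compl[OF A_sets] space_P by (simp add: Compl_eq_Diff_UNIV)
  ultimately show "1 - (\<Sum>\<epsilon>\<in>?I. b \<epsilon>) \<le> measure ?P A" by simp
qed

lemma finite_measure_unit_lebesgue: "finite_measure unit_lebesgue"
  by (intro finite_measureI) (simp add: space_restrict_space emeasure_restrict_space)

lemma sup_norm_le_iff:
  assumes "f \<in> borel_measurable unit_lebesgue"
  shows "sup_norm f \<le> ereal r \<longleftrightarrow> (AE x in unit_lebesgue. \<bar>f x\<bar> \<le> r)"
proof
  assume "sup_norm f \<le> ereal r"
  then show "AE x in unit_lebesgue. \<bar>f x\<bar> \<le> r"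
    unfolding sup_norm_def
    using esssup_AE[of "\<lambda>x. ereal \<bar>f x\<bar>" unit_lebesgue]
    by (elim eventually_mono) (metis ereal_less_eq(3) order_trans)
next
  assume "AE x in unit_lebesgue. \<bar>f x\<bar> \<le> r"
  then show "sup_norm f \<le> ereal r"
    unfolding sup_norm_def using assms by (intro esssup_I) auto
qed

text \<open>The norm is an essential supremum, so lying in the ball means that the exceptional set
  of x has measure zero. By joint measurability of the histogram in splits and point, the measure of
  this section is a measurable function of the splits.\<close>

lemma sup_norm_ball_measurable:
  fixes f0 :: "real \<Rightarrow> real"
  assumes f0[measurable]: "f0 \<in> borel_measurable unit_lebesgue"
  shows "{y \<in> space (split_law L (\<lambda>_. a) p). tree_density L y \<in> {f. sup_norm (\<lambda>x. f x - f0 x) \<le> ereal r}}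
    \<in> sets (split_law L (\<lambda>_. a) p)"
proof -
  let ?Q = "split_law L (\<lambda>_. a) p"
  interpret finite_measure unit_lebesgue by (rule finite_measure_unit_lebesgue)
  have T[measurable]: "(\<lambda>z. tree_density L (fst z) (snd z)) \<in> borel_measurable (?Q \<Otimes>\<^sub>M unit_lebesgue)"
  proof -
    have snd: "snd \<in> borel_measurable (?Q \<Otimes>\<^sub>M unit_lebesgue)"
      by (rule measurable_compose[OF measurable_snd measurable_restrict_space1[OF measurable_ident_sets]]) simp
    from measurable_compose[OF measurable_Pair[OF measurable_fst snd] tree_density_measurable[of L a p]]
    show ?thesis by simp
  qed
  have Ty[measurable]: "tree_density L y \<in> borel_measurable unit_lebesgue" for y
    by (simp add: measurable_restrict_space1)
  define A where "A y = {x \<in> space unit_lebesgue. \<not> \<bar>tree_density L y x - f0 x\<bar> \<le> r}" for y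
  have "(\<lambda>y. emeasure unit_lebesgue (A y)) \<in> borel_measurable ?Q"
  proof (intro measurable_emeasure)
    have "{z \<in> space (?Q \<Otimes>\<^sub>M unit_lebesgue). \<not> \<bar>tree_density L (fst z) (snd z) - f0 (snd z)\<bar> \<le> r}
      \<in> sets (?Q \<Otimes>\<^sub>M unit_lebesgue)"
      by measurable
    then show "{x \<in> space (?Q \<Otimes>\<^sub>M unit_lebesgue). snd x \<in> A (fst x)} \<in> sets (?Q \<Otimes>\<^sub>M unit_lebesgue)"
      by (rule back_subst[of "\<lambda>S. S \<in> sets (?Q \<Otimes>\<^sub>M unit_lebesgue)"])
         (auto simp: A_def space_pair_measure)
  qed (auto simp: A_def)
  then have "{y \<in> space ?Q. emeasure unit_lebesgue (A y) = 0} \<in> sets ?Q" by measurable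
  moreover have "sup_norm (\<lambda>x. tree_density L y x - f0 x) \<le> ereal r \<longleftrightarrow> emeasure unit_lebesgue (A y) = 0" for y
  proof -
    have "sup_norm (\<lambda>x. tree_density L y x - f0 x) \<le> ereal r
        \<longleftrightarrow> (AE x in unit_lebesgue. \<bar>tree_density L y x - f0 x\<bar> \<le> r)"
      by (intro sup_norm_le_iff) measurable
    also have "\<dots> \<longleftrightarrow> emeasure unit_lebesgue (A y) = 0"
      unfolding A_def by (intro AE_iff_measurable[OF _ refl]) measurable
    finally show ?thesis .
  qed
  ultimately show ?thesis by simp
qed

section \<open>Concentration of the cell counts\<close>

lemma exp_le_quadratic:
  fixes s :: real
  assumes "\<bar>s\<bar> \<le> 1"
  shows "exp s \<le> 1 + s + s\<^sup>2"
proof (cases "s \<ge> 0")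
  case True
  then show ?thesis using assms by (intro exp_bound) auto
next
  case False
  define x where "x = - s"
  have x: "x > 0" using False by (simp add: x_def)
  \<comment> \<open>With x = -s, the target is an upper bound for 1 / exp x. As exp x is at least
    \<open>1 + x + x\<^sup>2 / 2\<close>, it suffices that this polynomial times the proposed bound
    is at least 1.\<close>
  have "1 \<le> (1 - x + x\<^sup>2) * (1 + x + x\<^sup>2 / 2)"
  proof -
    have "(1 - x + x\<^sup>2) * (1 + x + x\<^sup>2 / 2) = 1 + x\<^sup>2 / 2 + x ^ 3 / 2 + x ^ 4 / 2"
      by (simp add: field_simps power2_eq_square power3_eq_cube power4_eq_xxxx)
    then show ?thesis using x by simp
  qed
  also have "\<dots> \<le> (1 - x + x\<^sup>2) * exp x"
  proof (intro mult_left_mono exp_lower_Taylor_quadratic)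
    have "0 \<le> (x - 1/2)\<^sup>2 + 3/4" by simp
    then show "0 \<le> 1 - x + x\<^sup>2" by (simp add: power2_eq_square algebra_simps)
  qed (use x in auto)
  finally have "exp (- x) \<le> 1 - x + x\<^sup>2"
    by (simp add: exp_minus field_simps)
  then show ?thesis by (simp add: x_def)
qed

lemma sample_count_eq_sum: "real (sample_count n X A) = (\<Sum>i<n. indicator A (X i))"
proof -
  have "(\<Sum>i<n. indicator A (X i)) = (\<Sum>i \<in> {i \<in> {..<n}. X i \<in> A}. 1 :: real)"
    unfolding indicator_def of_bool_def by (rule sum.inter_filter[symmetric]) simp
  then show ?thesis by (simp add: sample_count_def)
qed

lemma sample_count_measurable:
  assumes [measurable]: "A \<in> sets M"
  shows "(\<lambda>X. real (sample_count n X A)) \<in> borel_measurable (\<Pi>\<^sub>M i\<in>{..<n}. M)"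
  unfolding sample_count_eq_sum by measurable

text \<open>The count is binomial: independence gives the n-th power of the moment generating
  function of one indicator, and 1 + u \<le> exp u replaces it by the Poisson one.\<close>

lemma nn_integral_exp_sample_count_le:
  assumes M: "prob_space M" and A[measurable]: "A \<in> sets M"
  shows "(\<integral>\<^sup>+ X. ennreal (exp (s * real (sample_count n X A))) \<partial>(\<Pi>\<^sub>M i\<in>{..<n}. M))
    \<le> ennreal (exp (real n * measure M A * (exp s - 1)))"
proof -
  interpret prob_space M by fact
  interpret product_sigma_finite "\<lambda>_::nat. M" by standard
  have eq: "exp (s * indicator A x) = 1 + (exp s - 1) * indicator A x" for x
    by (simp add: indicator_def)
  have intA: "integrable M (indicat_real A)"
    by (intro integrable_real_indicator) (auto simp: less_top[symmetric])
  have int: "integrable M (\<lambda>x. 1 + (exp s - 1) * indicator A x)"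
    by (intro Bochner_Integration.integrable_add integrable_mult_right intA) auto
  have "(\<integral>\<^sup>+ x. ennreal (exp (s * indicator A x)) \<partial>M) = ennreal (\<integral> x. 1 + (exp s - 1) * indicator A x \<partial>M)"
    unfolding eq by (intro nn_integral_eq_integral int) (simp flip: eq)
  also have "(\<integral> x. 1 + (exp s - 1) * indicator A x \<partial>M) = 1 + (exp s - 1) * prob A"
    by (subst Bochner_Integration.integral_add) (auto simp: prob_space intA)
  finally have one: "(\<integral>\<^sup>+ x. ennreal (exp (s * indicator A x)) \<partial>M) = ennreal (1 + (exp s - 1) * prob A)" .
  have nonneg: "0 \<le> 1 + (exp s - 1) * prob A"
  proof -
    have "0 \<le> (1 - prob A) + exp s * prob A" by (intro add_nonneg_nonneg) auto
    then show ?thesis by (simp add: algebra_simps)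
  qed
  have "(\<integral>\<^sup>+ X. ennreal (exp (s * real (sample_count n X A))) \<partial>(\<Pi>\<^sub>M i\<in>{..<n}. M))
    = (\<integral>\<^sup>+ X. (\<Prod>i<n. ennreal (exp (s * indicator A (X i)))) \<partial>(\<Pi>\<^sub>M i\<in>{..<n}. M))"
    by (intro nn_integral_cong) (simp add: sample_count_eq_sum prod_ennreal exp_sum[symmetric] sum_distrib_left)
  also have "\<dots> = (\<Prod>i<n. \<integral>\<^sup>+ x. ennreal (exp (s * indicator A x)) \<partial>M)"
    by (intro product_nn_integral_prod) auto
  also have "\<dots> = ennreal ((1 + (exp s - 1) * prob A) ^ n)"
    unfolding one using nonneg by (simp add: ennreal_power)
  also have "\<dots> \<le> ennreal (exp ((exp s - 1) * prob A) ^ n)"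
    using nonneg exp_ge_add_one_self[of "(exp s - 1) * prob A"]
    by (intro ennreal_leI power_mono) auto
  also have "exp ((exp s - 1) * prob A) ^ n = exp (real n * prob A * (exp s - 1))"
    by (simp add: exp_of_nat_mult[symmetric] mult_ac)
  finally show ?thesis .
qed

text \<open>Chernoff's bound with a signed s, so that one statement covers both tails. The range of
  s is that of the quadratic bound on the exponential.\<close>

lemma sample_count_tail:
  assumes M: "prob_space M" and A[measurable]: "A \<in> sets M" and s: "\<bar>s\<bar> \<le> 1"
  shows "measure (\<Pi>\<^sub>M i\<in>{..<n}. M) {X \<in> space (\<Pi>\<^sub>M i\<in>{..<n}. M). u \<le> s * (real (sample_count n X A) - real n * measure M A)}
    \<le> exp (real n * measure M A * s\<^sup>2 - u)"
proof -
  let ?P = "\<Pi>\<^sub>M i\<in>{..<n}. M"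
  let ?p = "measure M A"
  interpret P: prob_space ?P by (intro prob_space_PiM M)
  note [measurable] = sample_count_measurable[OF A, of n]
  let ?c = "exp (- u - s * (real n * ?p))"
  have "emeasure ?P {X \<in> space ?P. u \<le> s * (real (sample_count n X A) - real n * ?p)}
    = emeasure ?P {X \<in> space ?P. 1 \<le> ennreal ?c * ennreal (exp (s * real (sample_count n X A)))}"
  proof -
    have "1 \<le> ennreal ?c * ennreal (exp (s * r)) \<longleftrightarrow> u \<le> s * (r - real n * ?p)" for r
      by (simp add: ennreal_mult'[symmetric] exp_add[symmetric] algebra_simps ennreal_1[symmetric] del: ennreal_1)
    then show ?thesis by simp
  qed
  also have "\<dots> \<le> ennreal ?c * (\<integral>\<^sup>+ X. ennreal (exp (s * real (sample_count n X A))) * indicator (space ?P) X \<partial>?P)"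
    by (intro nn_integral_Markov_inequality) measurable
  also have "(\<integral>\<^sup>+ X. ennreal (exp (s * real (sample_count n X A))) * indicator (space ?P) X \<partial>?P)
    = (\<integral>\<^sup>+ X. ennreal (exp (s * real (sample_count n X A))) \<partial>?P)"
    by (intro nn_integral_cong) simp
  also have "ennreal ?c * \<dots> \<le> ennreal ?c * ennreal (exp (real n * ?p * (exp s - 1)))"
    by (intro mult_left_mono nn_integral_exp_sample_count_le M A) simp
  also have "\<dots> = ennreal (exp (real n * ?p * (exp s - 1 - s) - u))"
    by (simp add: ennreal_mult'[symmetric] exp_add[symmetric] algebra_simps)
  also have "\<dots> \<le> ennreal (exp (real n * ?p * s\<^sup>2 - u))"
    using exp_le_quadratic[OF s]
    by (intro ennreal_leI iffD2[OF exp_le_cancel_iff] diff_right_mono mult_left_mono) auto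
  finally show ?thesis
    by (subst (asm) P.emeasure_eq_measure) simp
qed

lemma sample_count_deviation:
  assumes M: "prob_space M" and A[measurable]: "A \<in> sets M"
    and t: "0 \<le> t" "t \<le> 2 * (real n * measure M A)" and pos: "real n * measure M A > 0"
  shows "measure (\<Pi>\<^sub>M i\<in>{..<n}. M) {X \<in> space (\<Pi>\<^sub>M i\<in>{..<n}. M). t < \<bar>real (sample_count n X A) - real n * measure M A\<bar>}
    \<le> 2 * exp (- t\<^sup>2 / (4 * (real n * measure M A)))"
proof -
  let ?P = "\<Pi>\<^sub>M i\<in>{..<n}. M"
  define \<mu> where "\<mu> = real n * measure M A"
  \<comment> \<open>The minimiser of \<open>\<mu> * s\<^sup>2 - s * t\<close>; the assumption that t
    is at most twice the mean says exactly that it does not exceed 1.\<close>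
  define s where "s = t / (2 * \<mu>)"
  interpret P: prob_space ?P by (intro prob_space_PiM M)
  note [measurable] = sample_count_measurable[OF A, of n]
  have \<mu>: "\<mu> > 0" using pos by (simp add: \<mu>_def)
  have s: "0 \<le> s" "s \<le> 1" using t \<mu> by (auto simp: s_def \<mu>_def[symmetric] field_simps)
  have ex: "\<mu> * s\<^sup>2 - s * t = - t\<^sup>2 / (4 * \<mu>)"
    using \<mu> by (simp add: s_def field_simps power2_eq_square)
  define S where "S r = {X \<in> space ?P. s * t \<le> r * (real (sample_count n X A) - \<mu>)}" for r
  have S: "S r \<in> sets ?P" for r unfolding S_def by measurable
  have le: "measure ?P (S r) \<le> exp (- t\<^sup>2 / (4 * \<mu>))" if "r = s \<or> r = - s" for r
    using sample_count_tail[OF M A, of r n "s * t"] that s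
    unfolding S_def \<mu>_def[symmetric] ex[symmetric] by auto
  have "measure ?P {X \<in> space ?P. t < \<bar>real (sample_count n X A) - \<mu>\<bar>} \<le> measure ?P (S s \<union> S (- s))"
  proof (intro P.finite_measure_mono subsetI)
    fix X assume X: "X \<in> {X \<in> space ?P. t < \<bar>real (sample_count n X A) - \<mu>\<bar>}"
    then consider "t \<le> real (sample_count n X A) - \<mu>" | "t \<le> - (real (sample_count n X A) - \<mu>)"
      by fastforce
    then show "X \<in> S s \<union> S (- s)"
    proof cases
      case 1 from mult_left_mono[OF this s(1)] show ?thesis using X by (simp add: S_def)
    next
      case 2 from mult_left_mono[OF this s(1)] show ?thesis using X by (auto simp: S_def algebra_simps)
    qed
  qed (use S in auto)
  also have "\<dots> \<le> measure ?P (S s) + measure ?P (S (- s))"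
    by (intro measure_Un_le S)
  also have "\<dots> \<le> 2 * exp (- t\<^sup>2 / (4 * \<mu>))"
    using le[of s] le[of "- s"] by simp
  finally show ?thesis by (simp add: \<mu>_def)
qed

section \<open>Cell masses of the true density and the good event\<close>

definition cell_mass :: "(real \<Rightarrow> real) \<Rightarrow> word \<Rightarrow> real" where
  "cell_mass f \<epsilon> = (\<integral>x. f x * indicator (dyadic_interval \<epsilon>) x \<partial>unit_lebesgue)"

lemma dyadic_interval_sets_unit: "dyadic_interval \<epsilon> \<in> sets unit_lebesgue"
  using dyadic_interval_subset_unit[of \<epsilon>] by (subst sets_restrict_space_iff) auto

lemma measure_dyadic_interval: "measure unit_lebesgue (dyadic_interval \<epsilon>) = 1 / 2 ^ length \<epsilon>"
proof -
  have "measure unit_lebesgue (dyadic_interval \<epsilon>) = measure lborel (dyadic_interval \<epsilon>)"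
    using dyadic_interval_subset_unit[of \<epsilon>] by (subst measure_restrict_space) auto
  then show ?thesis by (simp add: dyadic_interval_def)
qed

lemma AE_unit_lebesgue: "AE x in unit_lebesgue. x \<in> {0<..1}"
  using AE_lborel_singleton[of "0::real"]
  by (subst AE_restrict_space_iff) (auto elim: eventually_mono)

locale bounded_density =
  fixes f0 :: "real \<Rightarrow> real" and m0 m1 :: real
  assumes m0_pos: "m0 > 0" and bounded: "f0 \<in> bounded_densities m0 m1"
begin

sublocale U: finite_measure unit_lebesgue by (rule finite_measure_unit_lebesgue)

lemma f0_measurable [measurable]: "f0 \<in> borel_measurable unit_lebesgue"
  using bounded by (simp add: bounded_densities_def)

lemma f0_bounds: "AE x in unit_lebesgue. m0 \<le> f0 x \<and> f0 x \<le> m1"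
  using bounded by (simp add: bounded_densities_def)

lemma f0_integral: "(\<integral>x. f0 x \<partial>unit_lebesgue) = 1"
  using bounded by (simp add: bounded_densities_def)

lemma f0_integrable [simp]: "integrable unit_lebesgue f0"
  by (rule U.integrable_const_bound[where B = m1]) (use f0_bounds m0_pos in auto)

lemma f0_indicator_integrable [simp]:
  "A \<in> sets unit_lebesgue \<Longrightarrow> integrable unit_lebesgue (\<lambda>x. f0 x * indicator A x)"
  by (rule integrable_mult_indicator[of A unit_lebesgue f0, simplified, simplified mult.commute]) auto

definition truth :: "real measure" where
  "truth = density unit_lebesgue (\<lambda>x. ennreal (f0 x))"

lemma sets_truth [simp, measurable_cong]: "sets truth = sets unit_lebesgue"
  by (simp add: truth_def)

lemma measure_truth:
  assumes "A \<in> sets unit_lebesgue"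
  shows "emeasure truth A = ennreal (\<integral>x. f0 x * indicator A x \<partial>unit_lebesgue)"
proof -
  have "emeasure truth A = (\<integral>\<^sup>+ x. ennreal (f0 x) * indicator A x \<partial>unit_lebesgue)"
    unfolding truth_def using assms by (intro emeasure_density) auto
  also have "\<dots> = (\<integral>\<^sup>+ x. ennreal (f0 x * indicator A x) \<partial>unit_lebesgue)"
    by (intro nn_integral_cong) (auto simp: indicator_def)
  also have "\<dots> = ennreal (\<integral>x. f0 x * indicator A x \<partial>unit_lebesgue)"
    using f0_bounds m0_pos
    by (intro nn_integral_eq_integral f0_indicator_integrable assms)
       (auto elim!: eventually_mono simp: indicator_def)
  finally show ?thesis .
qed

lemma prob_space_truth: "prob_space truth"
proof
  have "(\<integral>x. f0 x * indicator {0..1} x \<partial>unit_lebesgue) = (\<integral>x. f0 x \<partial>unit_lebesgue)"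
    by (intro Bochner_Integration.integral_cong) (auto simp: space_restrict_space)
  then show "emeasure truth (space truth) = 1"
    using measure_truth[of "{0..1}"] f0_integral
    by (simp add: truth_def space_restrict_space sets_restrict_space_iff)
qed

lemma cell_mass_bounds: "m0 / 2 ^ length \<epsilon> \<le> cell_mass f0 \<epsilon>" "cell_mass f0 \<epsilon> \<le> m1 / 2 ^ length \<epsilon>"
proof -
  let ?I = "dyadic_interval \<epsilon>"
  have c: "(\<integral>x. c * indicator ?I x \<partial>unit_lebesgue) = c / 2 ^ length \<epsilon>" for c :: real
    proof -
      have "dyadic_interval \<epsilon> \<inter> {0..1} = dyadic_interval \<epsilon>"
        using dyadic_interval_subset_unit[of \<epsilon>] by auto
      then show ?thesis
        using dyadic_interval_sets_unit[of \<epsilon>] measure_dyadic_interval[of \<epsilon>]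
        by (simp add: space_restrict_space)
    qed
  have i: "integrable unit_lebesgue (\<lambda>x. c * indicator ?I x)" for c :: real
    using dyadic_interval_sets_unit[of \<epsilon>]
    by (intro integrable_mult_right integrable_real_indicator) (auto simp: less_top[symmetric])
  have "(\<integral>x. m0 * indicator ?I x \<partial>unit_lebesgue) \<le> cell_mass f0 \<epsilon>"
    unfolding cell_mass_def
    by (intro integral_mono_AE i f0_indicator_integrable dyadic_interval_sets_unit)
       (use f0_bounds in eventually_elim, auto simp: indicator_def)
  then show "m0 / 2 ^ length \<epsilon> \<le> cell_mass f0 \<epsilon>" unfolding c .
  have "cell_mass f0 \<epsilon> \<le> (\<integral>x. m1 * indicator ?I x \<partial>unit_lebesgue)"
    unfolding cell_mass_def
    by (intro integral_mono_AE i f0_indicator_integrable dyadic_interval_sets_unit)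
       (use f0_bounds in eventually_elim, auto simp: indicator_def)
  then show "cell_mass f0 \<epsilon> \<le> m1 / 2 ^ length \<epsilon>" unfolding c .
qed

lemma cell_mass_pos: "cell_mass f0 \<epsilon> > 0"
proof -
  have "0 < m0 / 2 ^ length \<epsilon>" using m0_pos by simp
  then show ?thesis using cell_mass_bounds(1)[of \<epsilon>] by linarith
qed

lemma measure_truth_cell: "measure truth (dyadic_interval \<epsilon>) = cell_mass f0 \<epsilon>"
  using measure_truth[OF dyadic_interval_sets_unit, of \<epsilon>] cell_mass_pos[of \<epsilon>]
  by (simp add: measure_def cell_mass_def)

lemma cell_mass_children:
  "cell_mass f0 \<epsilon> = cell_mass f0 (\<epsilon> @ [False]) + cell_mass f0 (\<epsilon> @ [True])"
proof -
  interpret prob_space truth by (rule prob_space_truth)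
  show ?thesis
    unfolding measure_truth_cell[symmetric]
    using finite_measure_Union[OF _ _ dyadic_interval_children_disjoint[of \<epsilon>]]
    by (simp add: dyadic_interval_sets_unit dyadic_interval_children)
qed

lemma cell_mass_Nil: "cell_mass f0 [] = 1"
proof -
  have "cell_mass f0 [] = (\<integral>x. f0 x \<partial>unit_lebesgue)"
    unfolding cell_mass_def
    by (intro integral_cong_AE borel_measurable_integrable f0_indicator_integrable
        dyadic_interval_sets_unit f0_integrable)
       (use AE_unit_lebesgue in eventually_elim, auto)
  then show ?thesis by (simp add: f0_integral)
qed

text \<open>The bridge from the Haar ball to the tree: regularity of \<open>f0\<close> is used only
  through differences of sibling masses.\<close>

lemma cell_mass_diff_haar:
  "\<exists>k < 2 ^ length \<epsilon>. haar_coeff f0 (length \<epsilon>) k =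
     2 powr (real (length \<epsilon>) / 2) * (cell_mass f0 (\<epsilon> @ [True]) - cell_mass f0 (\<epsilon> @ [False]))"
proof -
  obtain k where k: "k < 2 ^ length \<epsilon>"
    "\<And>x. haar_wavelet (length \<epsilon>) k x = 2 powr (real (length \<epsilon>) / 2) *
     (indicator (dyadic_interval (\<epsilon> @ [True])) x - indicator (dyadic_interval (\<epsilon> @ [False])) x)"
    using haar_wavelet_eq_children[of \<epsilon>] by auto
  have "haar_coeff f0 (length \<epsilon>) k = (\<integral>x. 2 powr (real (length \<epsilon>) / 2) *
     (f0 x * indicator (dyadic_interval (\<epsilon> @ [True])) x - f0 x * indicator (dyadic_interval (\<epsilon> @ [False])) x) \<partial>unit_lebesgue)"
    unfolding haar_coeff_def k(2) by (simp add: algebra_simps)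
  also have "\<dots> = 2 powr (real (length \<epsilon>) / 2) * (cell_mass f0 (\<epsilon> @ [True]) - cell_mass f0 (\<epsilon> @ [False]))"
    unfolding cell_mass_def integral_mult_right_zero
    by (subst Bochner_Integration.integral_diff) (auto simp: dyadic_interval_sets_unit)
  finally show ?thesis using k(1) by auto
qed

text \<open>With the factor 8, the deviation bound
  \<open>2 * exp (- t\<^sup>2 / (4 * \<mu>))\<close> becomes 2 divided by the square of n for every
  cell.\<close>

definition good_sample :: "nat \<Rightarrow> nat \<Rightarrow> (nat \<Rightarrow> real) \<Rightarrow> bool" where
  "good_sample n L X \<longleftrightarrow> (\<forall>i<n. X i \<in> {0<..1}) \<and>
     (\<forall>\<epsilon>. length \<epsilon> \<le> L \<longrightarrow> \<bar>real (sample_count n X (dyadic_interval \<epsilon>)) - real n * cell_mass f0 \<epsilon>\<bar>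
        \<le> sqrt (8 * (real n * cell_mass f0 \<epsilon>) * ln (real n)))"

lemma iid_law_eq: "iid_law n f0 = (\<Pi>\<^sub>M i\<in>{..<n}. truth)"
  by (simp add: iid_law_def truth_def)

lemma prob_space_iid: "prob_space (iid_law n f0)"
  unfolding iid_law_eq by (intro prob_space_PiM prob_space_truth)

text \<open>The assumption on the depth puts the allowed deviation within the range of the Chernoff
  bound for all cells up to level L. A measurable set B covering the bad samples is produced, so
  that measurability of later events never matters; it also absorbs the null set of samples with a
  point at 0.\<close>

lemma bad_sample_prob_le:
  assumes n: "n \<ge> 2" and depth: "2 * ln (real n) \<le> real n * m0 / 2 ^ L"
  shows "\<exists>B \<in> sets (iid_law n f0). measure (iid_law n f0) B \<le> 4 * 2 ^ L / (real n)\<^sup>2 \<and>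
     (\<forall>X \<in> space (iid_law n f0) - B. good_sample n L X)"
proof -
  let ?P = "\<Pi>\<^sub>M i\<in>{..<n}. truth"
  let ?W = "{\<epsilon> :: word. length \<epsilon> \<le> L}"
  interpret P: prob_space ?P by (intro prob_space_PiM prob_space_truth)
  define t where "t \<epsilon> = sqrt (8 * (real n * cell_mass f0 \<epsilon>) * ln (real n))" for \<epsilon>
  define B where "B \<epsilon> = {X \<in> space ?P. t \<epsilon> < \<bar>real (sample_count n X (dyadic_interval \<epsilon>)) - real n * cell_mass f0 \<epsilon>\<bar>}" for \<epsilon>
  have ln: "ln (real n) > 0" using n by simp
  have I: "dyadic_interval \<epsilon> \<in> sets truth" for \<epsilon> by (simp add: dyadic_interval_sets_unit)
  have B_sets: "B \<epsilon> \<in> sets ?P" for \<epsilon>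
  proof -
    note [measurable] = sample_count_measurable[OF I, of n \<epsilon>]
    show ?thesis unfolding B_def by measurable
  qed
  have B_le: "measure ?P (B \<epsilon>) \<le> 2 / (real n)\<^sup>2" if "length \<epsilon> \<le> L" for \<epsilon>
  proof -
    define \<mu> where "\<mu> = real n * cell_mass f0 \<epsilon>"
    have \<mu>: "\<mu> > 0" using n cell_mass_pos[of \<epsilon>] by (simp add: \<mu>_def)
    have "2 * ln (real n) \<le> real n * (m0 / 2 ^ L)" using depth by simp
    also have "\<dots> \<le> real n * (m0 / 2 ^ length \<epsilon>)"
      using m0_pos that by (intro mult_left_mono divide_left_mono power_increasing) auto
    also have "\<dots> \<le> \<mu>" unfolding \<mu>_def by (intro mult_left_mono cell_mass_bounds) auto
    finally have \<mu>_ge: "2 * ln (real n) \<le> \<mu>" .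
    have "t \<epsilon> \<le> sqrt ((2 * \<mu>)\<^sup>2)"
      unfolding t_def \<mu>_def[symmetric]
      using mult_left_mono[OF \<mu>_ge, of "4 * \<mu>"] \<mu> by (intro real_sqrt_le_mono) (simp add: power2_eq_square)
    also have "sqrt ((2 * \<mu>)\<^sup>2) = 2 * \<mu>" using \<mu> by (intro real_sqrt_unique) auto
    finally have "t \<epsilon> \<le> 2 * \<mu>" .
    moreover have "0 \<le> t \<epsilon>" unfolding t_def \<mu>_def[symmetric] using \<mu> ln by simp
    ultimately have "measure ?P (B \<epsilon>) \<le> 2 * exp (- (t \<epsilon>)\<^sup>2 / (4 * \<mu>))"
      using sample_count_deviation[OF prob_space_truth I[of \<epsilon>], of "t \<epsilon>" n] \<mu>
      unfolding B_def measure_truth_cell \<mu>_def[symmetric] by simp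
    also have "(t \<epsilon>)\<^sup>2 = 8 * \<mu> * ln (real n)"
      unfolding t_def \<mu>_def[symmetric] using \<mu> ln by simp
    also have "- (8 * \<mu> * ln (real n)) / (4 * \<mu>) = - (2 * ln (real n))" using \<mu> by simp
    also have "exp (- (2 * ln (real n))) = 1 / (real n)\<^sup>2"
      using n exp_of_nat_mult[of 2 "ln (real n)"] by (simp add: exp_minus field_simps)
    finally show ?thesis by simp
  qed
  have "AE x in truth. x \<in> {0<..1}"
  proof -
    show ?thesis
      unfolding truth_def
      by (subst AE_density) (use AE_unit_lebesgue in \<open>auto elim: eventually_mono\<close>)
  qed
  then have "AE X in ?P. \<forall>i\<in>{..<n}. X i \<in> {0<..1}"
    by (intro AE_finite_allI AE_PiM_component prob_space_truth) auto
  then obtain N where N: "N \<in> null_sets ?P" "{X \<in> space ?P. \<not> (\<forall>i\<in>{..<n}. X i \<in> {0<..1})} \<subseteq> N"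
    by (auto simp: eventually_ae_filter)
  define BB where "BB = N \<union> (\<Union>\<epsilon>\<in>?W. B \<epsilon>)"
  have "measure ?P BB \<le> measure ?P N + measure ?P (\<Union>\<epsilon>\<in>?W. B \<epsilon>)"
    unfolding BB_def using N B_sets by (intro measure_Un_le) auto
  also have "measure ?P N = 0" using N by (simp add: null_sets_def measure_def)
  also have "measure ?P (\<Union>\<epsilon>\<in>?W. B \<epsilon>) \<le> (\<Sum>\<epsilon>\<in>?W. measure ?P (B \<epsilon>))"
    using B_sets by (intro P.finite_measure_subadditive_finite) auto
  also have "\<dots> \<le> (\<Sum>\<epsilon>\<in>?W. 2 / (real n)\<^sup>2)"
    using B_le by (intro sum_mono) auto
  also have "\<dots> = real (card ?W) * (2 / (real n)\<^sup>2)" by simp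
  also have "\<dots> \<le> real (2 ^ Suc L) * (2 / (real n)\<^sup>2)"
    using card_words_le[of L] by (intro mult_right_mono of_nat_mono) auto
  finally have "measure ?P BB \<le> 4 * 2 ^ L / (real n)\<^sup>2" by simp
  moreover have "BB \<in> sets ?P" unfolding BB_def using N B_sets by auto
  moreover have "good_sample n L X" if "X \<in> space ?P - BB" for X
    using that N(2) unfolding good_sample_def BB_def B_def t_def by auto
  ultimately show ?thesis unfolding iid_law_eq by blast
qed

end

section \<open>Approximation by dyadic histograms\<close>

lemma geometric_increments_limit:
  fixes u :: "nat \<Rightarrow> real"
  assumes \<rho>: "0 \<le> \<rho>" "\<rho> < 1" and d: "\<And>l. \<bar>u (Suc l) - u l\<bar> \<le> C * \<rho> ^ l"
  shows "u \<longlonglongrightarrow> u 0 + (\<Sum>i. u (Suc i) - u i)"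
    and "\<bar>u 0 + (\<Sum>i. u (Suc i) - u i) - u L\<bar> \<le> C * \<rho> ^ L / (1 - \<rho>)"
proof -
  have geo: "summable (\<lambda>i. C * \<rho> ^ i)" using \<rho> by (intro summable_mult summable_geometric) auto
  have abs: "summable (\<lambda>i. \<bar>u (Suc i) - u i\<bar>)"
    by (rule summable_comparison_test'[OF geo, of 0]) (use d in auto)
  then have sm: "summable (\<lambda>i. u (Suc i) - u i)" by (rule summable_rabs_cancel)
  have tel: "(\<Sum>i<l. u (Suc i) - u i) = u l - u 0" for l by (rule sum_lessThan_telescope)
  have "(\<lambda>l. u 0 + (u l - u 0)) \<longlonglongrightarrow> u 0 + (\<Sum>i. u (Suc i) - u i)"
    using summable_LIMSEQ[OF sm] unfolding tel by (intro tendsto_intros)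
  then show "u \<longlonglongrightarrow> u 0 + (\<Sum>i. u (Suc i) - u i)" by simp
  have "(\<Sum>i. u (Suc i) - u i) = (\<Sum>i. u (Suc (i + L)) - u (i + L)) + (u L - u 0)"
    using suminf_split_initial_segment[OF sm, of L] unfolding tel by simp
  then have "\<bar>u 0 + (\<Sum>i. u (Suc i) - u i) - u L\<bar> = \<bar>\<Sum>i. u (Suc (i + L)) - u (i + L)\<bar>" by simp
  also have "\<dots> \<le> (\<Sum>i. \<bar>u (Suc (i + L)) - u (i + L)\<bar>)"
    using abs by (intro summable_rabs) (simp add: summable_iff_shift[of "\<lambda>i. \<bar>u (Suc i) - u i\<bar>"])
  also have "\<dots> \<le> (\<Sum>i. C * \<rho> ^ L * \<rho> ^ i)"
  proof (rule suminf_le)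
    show "\<bar>u (Suc (i + L)) - u (i + L)\<bar> \<le> C * \<rho> ^ L * \<rho> ^ i" for i
      using d[of "i + L"] by (simp add: power_add mult_ac)
    show "summable (\<lambda>i. \<bar>u (Suc (i + L)) - u (i + L)\<bar>)"
      using abs by (simp add: summable_iff_shift[of "\<lambda>i. \<bar>u (Suc i) - u i\<bar>"])
    show "summable (\<lambda>i. C * \<rho> ^ L * \<rho> ^ i)"
      using \<rho> by (intro summable_mult summable_geometric) auto
  qed
  also have "\<dots> = C * \<rho> ^ L / (1 - \<rho>)"
    using \<rho> by (subst suminf_mult) (auto simp: suminf_geometric summable_geometric)
  finally show "\<bar>u 0 + (\<Sum>i. u (Suc i) - u i) - u L\<bar> \<le> C * \<rho> ^ L / (1 - \<rho>)" .
qed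

section \<open>Dyadic masses determine a density\<close>

lemma greaterThanAtMost_sets_unit: "t \<le> 1 \<Longrightarrow> {0<..t} \<in> sets unit_lebesgue"
  by (subst sets_restrict_space_iff) auto

text \<open>At every level l, (0,t] splits at the left endpoint of the cell containing t. Up to that
  endpoint the measures agree, and the rest lies in one cell of mass at most
  \<open>C / 2 ^ l\<close>, which vanishes in the limit.\<close>

lemma measure_initial_interval_eq:
  fixes P1 P2 :: "real measure"
  assumes P: "prob_space P1" "prob_space P2" "sets P1 = sets unit_lebesgue" "sets P2 = sets unit_lebesgue"
    and eq: "\<And>w. measure P1 (dyadic_interval w) = measure P2 (dyadic_interval w)"
    and small: "\<And>w. measure P1 (dyadic_interval w) \<le> C / 2 ^ length w"
    and t: "t \<in> {0<..1}"
  shows "measure P1 {0<..t} = measure P2 {0<..t}"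
proof -
  interpret P1: prob_space P1 by fact
  interpret P2: prob_space P2 by fact
  have I[simp]: "dyadic_interval w \<in> sets unit_lebesgue" for w by (rule dyadic_interval_sets_unit)
  have left: "0 \<le> dyadic_left w \<and> dyadic_left w \<le> 1" for w
  proof -
    obtain k where "k < 2 ^ length w" "dyadic_left w = real k / 2 ^ length w"
      using dyadic_left_index by blast
    moreover from this have "real k \<le> 2 ^ length w"
      using of_nat_mono[of k "2 ^ length w", where ?'a = real] by simp
    ultimately show ?thesis by simp
  qed
  \<comment> \<open>Appending the digit 0 does not move the left endpoint; appending 1 moves it
    across the left child, whose masses agree.\<close>
  have dyadic: "measure P1 {0<..dyadic_left w} = measure P2 {0<..dyadic_left w}" for w
  proof (induction w rule: rev_induct)
    case (snoc b w)
    show ?case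
    proof (cases b)
      case True
      have un: "{0<..dyadic_left (w @ [b])} = {0<..dyadic_left w} \<union> dyadic_interval (w @ [False])"
      proof -
        define h :: real where "h = 1 / 2 ^ Suc (length w)"
        have "0 \<le> h" by (simp add: h_def)
        then show ?thesis
          using left[of w] True
          unfolding dyadic_interval_def dyadic_left_snoc length_append_singleton h_def[symmetric]
          by (auto simp: h_def[symmetric] simp del: power_Suc)
      qed
      have "{0<..dyadic_left w} \<inter> dyadic_interval (w @ [False]) = {}"
        by (auto simp: dyadic_interval_def dyadic_left_snoc)
      then show ?thesis
        unfolding un using left[of w] P snoc eq
        by (simp add: P1.finite_measure_Union P2.finite_measure_Union greaterThanAtMost_sets_unit)
    qed (use snoc in \<open>simp add: dyadic_left_snoc\<close>)
  qed simp
  have bound: "\<bar>measure P1 {0<..t} - measure P2 {0<..t}\<bar> \<le> C * (1 / 2) ^ l" for l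
  proof -
    obtain w where w: "length w = l" "t \<in> dyadic_interval w"
      using dyadic_interval_length_ex[OF t] by auto
    define R where "R = {dyadic_left w<..t}"
    have R: "R \<in> sets unit_lebesgue" "R \<subseteq> dyadic_interval w"
      using t left[of w] w by (auto simp: R_def sets_restrict_space_iff dyadic_interval_def)
    have un: "{0<..t} = {0<..dyadic_left w} \<union> R" "{0<..dyadic_left w} \<inter> R = {}"
      using w left[of w] by (auto simp: R_def dyadic_interval_def)
    have "measure P1 {0<..t} - measure P2 {0<..t} = measure P1 R - measure P2 R"
      unfolding un(1) using left[of w] P R un(2) dyadic[of w]
      by (simp add: P1.finite_measure_Union P2.finite_measure_Union greaterThanAtMost_sets_unit)
    moreover have "measure P1 R \<le> measure P1 (dyadic_interval w)" "measure P2 R \<le> measure P2 (dyadic_interval w)"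
      using R P by (auto intro!: P1.finite_measure_mono P2.finite_measure_mono)
    moreover have "measure P1 (dyadic_interval w) \<le> C * (1 / 2) ^ l"
      using small[of w] w by (simp add: power_divide)
    ultimately show ?thesis
      using eq[of w] measure_nonneg[of P1 R] measure_nonneg[of P2 R] by linarith
  qed
  have "(\<lambda>l. C * (1 / 2) ^ l) \<longlonglongrightarrow> 0"
    using tendsto_mult_right_zero[OF LIMSEQ_realpow_zero[of "1 / 2 :: real"]] by simp
  then have "\<bar>measure P1 {0<..t} - measure P2 {0<..t}\<bar> \<le> 0"
    by (rule LIMSEQ_le_const) (use bound in auto)
  then show ?thesis by simp
qed

lemma AE_eq_if_dyadic_masses_eq:
  fixes f g :: "real \<Rightarrow> real"
  defines "P \<equiv> \<lambda>f. density unit_lebesgue (\<lambda>x. ennreal (f x))"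
  assumes [measurable]: "f \<in> borel_measurable unit_lebesgue" "g \<in> borel_measurable unit_lebesgue"
    and nonneg: "AE x in unit_lebesgue. 0 \<le> f x" "AE x in unit_lebesgue. 0 \<le> g x"
    and prob: "prob_space (P f)" "prob_space (P g)"
    and eq: "\<And>w. measure (P f) (dyadic_interval w) = measure (P g) (dyadic_interval w)"
    and small: "\<And>w. measure (P f) (dyadic_interval w) \<le> C / 2 ^ length w"
  shows "AE x in unit_lebesgue. f x = g x"
proof -
  interpret U: finite_measure unit_lebesgue by (rule finite_measure_unit_lebesgue)
  have sets_P: "sets (P h) = sets unit_lebesgue" for h by (simp add: P_def)
  have space_P: "space (P h) = {0..1}" for h by (simp add: P_def space_restrict_space)
  have id: "(\<lambda>x. x) \<in> borel_measurable (P h)" for h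
    using measurable_restrict_space1[of "\<lambda>x::real. x" lborel borel "{0..1}"] by (simp add: P_def)
  have init: "measure (P h) ({..t} \<inter> {0..1}) = measure (P h) {0<..min t 1}" if "prob_space (P h)"
    and [measurable]: "h \<in> borel_measurable unit_lebesgue" for t h
  proof -
    interpret prob_space "P h" by fact
    have "AE x in P h. x \<in> {0<..1}"
      unfolding P_def by (subst AE_density) (use AE_unit_lebesgue in \<open>auto elim: eventually_mono\<close>)
    then have "AE x in P h. x \<in> {..t} \<inter> {0..1} \<longleftrightarrow> x \<in> {0<..min t 1}"
      by eventually_elim auto
    then show ?thesis
      by (rule finite_measure_eq_AE) (auto simp: sets_P greaterThanAtMost_sets_unit sets_restrict_space_iff)
  qed
  have eq_init: "measure (P f) {0<..min t 1} = measure (P g) {0<..min t 1}" for t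
  proof (cases "t > 0")
    case True
    then show ?thesis
      by (intro measure_initial_interval_eq[OF prob sets_P sets_P eq small]) auto
  qed simp
  \<comment> \<open>Distribution functions characterise laws on the whole line, so both measures are
    pushed forward from [0,1] to the real line before they are compared.\<close>
  have "distr (P f) borel (\<lambda>x. x) = distr (P g) borel (\<lambda>x. x)"
  proof (rule cdf_unique)
    show "real_distribution (distr (P f) borel (\<lambda>x. x))" "real_distribution (distr (P g) borel (\<lambda>x. x))"
      by (intro prob_space.real_distribution_distr prob id)+
    show "cdf (distr (P f) borel (\<lambda>x. x)) = cdf (distr (P g) borel (\<lambda>x. x))"
      using init[OF prob(1)] init[OF prob(2)] eq_init
      by (auto simp: fun_eq_iff cdf_def measure_distr id space_P)
  qed
  then have meq: "measure (distr (P f) borel (\<lambda>x. x)) A = measure (distr (P g) borel (\<lambda>x. x)) A" for A by simp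
  have "P f = P g"
  proof (rule measure_eqI)
    fix A assume A: "A \<in> sets (P f)"
    then have A': "A \<in> sets borel" "A \<inter> {0..1} = A"
      by (auto simp: sets_P sets_restrict_space_iff)
    interpret Pf: prob_space "P f" by (rule prob)
    interpret Pg: prob_space "P g" by (rule prob)
    show "emeasure (P f) A = emeasure (P g) A"
      using meq[of A] A' by (simp add: measure_distr id space_P Pf.emeasure_eq_measure Pg.emeasure_eq_measure)
  qed (simp add: sets_P)
  then have "AE x in unit_lebesgue. ennreal (f x) = ennreal (g x)"
    unfolding P_def by (intro U.density_unique) auto
  then show ?thesis using nonneg by eventually_elim (auto simp: ennreal_inj)
qed

context bounded_density
begin

text \<open>The conditional expectation of \<open>f0\<close> given the cells of level l, written in
  the form of \<open>tree_density\<close> so that one lemma evaluates both.\<close>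

definition histogram :: "nat \<Rightarrow> real \<Rightarrow> real" where
  "histogram l x = (\<Sum>\<epsilon> | length \<epsilon> = l. 2 ^ l * cell_mass f0 \<epsilon> * indicator (dyadic_interval \<epsilon>) x)"

lemma histogram_eq: "x \<in> dyadic_interval w \<Longrightarrow> histogram (length w) x = 2 ^ length w * cell_mass f0 w"
  unfolding histogram_def by (rule sum_words_indicator)

lemma histogram_nonneg: "0 \<le> histogram l x"
  unfolding histogram_def
  by (intro sum_nonneg mult_nonneg_nonneg) (auto intro: less_imp_le cell_mass_pos)

lemma histogram_outside: "x \<notin> {0<..1} \<Longrightarrow> histogram l x = 0"
  unfolding histogram_def using dyadic_interval_subset_unit by (intro sum.neutral) (force simp: indicator_def)

lemma histogram_measurable [measurable]: "histogram l \<in> borel_measurable unit_lebesgue"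
proof -
  have "histogram l \<in> borel_measurable borel" unfolding histogram_def[abs_def] by measurable
  then show ?thesis by (intro measurable_restrict_space1) simp
qed

lemma histogram_le: "histogram l x \<le> m1"
proof (cases "x \<in> {0<..1}")
  case True
  then obtain w where w: "length w = l" "x \<in> dyadic_interval w" using dyadic_interval_length_ex by blast
  then show ?thesis
    using histogram_eq[OF w(2)] cell_mass_bounds(2)[of w] by (simp add: field_simps)
next
  case False
  have "0 < m1" using cell_mass_bounds(2)[of "[]"] cell_mass_Nil by simp
  then show ?thesis using False by (simp add: histogram_outside)
qed

lemma histogram_integrable: "integrable unit_lebesgue (histogram l)"
  by (rule U.integrable_const_bound[where B = m1]) (use histogram_nonneg histogram_le in auto)

text \<open>The martingale property, proved from the finest level upwards: the induction is on the
  number of levels between w and l, and the masses of two children add up. It passes the masses of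
  \<open>f0\<close> on to the limit of the histograms.\<close>

lemma histogram_cell_integral:
  "length w \<le> l \<Longrightarrow> (\<integral>x. histogram l x * indicator (dyadic_interval w) x \<partial>unit_lebesgue) = cell_mass f0 w"
proof (induction "l - length w" arbitrary: w)
  case 0
  then have l: "l = length w" by simp
  have "(\<integral>x. histogram l x * indicator (dyadic_interval w) x \<partial>unit_lebesgue)
    = (\<integral>x. 2 ^ length w * cell_mass f0 w * indicator (dyadic_interval w) x \<partial>unit_lebesgue)"
    unfolding l by (intro Bochner_Integration.integral_cong) (auto simp: histogram_eq indicator_def)
  also have "\<dots> = 2 ^ length w * cell_mass f0 w * measure unit_lebesgue (dyadic_interval w)"
  proof -
    have "dyadic_interval w \<inter> {0..1} = dyadic_interval w"
      using dyadic_interval_subset_unit[of w] by auto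
    then show ?thesis using dyadic_interval_sets_unit[of w] by (simp add: space_restrict_space)
  qed
  finally show ?case by (simp add: measure_dyadic_interval)
next
  case (Suc d)
  have ind: "indicator (dyadic_interval w) x = indicator (dyadic_interval (w @ [False])) x
      + (indicator (dyadic_interval (w @ [True])) x :: real)" for x
    using dyadic_interval_children[of w] dyadic_interval_children_disjoint[of w]
    by (auto simp: indicator_def)
  have int: "integrable unit_lebesgue (\<lambda>x. histogram l x * indicator (dyadic_interval v) x)" for v
    using integrable_mult_indicator[OF dyadic_interval_sets_unit histogram_integrable[of l], of v]
    by (simp add: mult.commute)
  have IH: "(\<integral>x. histogram l x * indicator (dyadic_interval (w @ [b])) x \<partial>unit_lebesgue) = cell_mass f0 (w @ [b])" for b
    using Suc by (intro Suc.hyps) auto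
  show ?case
    unfolding ind cell_mass_children[of w] distrib_left
    by (subst Bochner_Integration.integral_add) (auto simp: int IH)
qed

end

locale haar_regular_density = bounded_density +
  fixes \<alpha> R :: real
  assumes \<alpha>_pos: "\<alpha> > 0" and R_pos: "R > 0" and regular: "f0 \<in> haar_ball \<alpha> R"
begin

lemma cell_mass_diff_le:
  "\<bar>cell_mass f0 (\<epsilon> @ [True]) - cell_mass f0 (\<epsilon> @ [False])\<bar>
    \<le> R * 2 powr (- real (length \<epsilon>) * (\<alpha> + 1/2)) / 2 powr (real (length \<epsilon>) / 2)"
proof -
  let ?d = "cell_mass f0 (\<epsilon> @ [True]) - cell_mass f0 (\<epsilon> @ [False])"
  obtain k where k: "k < 2 ^ length \<epsilon>" "haar_coeff f0 (length \<epsilon>) k = 2 powr (real (length \<epsilon>) / 2) * ?d"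
    using cell_mass_diff_haar by blast
  then have "2 powr (real (length \<epsilon>) / 2) * \<bar>?d\<bar> \<le> R * 2 powr (- real (length \<epsilon>) * (\<alpha> + 1/2))"
    using regular unfolding haar_ball_def by (force simp: abs_mult)
  then show ?thesis by (simp add: field_simps)
qed

text \<open>The geometric ratio of the levels in sup norm: \<open>2 ^ l\<close> for the height of a
  cell, times the coefficient bound, times \<open>2 powr (- l / 2)\<close> for the normalisation of
  the wavelet, gives \<open>2 powr (- \<alpha> * l)\<close>.\<close>

definition decay :: real where "decay = 2 powr (- \<alpha>)"

lemma decay: "0 < decay" "decay < 1"
  using \<alpha>_pos by (auto simp: decay_def powr_less_one)

lemma cell_mass_diff_le_decay:
  "2 ^ length \<epsilon> * \<bar>cell_mass f0 (\<epsilon> @ [True]) - cell_mass f0 (\<epsilon> @ [False])\<bar> \<le> R * decay ^ length \<epsilon>"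
proof -
  let ?l = "real (length \<epsilon>)"
  have "2 ^ length \<epsilon> * \<bar>cell_mass f0 (\<epsilon> @ [True]) - cell_mass f0 (\<epsilon> @ [False])\<bar>
    \<le> 2 powr ?l * (R * 2 powr (- ?l * (\<alpha> + 1/2)) / 2 powr (?l / 2))"
    using mult_left_mono[OF cell_mass_diff_le[of \<epsilon>], of "2 powr ?l"]
    unfolding powr_realpow[of 2 "length \<epsilon>", simplified] by simp
  also have "\<dots> = R * (2 powr ?l * 2 powr (- ?l * (\<alpha> + 1/2)) / 2 powr (?l / 2))" by simp
  also have "2 powr ?l * 2 powr (- ?l * (\<alpha> + 1/2)) / 2 powr (?l / 2) = 2 powr (?l + - ?l * (\<alpha> + 1/2) - ?l / 2)"
    by (simp only: powr_diff powr_add)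
  also have "?l + - ?l * (\<alpha> + 1/2) - ?l / 2 = - \<alpha> * ?l" by (simp add: algebra_simps)
  also have "2 powr (- \<alpha> * ?l) = decay ^ length \<epsilon>"
    unfolding decay_def by (subst powr_realpow[symmetric]) (simp_all add: powr_powr)
  finally show ?thesis .
qed

lemma histogram_increment: "\<bar>histogram (Suc l) x - histogram l x\<bar> \<le> R * decay ^ l"
proof (cases "x \<in> {0<..1}")
  case True
  then obtain w where w: "length w = Suc l" "x \<in> dyadic_interval w" using dyadic_interval_length_ex by blast
  then obtain v b where v: "w = v @ [b]" by (cases w rule: rev_cases) auto
  then have l: "length v = l" using w by simp
  have "histogram (Suc l) x - histogram l x = 2 ^ l * (2 * cell_mass f0 w - cell_mass f0 v)"
    using histogram_eq[OF w(2)] histogram_eq[of x v] w v l dyadic_interval_snoc_subset[of v b]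
    by (auto simp: algebra_simps)
  then have "\<bar>histogram (Suc l) x - histogram l x\<bar> = 2 ^ l * \<bar>2 * cell_mass f0 w - cell_mass f0 v\<bar>"
    by (simp add: abs_mult)
  also have "\<bar>2 * cell_mass f0 w - cell_mass f0 v\<bar> = \<bar>cell_mass f0 (v @ [True]) - cell_mass f0 (v @ [False])\<bar>"
    unfolding v cell_mass_children[of v] by (cases b) auto
  finally show ?thesis using cell_mass_diff_le_decay[of v] l by simp
next
  case False
  then show ?thesis using R_pos decay by (simp add: histogram_outside)
qed

text \<open>The histograms converge uniformly; their limit has the same dyadic masses as \<open>f0\<close>, which
  identifies it with \<open>f0\<close> almost everywhere without a differentiation theorem.\<close>

lemma histogram_approx: "AE x in unit_lebesgue. \<bar>f0 x - histogram L x\<bar> \<le> R * decay ^ L / (1 - decay)"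
proof -
  \<comment> \<open>As a telescoping series rather than a limit, g is visibly measurable, and the
    tail of the series gives the uniform error.\<close>
  define g where "g x = histogram 0 x + (\<Sum>i. histogram (Suc i) x - histogram i x)" for x
  have g: "(\<lambda>l. histogram l x) \<longlonglongrightarrow> g x" "\<bar>g x - histogram l x\<bar> \<le> R * decay ^ l / (1 - decay)" for x l
    unfolding g_def
    using geometric_increments_limit[of decay "\<lambda>l. histogram l x" R] decay histogram_increment by auto
  have [measurable]: "g \<in> borel_measurable unit_lebesgue" unfolding g_def[abs_def] by measurable
  have g_bounds: "0 \<le> g x" "g x \<le> m1" for x
    using histogram_nonneg histogram_le
    by (auto intro!: LIMSEQ_le_const[OF g(1)] LIMSEQ_le_const2[OF g(1)])
  have g_int: "integrable unit_lebesgue g"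
    by (rule U.integrable_const_bound[where B = m1]) (use g_bounds in auto)
  have ind_int: "integrable unit_lebesgue (\<lambda>x. h x * indicator (dyadic_interval w) x)"
    if "integrable unit_lebesgue h" for h :: "real \<Rightarrow> real" and w
    using integrable_mult_indicator[OF dyadic_interval_sets_unit that, of w] by (simp add: mult.commute)
  have mass: "(\<integral>x. g x * indicator (dyadic_interval w) x \<partial>unit_lebesgue) = cell_mass f0 w" (is "?G = _") for w
  proof -
    have "\<bar>?G - cell_mass f0 w\<bar> \<le> R / (1 - decay) * decay ^ l" if l: "l \<ge> length w" for l
    proof -
      have "?G - cell_mass f0 w = (\<integral>x. g x * indicator (dyadic_interval w) x
          - histogram l x * indicator (dyadic_interval w) x \<partial>unit_lebesgue)"
        unfolding histogram_cell_integral[OF l, symmetric]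
        by (intro Bochner_Integration.integral_diff[symmetric] ind_int g_int histogram_integrable)
      also have "\<bar>\<dots>\<bar> \<le> (\<integral>x. \<bar>g x * indicator (dyadic_interval w) x
          - histogram l x * indicator (dyadic_interval w) x\<bar> \<partial>unit_lebesgue)"
        by (rule integral_abs_bound)
      also have "\<dots> \<le> (\<integral>x. R * decay ^ l / (1 - decay) \<partial>unit_lebesgue)"
        using g(2)[of _ l] R_pos decay
        by (intro integral_mono integrable_abs Bochner_Integration.integrable_diff ind_int g_int histogram_integrable)
           (auto simp: indicator_def)
      also have "\<dots> = R / (1 - decay) * decay ^ l"
        by (simp add: measure_restrict_space space_restrict_space)
      finally show ?thesis .
    qed
    moreover have "(\<lambda>l. R / (1 - decay) * decay ^ l) \<longlonglongrightarrow> 0"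
      using decay by (intro tendsto_mult_right_zero LIMSEQ_realpow_zero) auto
    ultimately have "\<bar>?G - cell_mass f0 w\<bar> \<le> 0"
      by (intro LIMSEQ_le_const[of "\<lambda>l. R / (1 - decay) * decay ^ l"]) auto
    then show ?thesis by simp
  qed
  let ?G = "density unit_lebesgue (\<lambda>x. ennreal (g x))"
  have G_cell: "emeasure ?G (dyadic_interval w) = ennreal (cell_mass f0 w)" for w
  proof -
    have "emeasure ?G (dyadic_interval w) = (\<integral>\<^sup>+ x. ennreal (g x * indicator (dyadic_interval w) x) \<partial>unit_lebesgue)"
      using dyadic_interval_sets_unit[of w]
      by (subst emeasure_density) (auto intro!: nn_integral_cong simp: indicator_def)
    also have "\<dots> = ennreal (\<integral>x. g x * indicator (dyadic_interval w) x \<partial>unit_lebesgue)"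
      using g_bounds by (intro nn_integral_eq_integral ind_int g_int) auto
    finally show ?thesis unfolding mass .
  qed
  have G_prob: "prob_space ?G"
  proof
    \<comment> \<open>The point 0 lies in no cell but is null, so the total mass is that of the root
      cell.\<close>
    have "AE x in ?G. x \<in> {0<..1}"
      by (subst AE_density) (use AE_unit_lebesgue in \<open>auto elim: eventually_mono\<close>)
    then have "emeasure ?G (space ?G) = emeasure ?G (dyadic_interval [])"
      using dyadic_interval_sets_unit[of "[]"]
      by (intro emeasure_eq_AE) (auto elim!: eventually_mono simp: space_restrict_space sets_restrict_space_iff)
    then show "emeasure ?G (space ?G) = 1"
      unfolding G_cell cell_mass_Nil by simp
  qed
  have "AE x in unit_lebesgue. f0 x = g x"
  proof (rule AE_eq_if_dyadic_masses_eq[where C = m1])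
    show "prob_space (density unit_lebesgue (\<lambda>x. ennreal (f0 x)))"
      using prob_space_truth by (simp add: truth_def)
    show "measure (density unit_lebesgue (\<lambda>x. ennreal (f0 x))) (dyadic_interval w)
        = measure ?G (dyadic_interval w)" for w
      using measure_truth_cell[of w] G_cell[of w] cell_mass_pos[of w]
      by (simp add: truth_def measure_def less_imp_le)
    show "measure (density unit_lebesgue (\<lambda>x. ennreal (f0 x))) (dyadic_interval w) \<le> m1 / 2 ^ length w" for w
      using measure_truth_cell[of w] cell_mass_bounds(2)[of w] by (simp add: truth_def)
    show "AE x in unit_lebesgue. 0 \<le> f0 x"
      using f0_bounds by eventually_elim (use m0_pos in auto)
  qed (use G_prob g_bounds in auto)
  then show ?thesis by eventually_elim (use g(2) in auto)
qed

end

section \<open>Levels, depth and the error of the splits\<close>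

text \<open>The term of largest index dominates, up to the factor \<open>x / (x - 1)\<close>. Since
  T is assumed to bound every term on S, the critical level need not be located: it suffices that
  each level of a class satisfies the bound.\<close>

lemma sum_geometric_growth_le:
  fixes x c T :: real
  assumes x: "x > 1" and S: "finite S" "\<And>l. l \<in> S \<Longrightarrow> c * x ^ l \<le> T" and "c \<ge> 0" "T \<ge> 0"
  shows "(\<Sum>l\<in>S. c * x ^ l) \<le> T * (x / (x - 1))"
proof (cases "S = {}")
  case False
  define m where "m = Max S"
  have "(\<Sum>l\<in>S. c * x ^ l) \<le> (\<Sum>l<Suc m. c * x ^ l)"
    using S False assms by (intro sum_mono2) (auto simp: m_def less_Suc_eq_le)
  also have "\<dots> = c * ((x ^ Suc m - 1) / (x - 1))"
    using x by (subst sum_distrib_left[symmetric], subst geometric_sum) auto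
  also have "\<dots> \<le> c * (x ^ Suc m / (x - 1))"
    using x assms by (intro mult_left_mono divide_right_mono) auto
  also have "\<dots> = c * x ^ m * (x / (x - 1))" by simp
  also have "\<dots> \<le> T * (x / (x - 1))"
    using S False x by (intro mult_right_mono) (auto simp: m_def)
  finally show ?thesis .
qed (use assms in simp)

text \<open>The decreasing counterpart: the smallest index is factored out and the rest is bounded
  by the full geometric series.\<close>

lemma sum_geometric_decay_le:
  fixes x c T :: real
  assumes x: "0 < x" "x < 1" and S: "finite S" "\<And>l. l \<in> S \<Longrightarrow> x ^ l \<le> T" and "T \<ge> 0"
  shows "(\<Sum>l\<in>S. x ^ l) \<le> T / (1 - x)"
proof (cases "S = {}")
  case False
  define m where "m = Min S"
  have m: "m \<in> S" "\<And>l. l \<in> S \<Longrightarrow> m \<le> l" using S False by (auto simp: m_def)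
  have "(\<Sum>l\<in>S. x ^ l) = (\<Sum>l\<in>S. x ^ m * x ^ (l - m))"
    using m by (intro sum.cong) (auto simp flip: power_add)
  also have "\<dots> = x ^ m * (\<Sum>l\<in>S. x ^ (l - m))" by (simp add: sum_distrib_left)
  also have "(\<Sum>l\<in>S. x ^ (l - m)) = (\<Sum>i\<in>(\<lambda>l. l - m) ` S. x ^ i)"
    using m by (subst sum.reindex) (auto simp: inj_on_def eq_diff_iff)
  also have "\<dots> \<le> (\<Sum>i. x ^ i)"
    using x S by (intro sum_le_suminf summable_geometric) auto
  also have "\<dots> = 1 / (1 - x)" using x by (simp add: suminf_geometric)
  finally have "(\<Sum>l\<in>S. x ^ l) \<le> x ^ m * (1 / (1 - x))" using x by (simp add: mult_left_mono)
  also have "\<dots> \<le> T * (1 / (1 - x))"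
    using S m x by (intro mult_right_mono) auto
  finally show ?thesis by simp
qed (use assms in simp)

lemma tree_mass_snoc: "tree_mass y (w @ [b]) = tree_mass y w * split_var y (w @ [b])"
proof -
  have "(\<Prod>j<length w. split_var y (take j (w @ [b]) @ [(w @ [b]) ! j]))
      = (\<Prod>j<length w. split_var y (take j w @ [w ! j]))"
    by (intro prod.cong) (auto simp: nth_append)
  then show ?thesis by (simp add: tree_mass_eq_prod)
qed

text \<open>As exp (- \<kappa>) is at most 1/2, the normalising sum lies between 1 and 2. The bound
  on the odds is what penalises slabs at high levels; the last bound limits what the penalty can
  cost at any level. The weight of a split is that of its child word, one letter longer, and this
  extra factor gives p \<le> 1/2.\<close>

lemma slab_weight_bounds:
  assumes \<kappa>: "\<kappa> \<ge> 1" and \<epsilon>: "length \<epsilon> < L"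
  defines "p \<equiv> slab_weight \<kappa> L (\<epsilon> @ [False])"
  shows "0 < p" "p \<le> 1 / 2" "p / (1 - p) \<le> 2 * exp (- \<kappa> * real (length \<epsilon>))"
    "exp (- \<kappa> * real L) / 2 \<le> p"
proof -
  define S where "S = (\<Sum>j = 0..L. exp (- \<kappa> * real j))"
  have e: "exp (- \<kappa>) \<le> 1 / 2"
  proof -
    have "2 \<le> exp \<kappa>" using exp_ge_add_one_self[of \<kappa>] \<kappa> by linarith
    then show ?thesis by (simp add: exp_minus field_simps)
  qed
  have S1: "1 \<le> S"
  proof -
    have "exp (- \<kappa> * real 0) \<le> S" unfolding S_def by (intro member_le_sum) auto
    then show ?thesis by simp
  qed
  have S2: "S \<le> 2"
  proof -
    have "S = (\<Sum>j\<in>{0..L}. exp (- \<kappa>) ^ j)"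
      unfolding S_def by (intro sum.cong) (auto simp: exp_of_nat_mult[symmetric] mult.commute)
    also have "\<dots> \<le> 1 / (1 - exp (- \<kappa>))"
      using \<kappa> by (intro sum_geometric_decay_le) (auto intro: power_le_one)
    also have "\<dots> \<le> 1 / (1 / 2)" using e \<kappa> by (intro divide_left_mono) auto
    also have "\<dots> = (2::real)" by simp
    finally show ?thesis .
  qed
  have p: "p = exp (- \<kappa> * real (Suc (length \<epsilon>))) / S"
    by (simp add: p_def slab_weight_def S_def)
  show "0 < p" using S1 by (simp add: p)
  have "p \<le> exp (- \<kappa> * real (Suc (length \<epsilon>)))"
    unfolding p using S1 by (simp add: divide_le_eq)
  also have E: "\<dots> = exp (- \<kappa>) * exp (- \<kappa> * real (length \<epsilon>))"
    by (simp add: exp_add[symmetric] algebra_simps)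
  also have "\<dots> \<le> 1 / 2 * exp (- \<kappa> * real (length \<epsilon>))"
    using e by (intro mult_right_mono) auto
  finally have p_le: "p \<le> 1 / 2 * exp (- \<kappa> * real (length \<epsilon>))" .
  also have "\<dots> \<le> 1 / 2" using \<kappa> by simp
  finally show half: "p \<le> 1 / 2" .
  have "p / (1 - p) \<le> p / (1 / 2)" using half \<open>0 < p\<close> by (intro divide_left_mono) auto
  also have "\<dots> \<le> 2 * exp (- \<kappa> * real (length \<epsilon>))"
  proof -
    have "p / (1 / 2) \<le> 2 * u" if "p \<le> 1 / 2 * u" "0 \<le> u" for u
      using that by simp
    from this[OF p_le] show ?thesis by simp
  qed
  finally show "p / (1 - p) \<le> 2 * exp (- \<kappa> * real (length \<epsilon>))" .
  have "exp (- \<kappa> * real L) / 2 \<le> exp (- \<kappa> * real (Suc (length \<epsilon>))) / S"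
    using \<epsilon> \<kappa> S1 S2 by (intro frac_le iffD2[OF exp_le_cancel_iff]) auto
  then show "exp (- \<kappa> * real L) / 2 \<le> p" by (simp add: p)
qed

lemma tree_depth_bounds:
  assumes n: "n \<ge> 2"
  defines "L \<equiv> tree_depth n"
  shows "2 ^ L * L\<^sup>2 \<le> n" "n < 2 ^ Suc L * (Suc L)\<^sup>2" "L \<ge> 1"
proof -
  \<comment> \<open>\<open>GREATEST\<close> requires a bounded nonempty set: 0 belongs to it, and y
    \<le> \<open>2 ^ y\<close> bounds its members by n.\<close>
  have bound: "y \<le> n" if "2 ^ y * y\<^sup>2 \<le> n" for y
  proof (cases "y = 0")
    case False
    have "y \<le> 2 ^ y" by (simp add: less_imp_le)
    also have "\<dots> \<le> 2 ^ y * y\<^sup>2" using False by simp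
    finally show ?thesis using that by simp
  qed simp
  show "2 ^ L * L\<^sup>2 \<le> n"
    unfolding L_def tree_depth_def
    by (rule GreatestI_nat[where k = 0 and b = n]) (simp, rule bound)
  have le: "y \<le> L" if "2 ^ y * y\<^sup>2 \<le> n" for y
    unfolding L_def tree_depth_def
    by (rule Greatest_le_nat[where b = n]) (rule that, rule bound)
  show "n < 2 ^ Suc L * (Suc L)\<^sup>2" using le[of "Suc L"] by force
  show "L \<ge> 1" using le[of 1] n by simp
qed

text \<open>The defining inequality gives L \<le> 2 ln n. Inserting this into its failure at L + 1
  shows that \<open>2 ^ L\<close> is at least n divided by a power of the logarithm.\<close>

lemma tree_depth_real_bounds:
  assumes n: "n \<ge> 2"
  defines "L \<equiv> tree_depth n"
  shows "2 ^ L \<le> real n" "real L \<le> 2 * ln (real n)" "(real L)\<^sup>2 \<le> real n / 2 ^ L"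
    "real n / (2 * (2 * ln (real n) + 1)\<^sup>2) \<le> 2 ^ L"
    "ln (real n) - ln (2 * (2 * ln (real n) + 1)\<^sup>2) \<le> real L"
proof -
  note b = tree_depth_bounds[OF n, folded L_def]
  have lnpos: "ln (real n) > 0" using n by simp
  have "real (2 ^ L * L\<^sup>2) \<le> real n" using b(1) of_nat_mono by blast
  then have sq: "2 ^ L * (real L)\<^sup>2 \<le> real n" by simp
  then show "(real L)\<^sup>2 \<le> real n / 2 ^ L" by (simp add: field_simps)
  have "(2 ^ L :: real) * 1 \<le> 2 ^ L * (real L)\<^sup>2"
    using b(3) by (intro mult_left_mono) auto
  then show 2: "2 ^ L \<le> real n" using sq by linarith
  have "real L * ln 2 = ln (2 ^ L)" by (simp add: ln_realpow)
  also have "\<dots> \<le> ln (real n)" using 2 n by (intro ln_mono) auto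
  finally have L2: "real L * ln 2 \<le> ln (real n)" .
  have "ln (2::real) \<ge> 1 / 2" using ln2_ge_two_thirds by simp
  then have "real L * (1 / 2) \<le> real L * ln 2" by (intro mult_left_mono) auto
  then show L_le: "real L \<le> 2 * ln (real n)" using L2 by simp
  have "real n \<le> real (2 ^ Suc L * (Suc L)\<^sup>2)" using b(2) of_nat_mono less_imp_le by blast
  also have "\<dots> = 2 ^ L * (2 * (real L + 1)\<^sup>2)" by (simp add: power2_eq_square algebra_simps)
  also have "\<dots> \<le> 2 ^ L * (2 * (2 * ln (real n) + 1)\<^sup>2)"
    using L_le by (intro mult_left_mono power_mono) auto
  finally have n_le: "real n \<le> 2 ^ L * (2 * (2 * ln (real n) + 1)\<^sup>2)" .
  have pos: "2 * (2 * ln (real n) + 1)\<^sup>2 > 0" using lnpos by simp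
  then show low: "real n / (2 * (2 * ln (real n) + 1)\<^sup>2) \<le> 2 ^ L"
    using n_le by (simp add: pos_divide_le_eq)
  have "ln (real n) \<le> ln (2 ^ L * (2 * (2 * ln (real n) + 1)\<^sup>2))"
    using n_le n by (intro ln_mono) auto
  also have "\<dots> = real L * ln 2 + ln (2 * (2 * ln (real n) + 1)\<^sup>2)"
    using pos by (subst ln_mult_pos) (auto simp: ln_realpow)
  also have "real L * ln 2 \<le> real L * 1"
    using ln_2_less_1 by (intro mult_left_mono) auto
  finally show "ln (real n) - ln (2 * (2 * ln (real n) + 1)\<^sup>2) \<le> real L" by simp
qed

text \<open>The factor \<open>L ^ 2\<close> in the depth condition makes n / \<open>2 ^ L\<close> at
  least the square of L, which is of order the square of ln n and so exceeds any multiple of ln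
  n.\<close>

lemma cells_eventually_heavy: "\<forall>\<^sub>F n in sequentially. K * ln (real n) \<le> real n / 2 ^ tree_depth n"
proof -
  have "\<forall>\<^sub>F n in sequentially. K * ln (real n) \<le> (ln (real n) - ln (2 * (2 * ln (real n) + 1)\<^sup>2))\<^sup>2"
    by real_asymp
  moreover have "\<forall>\<^sub>F n in sequentially. 0 \<le> ln (real n) - ln (2 * (2 * ln (real n) + 1)\<^sup>2)"
    by real_asymp
  ultimately show ?thesis
    using eventually_ge_at_top[of 2]
  proof eventually_elim
    case (elim n)
    have "(ln (real n) - ln (2 * (2 * ln (real n) + 1)\<^sup>2))\<^sup>2 \<le> (real (tree_depth n))\<^sup>2"
      using elim tree_depth_real_bounds(5)[of n] by (intro power_mono) auto
    then show ?case using elim tree_depth_real_bounds(3)[of n] by linarith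
  qed
qed

section \<open>Levels above and below the noise\<close>

definition noise :: "nat \<Rightarrow> real" where
  "noise n = ln (real n) / real n"

context haar_regular_density
begin

text \<open>What is compared with the noise is the bound of the Haar ball and not the coefficients
  themselves, so the property depends on the level only.\<close>

definition high :: "nat \<Rightarrow> nat \<Rightarrow> bool" where
  "high n l \<longleftrightarrow> R * 2 powr (- real l * (\<alpha> + 1/2)) \<le> sqrt (noise n)"

definition rate :: "nat \<Rightarrow> real" where
  "rate n = noise n powr (\<alpha> / (2 * \<alpha> + 1))"

lemma rate_tendsto_0: "rate \<longlonglongrightarrow> 0"
  unfolding rate_def noise_def using \<alpha>_pos by real_asymp

lemma noise_pos: "n \<ge> 2 \<Longrightarrow> noise n > 0"
  by (simp add: noise_def)

text \<open>Up to logarithms \<open>2 powr (- L)\<close> is 1/n, and the exponent \<alpha> + 1/2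
  strictly exceeds 1/2. It makes the bias of cutting \<open>f0\<close> off at depth L at most of the
  order of the rate.\<close>

lemma high_tree_depth: "\<forall>\<^sub>F n in sequentially. high n (tree_depth n)"
proof -
  have "\<forall>\<^sub>F n in sequentially. R * (2 * (2 * ln (real n) + 1)\<^sup>2 / real n) powr (\<alpha> + 1/2) \<le> sqrt (ln (real n) / real n)"
    using \<alpha>_pos R_pos by real_asymp
  then show ?thesis
    using eventually_ge_at_top[of 2]
  proof eventually_elim
    case (elim n)
    let ?L = "tree_depth n"
    let ?A = "2 * (2 * ln (real n) + 1)\<^sup>2"
    have ln: "ln (real n) > 0" using elim by simp
    then have A: "?A > 0" by simp
    have "1 / 2 ^ ?L \<le> 1 / (real n / ?A)"
      using tree_depth_real_bounds(4)[of n] A elim by (intro divide_left_mono) auto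
    then have "1 / 2 ^ ?L \<le> ?A / real n" by simp
    then have "(1 / 2 ^ ?L) powr (\<alpha> + 1/2) \<le> (?A / real n) powr (\<alpha> + 1/2)"
      using \<alpha>_pos by (intro powr_mono2) auto
    also have "(1 / 2 ^ ?L :: real) = 2 powr (- real ?L)"
      by (simp add: powr_minus powr_realpow field_simps)
    finally have "2 powr (- real ?L * (\<alpha> + 1/2)) \<le> (?A / real n) powr (\<alpha> + 1/2)"
      by (simp add: powr_powr)
    then have "R * 2 powr (- real ?L * (\<alpha> + 1/2)) \<le> R * (?A / real n) powr (\<alpha> + 1/2)"
      using R_pos by (intro mult_left_mono) auto
    then show ?case unfolding high_def noise_def using elim by linarith
  qed
qed

text \<open>Where \<alpha> \<le> 1 enters: the exponent per level is at most 3/2, so for l < ln n /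
  4 the bound of the Haar ball exceeds \<open>R * n powr (- 3/8)\<close>, and 3/8 is less than the
  exponent 1/2 of the noise.\<close>

lemma high_level_ge:
  assumes "\<alpha> \<le> 1"
  shows "\<forall>\<^sub>F n in sequentially. \<forall>l. high n l \<longrightarrow> ln (real n) / 4 \<le> real l"
proof -
  have "\<forall>\<^sub>F n in sequentially. sqrt (ln (real n) / real n) < R * exp (- (3/8 * ln (real n)))"
    using R_pos by real_asymp
  then show ?thesis
  proof eventually_elim
    case (elim n)
    show ?case
    proof (intro allI impI, rule ccontr)
      fix l assume h: "high n l" and "\<not> ln (real n) / 4 \<le> real l"
      then have l: "real l < ln (real n) / 4" by simp
      have "- (3/8 * ln (real n)) \<le> - (3/2 * real l)" using l by simp
      also have "\<dots> \<le> - real l * (\<alpha> + 1/2)"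
        using mult_left_mono[OF assms, of "real l"] by (simp add: algebra_simps)
      also have "\<dots> \<le> (- real l * (\<alpha> + 1/2)) * ln 2"
      proof -
        have "0 \<le> real l * (\<alpha> + 1/2)" using \<alpha>_pos by simp
        from mult_left_mono[OF less_imp_le[OF ln_2_less_1] this] show ?thesis by simp
      qed
      finally have "exp (- (3/8 * ln (real n))) \<le> 2 powr (- real l * (\<alpha> + 1/2))"
        by (simp add: powr_def)
      then have "R * exp (- (3/8 * ln (real n))) \<le> R * 2 powr (- real l * (\<alpha> + 1/2))"
        using R_pos by (intro mult_left_mono) auto
      then show False using elim h unfolding high_def noise_def by linarith
    qed
  qed
qed

text \<open>The left side is the order of the stochastic error of a split at level l. Failure of
  \<open>high\<close> bounds \<open>2 powr (l * (\<alpha> + 1/2))\<close>; the power 1 / (2\<alpha>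
  + 1) turns this into \<open>sqrt 2 ^ l\<close>.\<close>

lemma low_level_noise_le:
  assumes n: "n \<ge> 2" and low: "\<not> high n l"
  shows "sqrt (noise n) * sqrt 2 ^ l \<le> R powr (1 / (2 * \<alpha> + 1)) * rate n"
proof -
  define q where "q = noise n"
  have q: "q > 0" using noise_pos[OF n] by (simp add: q_def)
  have "sqrt q < R * 2 powr (- (real l * (\<alpha> + 1/2)))" using low by (simp add: high_def q_def)
  then have "2 powr (real l * (\<alpha> + 1/2)) \<le> R / sqrt q"
    using q by (simp add: powr_minus field_simps)
  then have "(2 powr (real l * (\<alpha> + 1/2))) powr (1 / (2 * \<alpha> + 1)) \<le> (R / sqrt q) powr (1 / (2 * \<alpha> + 1))"
    using \<alpha>_pos by (intro powr_mono2) auto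
  moreover have "real l * (\<alpha> + 1/2) * (1 / (2 * \<alpha> + 1)) = 1/2 * real l"
    using \<alpha>_pos by (simp add: field_simps)
  moreover have "2 powr (1/2 * real l) = sqrt 2 ^ l"
  proof -
    have "2 powr (1/2 * real l) = (2 powr (1/2)) powr real l" by (simp only: powr_powr)
    then show ?thesis by (simp only: powr_half_sqrt powr_realpow) (simp add: powr_realpow)
  qed
  ultimately have "sqrt 2 ^ l \<le> (R / sqrt q) powr (1 / (2 * \<alpha> + 1))"
    by (simp only: powr_powr)
  also have "\<dots> = R powr (1 / (2 * \<alpha> + 1)) * q powr (- (1/2 * (1 / (2 * \<alpha> + 1))))"
    using q R_pos by (simp add: powr_divide powr_half_sqrt[symmetric] powr_powr powr_minus field_simps)
  finally have "sqrt q * sqrt 2 ^ l \<le> q powr (1/2) * (R powr (1 / (2 * \<alpha> + 1)) * q powr (- (1/2 * (1 / (2 * \<alpha> + 1)))))"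
    using q by (simp add: powr_half_sqrt)
  also have "\<dots> = R powr (1 / (2 * \<alpha> + 1)) * q powr (1/2 + - (1/2 * (1 / (2 * \<alpha> + 1))))"
    by (simp only: powr_add mult_ac)
  also have "1/2 + - (1/2 * (1 / (2 * \<alpha> + 1))) = \<alpha> / (2 * \<alpha> + 1)"
    using \<alpha>_pos by (simp add: field_simps)
  finally show ?thesis by (simp add: rate_def q_def)
qed

text \<open>The same threshold read for the bias: the power 2\<alpha> / (2\<alpha> + 1) turns the
  coefficient bound into \<open>2 powr (- \<alpha> * l)\<close>. Bias and stochastic error thus meet
  at the same rate.\<close>

lemma high_level_decay_le:
  assumes n: "n \<ge> 2" and high: "high n l"
  shows "decay ^ l \<le> R powr (- (2 * \<alpha> / (2 * \<alpha> + 1))) * rate n"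
proof -
  define q where "q = noise n"
  define e where "e = 2 * \<alpha> / (2 * \<alpha> + 1)"
  have q: "q > 0" using noise_pos[OF n] by (simp add: q_def)
  have e: "e > 0" using \<alpha>_pos by (simp add: e_def)
  have "2 powr (- real l * (\<alpha> + 1/2)) \<le> sqrt q / R"
    using high R_pos by (simp add: high_def q_def field_simps)
  then have "(2 powr (- real l * (\<alpha> + 1/2))) powr e \<le> (sqrt q / R) powr e"
    using e by (intro powr_mono2) auto
  moreover have "- real l * (\<alpha> + 1/2) * e = - \<alpha> * real l"
    using \<alpha>_pos by (simp add: e_def field_simps)
  moreover have "2 powr (- \<alpha> * real l) = decay ^ l"
    unfolding decay_def by (subst powr_realpow[symmetric]) (simp_all add: powr_powr)
  ultimately have "decay ^ l \<le> (sqrt q / R) powr e" by (simp only: powr_powr)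
  also have "\<dots> = R powr (- e) * q powr (1/2 * e)"
    using q R_pos by (simp add: powr_divide powr_half_sqrt[symmetric] powr_powr powr_minus field_simps)
  also have "1/2 * e = \<alpha> / (2 * \<alpha> + 1)" by (simp add: e_def)
  finally show ?thesis by (simp add: rate_def q_def e_def)
qed

section \<open>The true splits and the propagation of their errors\<close>

definition split_prob :: "word \<Rightarrow> real" where
  "split_prob \<epsilon> = cell_mass f0 (\<epsilon> @ [False]) / cell_mass f0 \<epsilon>"

lemma one_minus_split_prob: "1 - split_prob \<epsilon> = cell_mass f0 (\<epsilon> @ [True]) / cell_mass f0 \<epsilon>"
  using cell_mass_children[of \<epsilon>] cell_mass_pos[of \<epsilon>] by (simp add: split_prob_def field_simps)

lemma m_bounds: "m0 \<le> 1" "1 \<le> m1"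
  using cell_mass_bounds[of "[]"] by (auto simp: cell_mass_Nil)

lemma child_mass_ratio_ge: "m0 / (2 * m1) \<le> cell_mass f0 (\<epsilon> @ [b]) / cell_mass f0 \<epsilon>"
proof -
  have "m0 / (2 * m1) = (m0 / 2 ^ length (\<epsilon> @ [b])) / (m1 / 2 ^ length \<epsilon>)"
    using m_bounds by (simp add: field_simps)
  also have "\<dots> \<le> cell_mass f0 (\<epsilon> @ [b]) / cell_mass f0 \<epsilon>"
    using cell_mass_bounds(1)[of "\<epsilon> @ [b]"] cell_mass_bounds(2)[of \<epsilon>] cell_mass_pos[of \<epsilon>]
      cell_mass_pos[of "\<epsilon> @ [b]"]
    by (intro frac_le) auto
  finally show ?thesis .
qed

lemma split_prob_bounds: "m0 / (2 * m1) \<le> split_prob \<epsilon>" "split_prob \<epsilon> \<le> 1 - m0 / (2 * m1)"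
  using child_mass_ratio_ge[of \<epsilon> False] child_mass_ratio_ge[of \<epsilon> True] one_minus_split_prob[of \<epsilon>]
  by (auto simp: split_prob_def)

lemma split_var_split_prob: "split_var split_prob (\<epsilon> @ [b]) = cell_mass f0 (\<epsilon> @ [b]) / cell_mass f0 \<epsilon>"
  using one_minus_split_prob[of \<epsilon>] by (cases b) (simp_all add: split_var_def split_prob_def)

text \<open>The price of choosing the spike: at high levels this bias takes the place of the
  stochastic error.\<close>

lemma split_prob_near_half: "\<bar>1/2 - split_prob \<epsilon>\<bar> \<le> R * decay ^ length \<epsilon> / (2 * m0)"
proof -
  let ?P = "2 ^ length \<epsilon> :: real"
  let ?d = "\<bar>cell_mass f0 (\<epsilon> @ [True]) - cell_mass f0 (\<epsilon> @ [False])\<bar>"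
  have "1/2 - split_prob \<epsilon> = ((1 - split_prob \<epsilon>) - split_prob \<epsilon>) / 2" by simp
  also have "\<dots> = (cell_mass f0 (\<epsilon> @ [True]) - cell_mass f0 (\<epsilon> @ [False])) / cell_mass f0 \<epsilon> / 2"
    unfolding one_minus_split_prob by (simp add: split_prob_def diff_divide_distrib)
  finally have "\<bar>1/2 - split_prob \<epsilon>\<bar> = ?d / cell_mass f0 \<epsilon> / 2"
    using cell_mass_pos[of \<epsilon>] by simp
  also have "\<dots> \<le> ?d / (m0 / ?P) / 2"
    using cell_mass_bounds(1)[of \<epsilon>] cell_mass_pos[of \<epsilon>] m0_pos
    by (intro divide_right_mono divide_left_mono) auto
  also have "\<dots> = ?P * ?d / (2 * m0)" by (simp add: mult_ac)
  also have "\<dots> \<le> R * decay ^ length \<epsilon> / (2 * m0)"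
    using cell_mass_diff_le_decay[of \<epsilon>] m0_pos by (intro divide_right_mono) auto
  finally show ?thesis .
qed

lemma cell_mass_eq_tree_mass: "cell_mass f0 w = tree_mass split_prob w"
proof (induction w rule: rev_induct)
  case Nil
  then show ?case by (simp add: cell_mass_Nil tree_mass_def)
next
  case (snoc b w)
  then show ?case
    using cell_mass_pos[of w] by (simp add: tree_mass_snoc split_var_split_prob)
qed

text \<open>True child ratios are at least \<open>m0 / (2 * m1)\<close>, so an absolute split error
  of that size times \<delta> is a relative error of at most \<delta>. Relative errors compound
  along the path, by writing \<open>t * v - c * v0\<close> as
  \<open>(t - c) * v + c * (v - v0)\<close> and using v \<le> v0 (1 + d).\<close>

lemma tree_mass_relative_error:
  assumes "\<And>\<epsilon>. length \<epsilon> < L \<Longrightarrow> 0 \<le> y \<epsilon> \<and> y \<epsilon> \<le> 1 \<and> \<bar>y \<epsilon> - split_prob \<epsilon>\<bar> \<le> m0 / (2 * m1) * \<delta> (length \<epsilon>)"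
  shows "length w \<le> L \<Longrightarrow>
    \<bar>tree_mass y w - cell_mass f0 w\<bar> \<le> cell_mass f0 w * ((\<Prod>j<length w. 1 + \<delta> j) - 1)"
proof (induction w rule: rev_induct)
  case Nil
  then show ?case by (simp add: cell_mass_Nil tree_mass_def)
next
  case (snoc b w)
  define v v0 c t d P where defs: "v = split_var y (w @ [b])" "v0 = split_var split_prob (w @ [b])"
    "c = cell_mass f0 w" "t = tree_mass y w" "d = \<delta> (length w)" "P = (\<Prod>j<length w. 1 + \<delta> j)"
  have y: "0 \<le> y w" "y w \<le> 1" "\<bar>y w - split_prob w\<bar> \<le> m0 / (2 * m1) * d"
    using assms[of w] snoc.prems by (auto simp: defs)
  have d: "0 \<le> d"
  proof -
    have "0 \<le> m0 / (2 * m1) * d" using y(3) by linarith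
    then show ?thesis using m0_pos m_bounds by (simp add: zero_le_mult_iff zero_le_divide_iff)
  qed
  have v: "0 \<le> v" using y by (cases b) (auto simp: defs split_var_def)
  have v0: "m0 / (2 * m1) \<le> v0"
    using child_mass_ratio_ge[of w b] by (simp add: defs split_var_split_prob)
  have v0': "0 \<le> v0" using v0 m0_pos m_bounds by (meson divide_nonneg_nonneg less_imp_le mult_nonneg_nonneg order_trans zero_le_numeral zero_le_one)
  have "\<bar>v - v0\<bar> \<le> m0 / (2 * m1) * d"
    using y(3) by (cases b) (auto simp: defs split_var_def)
  also have "\<dots> \<le> v0 * d" using v0 d by (intro mult_right_mono)
  finally have vv: "\<bar>v - v0\<bar> \<le> v0 * d" .
  have c: "c > 0" by (simp add: defs cell_mass_pos)
  have IH: "\<bar>t - c\<bar> \<le> c * (P - 1)" using snoc by (simp add: defs)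
  have "0 \<le> c * (P - 1)" using IH abs_ge_zero[of "t - c"] by linarith
  then have P1: "1 \<le> P" using c by (simp add: zero_le_mult_iff)
  have eqs: "tree_mass y (w @ [b]) = t * v" "cell_mass f0 (w @ [b]) = c * v0"
    "(\<Prod>j<length (w @ [b]). 1 + \<delta> j) = P * (1 + d)"
    by (simp_all add: defs tree_mass_snoc cell_mass_eq_tree_mass)
  have "t * v - c * v0 = (t - c) * v + c * (v - v0)" by (simp add: algebra_simps)
  then have "\<bar>t * v - c * v0\<bar> \<le> \<bar>t - c\<bar> * v + c * \<bar>v - v0\<bar>"
    using abs_triangle_ineq[of "(t - c) * v" "c * (v - v0)"] v c by (simp add: abs_mult)
  also have "\<dots> \<le> (c * (P - 1)) * (v0 * (1 + d)) + c * (v0 * d)"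
    using IH vv v c P1 by (intro add_mono mult_mono mult_left_mono) (auto simp: algebra_simps)
  also have "\<dots> = c * v0 * (P * (1 + d) - 1)" by (simp add: algebra_simps)
  finally show ?case unfolding eqs .
qed

text \<open>A product of factors 1 + \<delta> is at most the exponential of the sum, and exp u \<le>
  1 + 2u for u \<le> 1/2 makes the error additive over the levels.\<close>

lemma tree_density_error:
  assumes y: "\<And>\<epsilon>. length \<epsilon> < L \<Longrightarrow> 0 \<le> y \<epsilon> \<and> y \<epsilon> \<le> 1 \<and> \<bar>y \<epsilon> - split_prob \<epsilon>\<bar> \<le> m0 / (2 * m1) * \<delta> (length \<epsilon>)"
    and \<delta>: "\<And>l. 0 \<le> \<delta> l" "(\<Sum>l<L. \<delta> l) \<le> 1 / 2" and x: "x \<in> {0<..1}"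
  shows "\<bar>tree_density L y x - histogram L x\<bar> \<le> 2 * m1 * (\<Sum>l<L. \<delta> l)"
proof -
  obtain w where w: "length w = L" "x \<in> dyadic_interval w" using dyadic_interval_length_ex[OF x] by blast
  have "(\<Prod>j<L. 1 + \<delta> j) \<le> (\<Prod>j<L. exp (\<delta> j))"
    using \<delta>(1) by (intro prod_mono) (auto intro: add_nonneg_nonneg)
  also have "\<dots> = exp (\<Sum>l<L. \<delta> l)" by (simp add: exp_sum)
  also have "\<dots> \<le> 1 + 2 * (\<Sum>l<L. \<delta> l)"
    using \<delta> by (intro real_exp_bound_lemma sum_nonneg) auto
  finally have P: "(\<Prod>j<L. 1 + \<delta> j) - 1 \<le> 2 * (\<Sum>l<L. \<delta> l)" by simp
  have "\<bar>tree_density L y x - histogram L x\<bar> = 2 ^ L * \<bar>tree_mass y w - cell_mass f0 w\<bar>"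
    using tree_density_eq[OF w, of y] histogram_eq[OF w(2)] w(1)
    by (simp add: abs_mult flip: right_diff_distrib)
  also have "\<dots> \<le> 2 ^ L * (cell_mass f0 w * (2 * (\<Sum>l<L. \<delta> l)))"
    using tree_mass_relative_error[where y = y and \<delta> = \<delta> and L = L and w = w] y w P cell_mass_pos[of w]
    by (intro mult_left_mono) (auto intro: order_trans[OF _ mult_left_mono])
  also have "\<dots> = 2 ^ L * cell_mass f0 w * (2 * (\<Sum>l<L. \<delta> l))" by simp
  also have "\<dots> \<le> m1 * (2 * (\<Sum>l<L. \<delta> l))"
    using cell_mass_bounds(2)[of w] w \<delta> by (intro mult_right_mono) (auto simp: field_simps sum_nonneg)
  finally show ?thesis by simp
qed

text \<open>All deviations are measured against the expected count \<open>n * cell_mass f0 \<epsilon>\<close>, which the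
  depth condition makes much larger than \<open>ln n\<close>.\<close>

lemma good_sample_counts:
  assumes n: "n \<ge> 2" and good: "good_sample n L X" and \<epsilon>: "length \<epsilon> < L"
    and depth: "32 / m0 * ln (real n) \<le> real n / 2 ^ L"
  defines "N0 \<equiv> sample_count n X (dyadic_interval (\<epsilon> @ [False]))"
    and "N1 \<equiv> sample_count n X (dyadic_interval (\<epsilon> @ [True]))"
  shows "N0 > 0" "N1 > 0" "real n * cell_mass f0 \<epsilon> / 2 \<le> real (N0 + N1)"
    and "high n (length \<epsilon>) \<Longrightarrow> (real N0 - real N1)\<^sup>2 / real (N0 + N1) \<le> (4 / m0 + 128) * ln (real n)"
    and "\<bar>real N0 / real (N0 + N1) - split_prob \<epsilon>\<bar> \<le> 4 * sqrt (8 / m0) * (sqrt (noise n) * sqrt 2 ^ length \<epsilon>)"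
proof -
  define t where "t = ln (real n)"
  define \<mu> where "\<mu> v = real n * cell_mass f0 v" for v
  define N where "N v = real (sample_count n X (dyadic_interval v))" for v
  have t: "t > 0" using n by (simp add: t_def)
  have \<mu>_ge: "real n * m0 / 2 ^ length v \<le> \<mu> v" for v
    using mult_left_mono[OF cell_mass_bounds(1)[of v], of "real n"] by (simp add: \<mu>_def)
  have \<mu>_large: "32 * t \<le> \<mu> v" if "length v \<le> L" for v
  proof -
    have "32 * t \<le> real n * m0 / 2 ^ L" using depth m0_pos by (simp add: t_def field_simps)
    also have "\<dots> \<le> real n * m0 / 2 ^ length v"
      using that m0_pos by (intro divide_left_mono power_increasing) auto
    finally show ?thesis using \<mu>_ge[of v] by simp
  qed
  have \<mu>_pos: "\<mu> v > 0" for v using n cell_mass_pos[of v] by (simp add: \<mu>_def)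
  have dev: "\<bar>N v - \<mu> v\<bar> \<le> sqrt (8 * \<mu> v * t)" if "length v \<le> L" for v
    using good that by (simp add: good_sample_def N_def \<mu>_def t_def)
  \<comment> \<open>The origin of 32: \<open>sqrt (8 * \<mu> * t)\<close> is at most \<mu>/2 exactly
    when \<mu> is at least 32t.\<close>
  have half: "\<mu> v / 2 \<le> N v" if "length v \<le> L" for v
  proof -
    have "sqrt (8 * \<mu> v * t) \<le> sqrt ((\<mu> v / 2)\<^sup>2)"
      using mult_left_mono[OF \<mu>_large[OF that], of "\<mu> v / 4"] \<mu>_pos[of v]
      by (intro real_sqrt_le_mono) (simp add: power2_eq_square)
    also have "\<dots> = \<mu> v / 2" using \<mu>_pos[of v] by (intro real_sqrt_unique) auto
    finally show ?thesis using dev[OF that] by linarith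
  qed
  define \<mu>0 \<mu>1 \<mu>\<epsilon> where \<mu>s: "\<mu>0 = \<mu> (\<epsilon> @ [False])" "\<mu>1 = \<mu> (\<epsilon> @ [True])" "\<mu>\<epsilon> = \<mu> \<epsilon>"
  have sum: "\<mu>\<epsilon> = \<mu>0 + \<mu>1" unfolding \<mu>s \<mu>_def using cell_mass_children[of \<epsilon>] by (simp add: algebra_simps)
  have pos: "\<mu>0 > 0" "\<mu>1 > 0" "\<mu>\<epsilon> > 0" unfolding \<mu>s by (simp_all add: \<mu>_pos)
  have N01: "N (\<epsilon> @ [False]) = real N0" "N (\<epsilon> @ [True]) = real N1" "N \<epsilon> = real (N0 + N1)"
    by (simp_all add: N_def N0_def N1_def sample_count_children[of n X \<epsilon>])
  \<comment> \<open>The deviation allowed for the parent cell also dominates those of the two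
    lighter children, so one D serves all three counts.\<close>
  define D where "D = sqrt (8 * \<mu>\<epsilon> * t)"
  have dev0: "\<bar>real N0 - \<mu>0\<bar> \<le> D"
  proof -
    have "sqrt (8 * \<mu>0 * t) \<le> D"
      unfolding D_def using sum pos t by (intro real_sqrt_le_mono mult_right_mono) auto
    then show ?thesis using dev[of "\<epsilon> @ [False]"] \<epsilon> unfolding N01 \<mu>s[symmetric] by simp
  qed
  have dev1: "\<bar>real N1 - \<mu>1\<bar> \<le> D"
  proof -
    have "sqrt (8 * \<mu>1 * t) \<le> D"
      unfolding D_def using sum pos t by (intro real_sqrt_le_mono mult_right_mono) auto
    then show ?thesis using dev[of "\<epsilon> @ [True]"] \<epsilon> unfolding N01 \<mu>s[symmetric] by simp
  qed
  have dev\<epsilon>: "\<bar>real (N0 + N1) - \<mu>\<epsilon>\<bar> \<le> D"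
    using dev[of \<epsilon>] \<epsilon> unfolding D_def N01 \<mu>s[symmetric] by simp
  have D: "D\<^sup>2 = 8 * \<mu>\<epsilon> * t" "D \<ge> 0" using pos t by (auto simp: D_def)
  show "N0 > 0" "N1 > 0"
    using half[of "\<epsilon> @ [False]"] half[of "\<epsilon> @ [True]"] \<epsilon> pos unfolding N01 \<mu>s[symmetric]
    by (auto intro: gr0I)
  show N_half: "real n * cell_mass f0 \<epsilon> / 2 \<le> real (N0 + N1)"
    using half[of \<epsilon>] \<epsilon> unfolding N01 by (simp add: \<mu>_def)
  then have N_half': "\<mu>\<epsilon> / 2 \<le> real (N0 + N1)" by (simp add: \<mu>s \<mu>_def)
  have Npos: "real (N0 + N1) > 0" using N_half' pos by linarith
  let ?P = "2 ^ length \<epsilon> :: real"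
  have n_le: "real n / ?P \<le> \<mu>\<epsilon> / m0"
    using \<mu>_ge[of \<epsilon>] m0_pos by (simp add: \<mu>s field_simps)
  show "(real N0 - real N1)\<^sup>2 / real (N0 + N1) \<le> (4 / m0 + 128) * ln (real n)" if "high n (length \<epsilon>)"
  proof -
    define A where "A = \<bar>\<mu>0 - \<mu>1\<bar>"
    have A: "A = real n * \<bar>cell_mass f0 (\<epsilon> @ [True]) - cell_mass f0 (\<epsilon> @ [False])\<bar>"
      unfolding A_def \<mu>s \<mu>_def by (simp add: abs_mult abs_minus_commute flip: right_diff_distrib)
    also have "\<dots> \<le> real n * (sqrt (noise n) / 2 powr (real (length \<epsilon>) / 2))"
      using cell_mass_diff_le[of \<epsilon>] that unfolding high_def
      by (intro mult_left_mono) (auto intro: order_trans[OF _ divide_right_mono])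
    finally have "A\<^sup>2 \<le> (real n * (sqrt (noise n) / 2 powr (real (length \<epsilon>) / 2)))\<^sup>2"
      by (intro power_mono) (auto simp: A_def)
    also have "\<dots> = (real n)\<^sup>2 * noise n / (2 powr (real (length \<epsilon>) / 2))\<^sup>2"
      using noise_pos[OF n] by (simp add: power_mult_distrib power_divide)
    also have "(2 powr (real (length \<epsilon>) / 2))\<^sup>2 = ?P"
      by (subst powr_numeral[symmetric]) (simp_all add: powr_powr powr_realpow)
    also have "(real n)\<^sup>2 * noise n / ?P = t * (real n / ?P)"
      using n by (simp add: noise_def t_def power2_eq_square)
    also have "\<dots> \<le> t * (\<mu>\<epsilon> / m0)" using n_le t by (intro mult_left_mono) auto
    finally have A2: "A\<^sup>2 \<le> \<mu>\<epsilon> * t / m0" by (simp add: mult.commute)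
    \<comment> \<open>With \<open>A\<^sup>2\<close> at most \<mu>t/m0 and \<open>D\<^sup>2\<close> =
      8\<mu>t, the bound \<open>2 * A\<^sup>2 + 8 * D\<^sup>2\<close> is at most (2/m0 + 64)\<mu>t;
      dividing by a count of at least \<mu>/2 gives the constant 4/m0 + 128.\<close>
    have "\<bar>real N0 - real N1\<bar> \<le> A + 2 * D" using dev0 dev1 unfolding A_def by linarith
    then have "(real N0 - real N1)\<^sup>2 \<le> (A + 2 * D)\<^sup>2"
      using power_mono[of "\<bar>real N0 - real N1\<bar>" "A + 2 * D" 2] by simp
    also have "\<dots> \<le> 2 * A\<^sup>2 + 8 * D\<^sup>2"
      using zero_le_power2[of "A - 2 * D"] by (simp add: power2_eq_square algebra_simps)
    also have "\<dots> \<le> 2 * (\<mu>\<epsilon> * t / m0) + 8 * (8 * \<mu>\<epsilon> * t)"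
      using A2 D(1) by simp
    also have "\<dots> = (\<mu>\<epsilon> / 2) * ((4 / m0 + 128) * t)" by (simp add: algebra_simps)
    also have "\<dots> \<le> real (N0 + N1) * ((4 / m0 + 128) * t)"
      using N_half' t m0_pos by (intro mult_right_mono) auto
    finally show ?thesis using Npos by (simp add: t_def divide_le_eq mult.commute)
  qed
  have "\<bar>real N0 / real (N0 + N1) - \<mu>0 / \<mu>\<epsilon>\<bar> \<le> 4 * D / \<mu>\<epsilon>"
  proof -
    define r where "r = \<mu>0 / \<mu>\<epsilon>"
    have r: "0 \<le> r" "r \<le> 1" "\<mu>0 = r * \<mu>\<epsilon>" using pos sum by (auto simp: r_def)
    \<comment> \<open>Numerator and denominator are centred together: since
      \<open>\<mu>0 = r * \<mu>\<epsilon>\<close> the means cancel and only deviations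
      remain.\<close>
    have "real N0 / real (N0 + N1) - r = ((real N0 - \<mu>0) - r * (real (N0 + N1) - \<mu>\<epsilon>)) / real (N0 + N1)"
      using Npos r(3) by (simp add: field_simps)
    also have "\<bar>\<dots>\<bar> = \<bar>(real N0 - \<mu>0) - r * (real (N0 + N1) - \<mu>\<epsilon>)\<bar> / real (N0 + N1)"
      using Npos by simp
    also have "\<dots> \<le> (2 * D) / (\<mu>\<epsilon> / 2)"
    proof (intro frac_le)
      have "\<bar>r * (real (N0 + N1) - \<mu>\<epsilon>)\<bar> \<le> 1 * D"
        unfolding abs_mult using r dev\<epsilon> by (intro mult_mono) auto
      then show "\<bar>(real N0 - \<mu>0) - r * (real (N0 + N1) - \<mu>\<epsilon>)\<bar> \<le> 2 * D"
        using dev0 by linarith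
    qed (use N_half' pos D in auto)
    finally show ?thesis by (simp add: r_def)
  qed
  also have "\<mu>0 / \<mu>\<epsilon> = split_prob \<epsilon>"
    using n by (simp add: \<mu>s \<mu>_def split_prob_def)
  also have "4 * D / \<mu>\<epsilon> = 4 * (D / \<mu>\<epsilon>)" by simp
  also have "D / \<mu>\<epsilon> \<le> sqrt (8 / m0) * (sqrt (noise n) * sqrt 2 ^ length \<epsilon>)"
  proof -
    have "D / \<mu>\<epsilon> = sqrt (8 * t / \<mu>\<epsilon>)"
    proof -
      have "sqrt (8 * t / \<mu>\<epsilon>) = sqrt (8 * \<mu>\<epsilon> * t / \<mu>\<epsilon>\<^sup>2)"
        using pos by (simp add: power2_eq_square)
      also have "\<dots> = D / \<mu>\<epsilon>" unfolding D_def real_sqrt_divide using pos by simp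
      finally show ?thesis by simp
    qed
    also have "\<dots> \<le> sqrt (8 / m0 * (noise n * ?P))"
    proof (intro real_sqrt_le_mono)
      have "8 * t / \<mu>\<epsilon> \<le> 8 * t / (real n * m0 / ?P)"
        using \<mu>_ge[of \<epsilon>] n m0_pos t pos by (intro divide_left_mono) (auto simp: \<mu>s)
      then show "8 * t / \<mu>\<epsilon> \<le> 8 / m0 * (noise n * ?P)"
        by (simp add: noise_def t_def mult_ac)
    qed
    also have "\<dots> = sqrt (8 / m0) * (sqrt (noise n) * sqrt 2 ^ length \<epsilon>)"
      by (simp only: real_sqrt_mult real_sqrt_power)
    finally show ?thesis .
  qed
  finally show "\<bar>real N0 / real (N0 + N1) - split_prob \<epsilon>\<bar>
      \<le> 4 * sqrt (8 / m0) * (sqrt (noise n) * sqrt 2 ^ length \<epsilon>)" by simp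
qed

end

section \<open>Contraction\<close>

lemma sample_count_le: "sample_count n X A \<le> n"
  unfolding sample_count_def using card_mono[of "{..<n}" "{i. i < n \<and> X i \<in> A}"] by auto

context haar_regular_density
begin

text \<open>The first summand covers the distance of the empirical split from the true one; the second
  makes \<open>exp (- N r\<^sup>2 / 2)\<close> small enough to offset the prior weight \<open>n powr (- 2 * \<kappa>)\<close> of the slab.\<close>

definition split_tol :: "real \<Rightarrow> real" where
  "split_tol \<kappa> = 4 * sqrt (8 / m0) + sqrt (4 * (2 * \<kappa> + 3) / m0)"

definition bad_split :: "real \<Rightarrow> nat \<Rightarrow> word \<Rightarrow> real set" where
  "bad_split \<kappa> n \<epsilon> = (if high n (length \<epsilon>) then - {1/2}
     else {y. split_tol \<kappa> * (sqrt (noise n) * sqrt 2 ^ length \<epsilon>) < \<bar>y - split_prob \<epsilon>\<bar>})"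

lemma bad_split_sets: "bad_split \<kappa> n \<epsilon> \<in> sets borel"
proof -
  have "{y. t < \<bar>y - s\<bar>} \<in> sets borel" for t s :: real by measurable
  then show ?thesis by (simp add: bad_split_def)
qed

text \<open>The constant of \<open>split_posterior_tail_le\<close> with c = m0/(8 m1): true splits
  stay 4c away from 0 and 1, and half of this margin is given up to the empirical ones.\<close>

definition beta_const :: "real \<Rightarrow> real" where
  "beta_const a = 4 * Beta a a / (m0 / (8 * m1)) powr (2 * a - 1)"

lemma beta_const_nonneg: "a \<ge> 1 \<Longrightarrow> 0 \<le> beta_const a"
  by (simp add: beta_const_def Beta_def)

text \<open>Two separate estimates under one bound: high levels yield 2, low levels
  \<open>2 * beta_const a\<close>, each over the square of n, and the constant is their sum. The
  condition \<open>depth\<close> controls the counts, \<open>depth'\<close> keeps the empirical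
  split away from 0 and 1.\<close>

lemma bad_split_posterior_le:
  fixes n L :: nat
  assumes n: "n \<ge> 2" and good: "good_sample n L X" and \<epsilon>: "length \<epsilon> < L"
    and L: "real L \<le> 2 * ln (real n)" and a: "a \<ge> 1"
    and \<kappa>: "\<kappa> \<ge> 16 / m0 + 520"
    and depth: "32 / m0 * ln (real n) \<le> real n / 2 ^ L"
    and depth': "(16 * (8 / m0)) / (m0 / (4 * m1))\<^sup>2 * ln (real n) \<le> real n / 2 ^ L"
    and high_ge: "\<And>l. high n l \<Longrightarrow> ln (real n) / 4 \<le> real l"
  defines "\<mu> \<equiv> spike_slab (slab_weight \<kappa> L (\<epsilon> @ [False])) a a"
  shows "(\<integral>\<^sup>+ y. ennreal (node_lik n X \<epsilon> y) * indicator (bad_split \<kappa> n \<epsilon>) y \<partial>\<mu>)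
    \<le> ennreal ((2 + 2 * beta_const a) / (real n)\<^sup>2) * (\<integral>\<^sup>+ y. ennreal (node_lik n X \<epsilon> y) \<partial>\<mu>)"
proof -
  define t where "t = ln (real n)"
  define N0 N1 where N_defs: "N0 = sample_count n X (dyadic_interval (\<epsilon> @ [False]))"
    "N1 = sample_count n X (dyadic_interval (\<epsilon> @ [True]))"
  define s where "s = sqrt (noise n) * sqrt 2 ^ length \<epsilon>"
  define p where "p = slab_weight \<kappa> L (\<epsilon> @ [False])"
  note counts = good_sample_counts[OF n good \<epsilon> depth, folded N_defs s_def t_def]
  have t: "t > 0" using n by (simp add: t_def)
  have exp_t: "exp t = real n" using n by (simp add: t_def)
  have "0 < 16 / m0" using m0_pos by simp
  then have \<kappa>1: "\<kappa> \<ge> 1" using \<kappa> by linarith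
  note p_bounds = slab_weight_bounds[OF \<kappa>1 \<epsilon>, folded p_def]
  have exp2: "exp (- 2 * t) = 1 / (real n)\<^sup>2"
    using exp_of_nat_mult[of 2 t] exp_t by (simp add: exp_minus field_simps)
  have bc: "0 \<le> beta_const a" by (rule beta_const_nonneg[OF a])
  have mono: "ennreal x * y \<le> ennreal x' * y" if "x \<le> x'" for x x' y
    using that by (intro mult_right_mono ennreal_leI) auto
  show ?thesis
  proof (cases "high n (length \<epsilon>)")
    case True
    have "(\<integral>\<^sup>+ y. ennreal (node_lik n X \<epsilon> y) * indicator (bad_split \<kappa> n \<epsilon>) y \<partial>\<mu>)
      \<le> ennreal (p / (1 - p) * exp ((real N0 - real N1)\<^sup>2 / real (N0 + N1)))
        * (\<integral>\<^sup>+ y. ennreal (node_lik n X \<epsilon> y) \<partial>\<mu>)"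
      unfolding \<mu>_def p_def[symmetric] N_defs[symmetric] bad_split_def if_P[OF True]
      using p_bounds a counts(1,2) by (intro slab_posterior_le) auto
    also have "\<dots> \<le> ennreal ((2 + 2 * beta_const a) / (real n)\<^sup>2)
        * (\<integral>\<^sup>+ y. ennreal (node_lik n X \<epsilon> y) \<partial>\<mu>)"
    proof (rule mono)
      have "p / (1 - p) * exp ((real N0 - real N1)\<^sup>2 / real (N0 + N1))
        \<le> (2 * exp (- \<kappa> * real (length \<epsilon>))) * exp ((4 / m0 + 128) * t)"
        using p_bounds counts(4)[OF True] by (intro mult_mono) auto
      also have "\<dots> = 2 * exp (- \<kappa> * real (length \<epsilon>) + (4 / m0 + 128) * t)"
        by (simp only: exp_add mult.assoc)
      also have "\<dots> \<le> 2 * exp (- 2 * t)"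
      proof -
        \<comment> \<open>The origin of \<kappa>0: a quarter of 16/m0 + 520 is (4/m0 + 128) + 2, the
          exponent of the likelihood gain plus the 2 of the target.\<close>
        have "(16 / m0 + 520) * (t / 4) \<le> \<kappa> * real (length \<epsilon>)"
          using \<kappa> high_ge[OF True] t \<kappa>1 unfolding t_def[symmetric] by (intro mult_mono) auto
        moreover have "(16 / m0 + 520) * (t / 4) = (4 / m0 + 128) * t + 2 * t"
          by (simp add: algebra_simps)
        ultimately show ?thesis by simp
      qed
      also have "\<dots> \<le> (2 + 2 * beta_const a) / (real n)\<^sup>2"
        unfolding exp2 using bc by (simp add: divide_right_mono)
      finally show "p / (1 - p) * exp ((real N0 - real N1)\<^sup>2 / real (N0 + N1))
        \<le> (2 + 2 * beta_const a) / (real n)\<^sup>2" .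
    qed
    finally show ?thesis .
  next
    case False
    define c where "c = m0 / (8 * m1)"
    define D where "D = sqrt (4 * (2 * \<kappa> + 3) / m0)"
    define q where "q = real N0 / real (N0 + N1)"
    have c: "c > 0" using m0_pos m_bounds by (simp add: c_def)
    have D: "D \<ge> 0" "D\<^sup>2 = 4 * (2 * \<kappa> + 3) / m0" using \<kappa>1 m0_pos by (auto simp: D_def)
    have s: "s \<ge> 0" "s\<^sup>2 = noise n * 2 ^ length \<epsilon>"
    proof -
      have "(sqrt 2 ^ length \<epsilon>)\<^sup>2 = (sqrt 2)\<^sup>2 ^ length \<epsilon>"
        by (simp only: power_mult[symmetric] mult.commute)
      then show "s \<ge> 0" "s\<^sup>2 = noise n * 2 ^ length \<epsilon>"
        using noise_pos[OF n] by (auto simp: s_def power_mult_distrib)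
    qed
    have q_dev: "\<bar>q - split_prob \<epsilon>\<bar> \<le> 4 * sqrt (8 / m0) * s"
      using counts(5) by (simp add: q_def)
    have small: "4 * sqrt (8 / m0) * s \<le> 2 * c"
    proof (rule power2_le_imp_le)
      have "s\<^sup>2 \<le> t / (real n / 2 ^ L)"
        unfolding s(2) noise_def t_def[symmetric] using \<epsilon> t by (auto intro!: divide_right_mono mult_left_mono)
      moreover have "(16 * (8 / m0)) * (t / (real n / 2 ^ L)) \<le> (m0 / (4 * m1))\<^sup>2"
        using depth' n m0_pos m_bounds unfolding t_def[symmetric]
        by (simp add: field_simps)
      ultimately have "(16 * (8 / m0)) * s\<^sup>2 \<le> (m0 / (4 * m1))\<^sup>2"
        using m0_pos mult_left_mono[of "s\<^sup>2" "t / (real n / 2 ^ L)" "16 * (8 / m0)"] by simp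
      moreover have "2 * c = m0 / (4 * m1)" by (simp add: c_def)
      ultimately show "(4 * sqrt (8 / m0) * s)\<^sup>2 \<le> (2 * c)\<^sup>2"
        using m0_pos by (simp add: power_mult_distrib)
    qed (use c in simp)
    have "m0 / (2 * m1) = 4 * c" by (simp add: c_def)
    then have q: "2 * c \<le> q" "q \<le> 1 - 2 * c"
      using split_prob_bounds[of \<epsilon>] q_dev small by linarith+
    have far: "D * s \<le> \<bar>y - q\<bar>" if "y \<in> bad_split \<kappa> n \<epsilon>" for y
    proof -
      have "4 * sqrt (8 / m0) * s + D * s < \<bar>y - split_prob \<epsilon>\<bar>"
        using that False by (simp add: bad_split_def split_tol_def s_def D_def distrib_right)
      then show ?thesis using q_dev by linarith
    qed
    have "(\<integral>\<^sup>+ y. ennreal (node_lik n X \<epsilon> y) * indicator (bad_split \<kappa> n \<epsilon>) y \<partial>\<mu>)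
      \<le> ennreal (4 * Beta a a / c powr (2 * a - 1) * real (N0 + N1) / p * exp (- real (N0 + N1) * (D * s)\<^sup>2 / 2))
        * (\<integral>\<^sup>+ y. ennreal (node_lik n X \<epsilon> y) \<partial>\<mu>)"
      unfolding \<mu>_def p_def[symmetric] N_defs[symmetric]
      using a p_bounds counts(1,2) c D s q far bad_split_sets
      by (intro split_posterior_tail_le) (auto simp: q_def)
    also have "\<dots> \<le> ennreal ((2 + 2 * beta_const a) / (real n)\<^sup>2)
        * (\<integral>\<^sup>+ y. ennreal (node_lik n X \<epsilon> y) \<partial>\<mu>)"
    proof (rule mono)
      have N_le: "real (N0 + N1) \<le> exp t"
        unfolding exp_t N_defs sample_count_children[symmetric] using sample_count_le by simp
      have p_ge: "exp (- (2 * \<kappa> * t)) / 2 \<le> p"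
      proof -
        have "- (2 * \<kappa> * t) \<le> - \<kappa> * real L"
          using mult_left_mono[OF L, of \<kappa>] \<kappa>1 by (simp add: t_def algebra_simps)
        then have "exp (- (2 * \<kappa> * t)) / 2 \<le> exp (- \<kappa> * real L) / 2" by simp
        then show ?thesis using p_bounds(4) by linarith
      qed
      \<comment> \<open>The count is at least half its mean, and the mean times
        \<open>s\<^sup>2\<close> is at least m0 times t; the factor 4/m0 in \<open>D\<^sup>2\<close>
        cancels m0 and both halves. The sum 2\<kappa> + 3 is spent as 1 for the factor N, 2\<kappa>
        for dividing by the slab weight, and 2 for the target.\<close>
      have expo: "(2 * \<kappa> + 3) * t \<le> real (N0 + N1) * (D * s)\<^sup>2 / 2"
      proof -
        have "m0 \<le> cell_mass f0 \<epsilon> * 2 ^ length \<epsilon>"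
          using cell_mass_bounds(1)[of \<epsilon>] by (simp add: field_simps)
        then have "(2 * \<kappa> + 3) * t / m0 * m0 \<le> (2 * \<kappa> + 3) * t / m0 * (cell_mass f0 \<epsilon> * 2 ^ length \<epsilon>)"
          using t \<kappa>1 m0_pos by (intro mult_left_mono) auto
        also have "\<dots> = real n * cell_mass f0 \<epsilon> / 2 * (D\<^sup>2 * s\<^sup>2) / 2"
        proof -
          have t_eq: "t = real n * noise n" using n by (simp add: noise_def t_def)
          show ?thesis unfolding D s t_eq using m0_pos by (simp add: field_simps)
        qed
        also have "\<dots> \<le> real (N0 + N1) * (D\<^sup>2 * s\<^sup>2) / 2"
          using counts(3) by (intro divide_right_mono mult_right_mono) auto
        finally show ?thesis using m0_pos by (simp add: power_mult_distrib)
      qed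
      have "4 * Beta a a / c powr (2 * a - 1) * real (N0 + N1) / p * exp (- real (N0 + N1) * (D * s)\<^sup>2 / 2)
        \<le> beta_const a * exp t / (exp (- (2 * \<kappa> * t)) / 2) * exp (- ((2 * \<kappa> + 3) * t))"
        unfolding c_def beta_const_def[symmetric]
      proof (intro mult_mono frac_le mult_left_mono iffD2[OF exp_le_cancel_iff])
        show "- real (N0 + N1) * (D * s)\<^sup>2 / 2 \<le> - ((2 * \<kappa> + 3) * t)"
          using expo unfolding mult_minus_left by linarith
      qed (use bc N_le p_ge p_bounds(1) in auto)
      also have "\<dots> = 2 * beta_const a * exp (t + 2 * \<kappa> * t - (2 * \<kappa> + 3) * t)"
      proof -
        have "b * exp t / (exp (- u) / 2) * exp (- v) = 2 * b * exp (t + u - v)" for b u v :: real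
          by (simp add: exp_add exp_diff exp_minus field_simps)
        then show ?thesis .
      qed
      also have "t + 2 * \<kappa> * t - (2 * \<kappa> + 3) * t = - 2 * t" by (simp add: algebra_simps)
      also have "2 * beta_const a * exp (- 2 * t) \<le> (2 + 2 * beta_const a) / (real n)\<^sup>2"
        unfolding exp2 by (simp add: divide_right_mono)
      finally show "4 * Beta a a / c powr (2 * a - 1) * real (N0 + N1) / p * exp (- real (N0 + N1) * (D * s)\<^sup>2 / 2)
        \<le> (2 + 2 * beta_const a) / (real n)\<^sup>2" .
    qed
    finally show ?thesis .
  qed
qed

text \<open>The relative error at a level: the absolute bounds from
  \<open>split_prob_near_half\<close> and from the tolerance, multiplied by
  \<open>2 * m1 / m0\<close>.\<close>

definition split_error :: "real \<Rightarrow> nat \<Rightarrow> nat \<Rightarrow> real" where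
  "split_error \<kappa> n l = (if high n l then R * m1 / m0\<^sup>2 * decay ^ l
     else 2 * m1 / m0 * split_tol \<kappa> * (sqrt (noise n) * sqrt 2 ^ l))"

definition error_const :: "real \<Rightarrow> real" where
  "error_const \<kappa> = R * m1 / m0\<^sup>2 * (R powr (- (2 * \<alpha> / (2 * \<alpha> + 1))) / (1 - decay))
     + 2 * m1 / m0 * split_tol \<kappa> * (R powr (1 / (2 * \<alpha> + 1)) * (sqrt 2 / (sqrt 2 - 1)))"

lemma split_tol_nonneg: "\<kappa> \<ge> 1 \<Longrightarrow> 0 \<le> split_tol \<kappa>"
  using m0_pos by (simp add: split_tol_def)

lemma split_error_nonneg: "n \<ge> 2 \<Longrightarrow> \<kappa> \<ge> 1 \<Longrightarrow> 0 \<le> split_error \<kappa> n l"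
  using R_pos m0_pos m_bounds decay split_tol_nonneg[of \<kappa>] noise_pos[of n]
  by (auto simp: split_error_def intro!: mult_nonneg_nonneg divide_nonneg_nonneg)

lemma rate_nonneg: "0 \<le> rate n"
  by (simp add: rate_def)

lemma sum_split_error_le:
  assumes n: "n \<ge> 2" and \<kappa>: "\<kappa> \<ge> 1"
  shows "(\<Sum>l<L. split_error \<kappa> n l) \<le> error_const \<kappa> * rate n"
proof -
  let ?H = "{l \<in> {..<L}. high n l}" and ?W = "{l \<in> {..<L}. \<not> high n l}"
  let ?a = "R * m1 / m0\<^sup>2" and ?b = "2 * m1 / m0 * split_tol \<kappa>"
  have ab: "?a \<ge> 0" "?b \<ge> 0" using R_pos m0_pos m_bounds split_tol_nonneg[OF \<kappa>] by auto
  have "(\<Sum>l<L. split_error \<kappa> n l) = (\<Sum>l\<in>?H \<union> ?W. split_error \<kappa> n l)"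
    by (intro sum.cong) auto
  also have "\<dots> = (\<Sum>l\<in>?H. split_error \<kappa> n l) + (\<Sum>l\<in>?W. split_error \<kappa> n l)"
    by (intro sum.union_disjoint) auto
  also have "(\<Sum>l\<in>?H. split_error \<kappa> n l) = ?a * (\<Sum>l\<in>?H. decay ^ l)"
    unfolding sum_distrib_left by (intro sum.cong) (auto simp: split_error_def)
  also have "(\<Sum>l\<in>?W. split_error \<kappa> n l) = ?b * (\<Sum>l\<in>?W. sqrt (noise n) * sqrt 2 ^ l)"
    unfolding sum_distrib_left by (intro sum.cong) (auto simp: split_error_def)
  also have "?a * (\<Sum>l\<in>?H. decay ^ l) + ?b * (\<Sum>l\<in>?W. sqrt (noise n) * sqrt 2 ^ l)
    \<le> ?a * (R powr (- (2 * \<alpha> / (2 * \<alpha> + 1))) * rate n / (1 - decay))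
      + ?b * (R powr (1 / (2 * \<alpha> + 1)) * rate n * (sqrt 2 / (sqrt 2 - 1)))"
    using ab decay high_level_decay_le[OF n] low_level_noise_le[OF n] noise_pos[OF n] rate_nonneg[of n]
    by (intro add_mono mult_left_mono sum_geometric_decay_le sum_geometric_growth_le)
       (auto intro!: mult_nonneg_nonneg)
  also have "\<dots> = error_const \<kappa> * rate n"
    by (simp add: error_const_def algebra_simps)
  finally show ?thesis .
qed

lemma not_bad_split:
  assumes "y \<notin> bad_split \<kappa> n \<epsilon>"
  shows "\<bar>y - split_prob \<epsilon>\<bar> \<le> m0 / (2 * m1) * split_error \<kappa> n (length \<epsilon>)"
proof (cases "high n (length \<epsilon>)")
  case True
  then have "\<bar>y - split_prob \<epsilon>\<bar> \<le> R * decay ^ length \<epsilon> / (2 * m0)"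
    using assms split_prob_near_half[of \<epsilon>] by (simp add: bad_split_def)
  also have "\<dots> = m0 / (2 * m1) * split_error \<kappa> n (length \<epsilon>)"
    using True m0_pos m_bounds by (simp add: split_error_def power2_eq_square)
  finally show ?thesis .
next
  case False
  then have "\<bar>y - split_prob \<epsilon>\<bar> \<le> split_tol \<kappa> * (sqrt (noise n) * sqrt 2 ^ length \<epsilon>)"
    using assms by (simp add: bad_split_def)
  also have "\<dots> = m0 / (2 * m1) * split_error \<kappa> n (length \<epsilon>)"
    using False m0_pos m_bounds by (simp add: split_error_def)
  finally show ?thesis .
qed

text \<open>The first summand covers the splits down to depth L, the second the distance of
  \<open>f0\<close> from its histogram at that depth.\<close>

definition radius_const :: "real \<Rightarrow> real" where
  "radius_const \<kappa> = 2 * m1 * error_const \<kappa> + R * R powr (- (2 * \<alpha> / (2 * \<alpha> + 1))) / (1 - decay)"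

lemma sup_norm_tree_density_le:
  assumes n: "n \<ge> 2" and \<kappa>: "\<kappa> \<ge> 1" and small: "error_const \<kappa> * rate n \<le> 1 / 2" and high: "high n L"
    and y: "\<And>\<epsilon>. length \<epsilon> < L \<Longrightarrow> 0 \<le> y \<epsilon> \<and> y \<epsilon> \<le> 1 \<and> y \<epsilon> \<notin> bad_split \<kappa> n \<epsilon>"
  shows "sup_norm (\<lambda>x. tree_density L y x - f0 x) \<le> ereal (radius_const \<kappa> * rate n)"
proof -
  have [measurable]: "tree_density L y \<in> borel_measurable unit_lebesgue"
    by (simp add: measurable_restrict_space1)
  let ?S = "\<Sum>l<L. split_error \<kappa> n l"
  have S: "?S \<le> error_const \<kappa> * rate n" by (rule sum_split_error_le[OF n \<kappa>])
  have "AE x in unit_lebesgue. \<bar>tree_density L y x - f0 x\<bar> \<le> radius_const \<kappa> * rate n"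
    using histogram_approx[of L] AE_unit_lebesgue
  proof eventually_elim
    case (elim x)
    have "\<bar>tree_density L y x - histogram L x\<bar> \<le> 2 * m1 * ?S"
      using y not_bad_split split_error_nonneg[OF n \<kappa>] S small elim
      by (intro tree_density_error) auto
    also have "\<dots> \<le> 2 * m1 * (error_const \<kappa> * rate n)"
      using S m_bounds by (intro mult_left_mono) auto
    finally have 1: "\<bar>tree_density L y x - histogram L x\<bar> \<le> 2 * m1 * (error_const \<kappa> * rate n)" .
    have "\<bar>f0 x - histogram L x\<bar> \<le> R * decay ^ L / (1 - decay)" by fact
    also have "\<dots> \<le> R * (R powr (- (2 * \<alpha> / (2 * \<alpha> + 1))) * rate n) / (1 - decay)"
      using high_level_decay_le[OF n high] R_pos decay by (intro divide_right_mono mult_left_mono) auto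
    finally have 2: "\<bar>f0 x - histogram L x\<bar> \<le> R * (R powr (- (2 * \<alpha> / (2 * \<alpha> + 1))) * rate n) / (1 - decay)" .
    have "radius_const \<kappa> * rate n = 2 * m1 * (error_const \<kappa> * rate n)
      + R * (R powr (- (2 * \<alpha> / (2 * \<alpha> + 1))) * rate n) / (1 - decay)"
      by (simp add: radius_const_def algebra_simps)
    then show ?case using 1 2 by linarith
  qed
  then show ?thesis by (subst sup_norm_le_iff) measurable
qed

text \<open>A deterministic statement, uniform over good samples: at most \<open>2 ^ L\<close> \<le>
  n nodes, each bad with posterior mass O(1/n) times 1/n. The slab parameter a affects only this
  vanishing remainder.\<close>

lemma posterior_ball_ge:
  assumes "\<alpha> \<le> 1" and a: "a \<ge> 1" and \<kappa>: "\<kappa> \<ge> 16 / m0 + 520" and M: "M \<ge> radius_const \<kappa>"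
  defines "A \<equiv> \<lambda>n. {f. sup_norm (\<lambda>x. f x - f0 x) \<le> ereal (M * rate n)}"
  defines "P \<equiv> \<lambda>n X. posterior (Polya_tree (tree_depth n) a (slab_weight \<kappa> (tree_depth n))) n X"
  shows "\<forall>\<^sub>F n in sequentially. \<forall>X. good_sample n (tree_depth n) X \<longrightarrow>
    1 - (2 + 2 * beta_const a) / real n \<le> measure (P n X) (A n) \<and> measure (P n X) (A n) \<le> 1"
proof -
  have "0 < 16 / m0" using m0_pos by simp
  then have \<kappa>1: "\<kappa> \<ge> 1" using \<kappa> by linarith
  have "(\<lambda>n. error_const \<kappa> * rate n) \<longlonglongrightarrow> 0"
    by (rule tendsto_mult_right_zero[OF rate_tendsto_0])
  then have "\<forall>\<^sub>F n in sequentially. error_const \<kappa> * rate n < 1 / 2"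
    by (rule order_tendstoD) simp
  then show ?thesis
    using eventually_ge_at_top[of 2] high_tree_depth high_level_ge[OF \<open>\<alpha> \<le> 1\<close>]
      cells_eventually_heavy[of "32 / m0"] cells_eventually_heavy[of "(16 * (8 / m0)) / (m0 / (4 * m1))\<^sup>2"]
  proof eventually_elim
    case (elim n)
    define L where "L = tree_depth n"
    note n = elim(2) and depths = elim(5,6)[folded L_def] and high = elim(3)[folded L_def]
    note Lb = tree_depth_real_bounds[OF n, folded L_def]
    let ?p = "slab_weight \<kappa> L"
    let ?b = "(2 + 2 * beta_const a) / (real n)\<^sup>2"
    show ?case
    proof (intro allI impI)
      fix X assume good: "good_sample n (tree_depth n) X"
      note good = good[folded L_def]
      have weights: "0 \<le> ?p \<epsilon>" for \<epsilon>
        by (auto simp: slab_weight_def intro!: divide_nonneg_nonneg sum_nonneg)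
      have weights1: "?p (\<epsilon> @ [False]) < 1" if "length \<epsilon> < L" for \<epsilon>
        using slab_weight_bounds(2)[OF \<kappa>1 that] by linarith
      have sub: "tree_density L y \<in> A n"
        if "\<And>\<epsilon>. length \<epsilon> < L \<Longrightarrow> 0 \<le> y \<epsilon> \<and> y \<epsilon> \<le> 1 \<and> y \<epsilon> \<notin> bad_split \<kappa> n \<epsilon>" for y
      proof -
        have "sup_norm (\<lambda>x. tree_density L y x - f0 x) \<le> ereal (radius_const \<kappa> * rate n)"
          using elim(1) by (intro sup_norm_tree_density_le n \<kappa>1 high that) auto
        also have "\<dots> \<le> ereal (M * rate n)"
          using M rate_nonneg[of n] by (simp add: mult_right_mono)
        finally show ?thesis by (simp add: A_def)
      qed
      have X: "X i \<in> {0<..1}" if "i < n" for i using good that by (simp add: good_sample_def)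
      have b: "0 \<le> ?b" using beta_const_nonneg[OF a] by simp
      have a_pos: "0 < a" using a by simp
      have A: "{y \<in> space (split_law L (\<lambda>_. a) ?p). tree_density L y \<in> A n} \<in> sets (split_law L (\<lambda>_. a) ?p)"
        unfolding A_def by (rule sup_norm_ball_measurable[OF f0_measurable])
      have le: "(\<integral>\<^sup>+ y. ennreal (node_lik n X \<epsilon> y) * indicator (bad_split \<kappa> n \<epsilon>) y \<partial>spike_slab (?p (\<epsilon> @ [False])) a a)
          \<le> ennreal ?b * (\<integral>\<^sup>+ y. ennreal (node_lik n X \<epsilon> y) \<partial>spike_slab (?p (\<epsilon> @ [False])) a a)"
        if "length \<epsilon> < L" for \<epsilon>
        by (rule bad_split_posterior_le[OF n good that Lb(2) a \<kappa> depths]) (use elim(4) in auto)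
      note post = posterior_Polya_tree_ge[where B = "bad_split \<kappa> n" and b = "\<lambda>_. ?b",
          OF a_pos weights weights1 X bad_split_sets b le A sub]
      have P: "P n X = posterior (Polya_tree L a ?p) n X" by (simp add: P_def L_def)
      have 1: "1 - (\<Sum>\<epsilon>\<in>{\<epsilon> :: word. length \<epsilon> < L}. ?b) \<le> measure (P n X) (A n)" "measure (P n X) (A n) \<le> 1"
        unfolding P using post by blast+
      have "(\<Sum>\<epsilon>\<in>{\<epsilon> :: word. length \<epsilon> < L}. ?b) = real (card {\<epsilon> :: word. length \<epsilon> < L}) * ?b" by simp
      also have "\<dots> \<le> real n * ?b"
      proof (intro mult_right_mono)
        have "real (card {\<epsilon> :: word. length \<epsilon> < L}) \<le> real (2 ^ L)"
          using card_words_less[of L] by (intro of_nat_mono)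
        then show "real (card {\<epsilon> :: word. length \<epsilon> < L}) \<le> real n" using Lb(1) by simp
      qed (use beta_const_nonneg[OF a] in auto)
      also have "\<dots> = (2 + 2 * beta_const a) / real n" using n by (simp add: power2_eq_square)
      finally show "1 - (2 + 2 * beta_const a) / real n \<le> measure (P n X) (A n) \<and> measure (P n X) (A n) \<le> 1"
        using 1 by linarith
    qed
  qed
qed

lemma posterior_ball_converges:
  assumes "\<alpha> \<le> 1" and a: "a \<ge> 1" and \<kappa>: "\<kappa> \<ge> 16 / m0 + 520" and M: "M \<ge> radius_const \<kappa>"
  shows "converges_in_prob (\<lambda>n. iid_law n f0)
    (\<lambda>n X. measure (posterior (Polya_tree (tree_depth n) a (slab_weight \<kappa> (tree_depth n))) n X)
      {f. sup_norm (\<lambda>x. f x - f0 x) \<le> ereal (M * rate n)}) 1"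
  unfolding converges_in_prob_def
proof (intro allI impI)
  fix \<eta> :: real assume \<eta>: "\<eta> > 0"
  define Z where "Z n X = measure (posterior (Polya_tree (tree_depth n) a (slab_weight \<kappa> (tree_depth n))) n X)
      {f. sup_norm (\<lambda>x. f x - f0 x) \<le> ereal (M * rate n)}" for n X
  let ?E = "\<lambda>n. {X \<in> space (iid_law n f0). \<bar>Z n X - 1\<bar> > \<eta>}"
  have "\<forall>\<^sub>F n in sequentially. (2 + 2 * beta_const a) / real n < \<eta>"
    by (rule order_tendstoD(2)[OF lim_const_over_n \<eta>])
  moreover note posterior_ball_ge[OF assms, folded Z_def] cells_eventually_heavy[of "2 / m0"]
    eventually_ge_at_top[of 2]
  ultimately have "\<forall>\<^sub>F n in sequentially. measure (iid_law n f0) (?E n) \<le> 4 / real n"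
  proof eventually_elim
    case (elim n)
    note n = elim(4)
    let ?L = "tree_depth n"
    interpret prob_space "iid_law n f0" by (rule prob_space_iid)
    have "2 * ln (real n) \<le> real n * m0 / 2 ^ ?L"
      using elim(3) m0_pos by (simp add: field_simps)
    from bad_sample_prob_le[OF n this] obtain B where B: "B \<in> sets (iid_law n f0)"
      "prob B \<le> 4 * 2 ^ ?L / (real n)\<^sup>2" "\<And>X. X \<in> space (iid_law n f0) - B \<Longrightarrow> good_sample n ?L X"
      by blast
    \<comment> \<open>Monotonicity of the measure requires only B to be measurable, so no
      measurability of the posterior mass in X is involved.\<close>
    have "?E n \<subseteq> B"
    proof
      fix X assume X: "X \<in> ?E n"
      show "X \<in> B"
      proof (rule ccontr)
        assume "X \<notin> B"
        then have "good_sample n ?L X" using X B(3) by auto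
        then have "1 - (2 + 2 * beta_const a) / real n \<le> Z n X" "Z n X \<le> 1" using elim(2) by auto
        then show False using X elim(1) by auto
      qed
    qed
    then have "prob (?E n) \<le> prob B" using B(1) by (rule finite_measure_mono)
    also have "\<dots> \<le> 4 * real n / (real n)\<^sup>2"
      using B(2) tree_depth_real_bounds(1)[OF n]
      by (elim order_trans) (intro divide_right_mono, auto)
    also have "\<dots> = 4 / real n" using n by (simp add: power2_eq_square)
    finally show ?case .
  qed
  moreover have "(\<lambda>n. 4 / real n) \<longlonglongrightarrow> 0" by real_asymp
  ultimately have "(\<lambda>n. measure (iid_law n f0) (?E n)) \<longlonglongrightarrow> 0"
    by (rule tendsto_sandwich[OF always_eventually _ tendsto_const, rotated]) simp
  then show "(\<lambda>n. measure (iid_law n f0) {X \<in> space (iid_law n f0).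
      \<bar>measure (posterior (Polya_tree (tree_depth n) a (slab_weight \<kappa> (tree_depth n))) n X)
      {f. sup_norm (\<lambda>x. f x - f0 x) \<le> ereal (M * rate n)} - 1\<bar> > \<eta>}) \<longlonglongrightarrow> 0"
    by (simp add: Z_def)
qed

end

theorem theorem2:
  fixes m0 m1 :: real
  assumes "m0 > 0" and "m1 > 0"
  shows "\<exists>\<kappa>0 :: real. \<forall>a :: nat. \<forall>\<kappa> \<alpha> R :: real. \<forall>f0 :: real \<Rightarrow> real.
    a \<ge> 1 \<longrightarrow> \<kappa> \<ge> \<kappa>0 \<longrightarrow> 0 < \<alpha> \<longrightarrow> \<alpha> \<le> 1 \<longrightarrow> R > 0 \<longrightarrow>
    f0 \<in> haar_ball \<alpha> R \<inter> bounded_densities m0 m1 \<longrightarrow>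
    (\<exists>M0 :: real. \<forall>M \<ge> M0.
      converges_in_prob (\<lambda>n. iid_law n f0)
        (\<lambda>n X. measure
          (posterior
            (spike_slab_Polya_tree (tree_depth n) (\<lambda>_. real a) (slab_weight \<kappa> (tree_depth n)))
            n X)
          {f. sup_norm (\<lambda>x. f x - f0 x)
                \<le> ereal (M * (ln (real n) / real n) powr (\<alpha> / (2 * \<alpha> + 1)))})
        1)"
proof (rule exI[of _ "16 / m0 + 520"], intro allI impI)
  fix a :: nat and \<kappa> \<alpha> R :: real and f0 :: "real \<Rightarrow> real"
  assume a: "a \<ge> 1" and \<kappa>: "\<kappa> \<ge> 16 / m0 + 520" and \<alpha>: "0 < \<alpha>" "\<alpha> \<le> 1" and R: "R > 0"
    and f0: "f0 \<in> haar_ball \<alpha> R \<inter> bounded_densities m0 m1"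
  interpret haar_regular_density f0 m0 m1 \<alpha> R
    using assms \<alpha> R f0 by unfold_locales auto
  show "\<exists>M0 :: real. \<forall>M \<ge> M0.
      converges_in_prob (\<lambda>n. iid_law n f0)
        (\<lambda>n X. measure
          (posterior
            (spike_slab_Polya_tree (tree_depth n) (\<lambda>_. real a) (slab_weight \<kappa> (tree_depth n)))
            n X)
          {f. sup_norm (\<lambda>x. f x - f0 x)
                \<le> ereal (M * (ln (real n) / real n) powr (\<alpha> / (2 * \<alpha> + 1)))})
        1"
    \<comment> \<open>M0 is \<open>radius_const \<kappa>\<close>, which depends on \<kappa>,
      \<alpha>, R, m0 and m1, but not on a or n.\<close>
    using posterior_ball_converges[OF \<alpha>(2) _ \<kappa>, of "real a"] a
    unfolding rate_def noise_def by auto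
qed

end
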